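(* Let $M^m$ and $N$ be closed manifolds, $(N,\gamma)$ Riemannian. Let $(g(t),\phi(t))_{t\in[0,T)}$ be a smooth solution of the $(RH)_\alpha$ flow with a non-increasing coupling function $\alpha(t)\ge\underline{\alpha}>0$ for all $t\in[0,T)$. Assume that the scalar curvature satisfies $R\le R_0$ on $M\times[0,T)$. Then $$|\nabla\phi|^2\le\frac{R_0}{\underline{\alpha}}+\frac{m}{2\underline{\alpha}\,t},\qquad\forall(x,t)\in M\times(0,T).$$
   Context: $(g(t),\phi(t))$, with $g(t)$ Riemannian metrics on $M$ and $\phi(t):M\to N$ smooth maps, solves $(RH)_\alpha$ with coupling function $\alpha(t)$ (smooth in $t$) if $$\partial_t g=-2\,\mathrm{Rc}+2\alpha\,\nabla\phi\otimes\nabla\phi,\qquad \partial_t\phi=\tau_g\phi ,$$ where $\mathrm{Rc}$ is the Ricci tensor of $g(t)$, $(\nabla\phi\otimes\nabla\phi)_{ij}=\langle\nabla_i\phi,\nabla_j\phi\rangle_\gamma$, and $\tau_g\phi=\mathrm{tr}_g\nabla d\phi$ is the tension field. $|\nabla\phi|^2=g^{ij}\langle\nabla_i\phi,\nabla_j\phi\rangle_\gamma$ and $R$ is the scalar curvature of $g(t)$; $m=\dim M$. *)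

theory Defs
  imports "HOL-Analysis.Analysis"
begin

section \<open>Smooth functions on subsets of Euclidean spaces\<close>

primrec Ck_on :: "nat \<Rightarrow> 'e::euclidean_space set \<Rightarrow> ('e \<Rightarrow> 'b::real_normed_vector) \<Rightarrow> bool" where
  "Ck_on 0 S f \<longleftrightarrow> continuous_on S f"
| "Ck_on (Suc k) S f \<longleftrightarrow> (\<forall>x\<in>S. f differentiable (at x)) \<and>
     (\<forall>v. Ck_on k S (\<lambda>x. frechet_derivative f (at x) v))"

text \<open>On an arbitrary set, smooth means locally extendable to a smooth function on an open set; for
  open sets this is the usual notion. It is needed for space-time functions, whose domains
  contain the initial time \<open>t = 0\<close>.\<close>

definition smooth_on :: "'e::euclidean_space set \<Rightarrow> ('e \<Rightarrow> 'b::real_normed_vector) \<Rightarrow> bool" where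
  "smooth_on S f \<longleftrightarrow>
     (\<forall>x\<in>S. \<exists>U F. open U \<and> x \<in> U \<and> (\<forall>k. Ck_on k U F) \<and> (\<forall>y\<in>S \<inter> U. F y = f y))"

section \<open>Closed manifolds\<close>

text \<open>A chart is its domain together with its coordinate map; values of the coordinate map outside
  the domain are irrelevant.\<close>

type_synonym ('a, 'm) chart = "'a set \<times> ('a \<Rightarrow> real ^ 'm)"

definition chart_image :: "('a, 'm::finite) chart \<Rightarrow> (real ^ 'm) set" where
  "chart_image \<kappa> = snd \<kappa> ` fst \<kappa>"

definition chart_inv :: "('a, 'm::finite) chart \<Rightarrow> real ^ 'm \<Rightarrow> 'a" where
  "chart_inv \<kappa> = inv_into (fst \<kappa>) (snd \<kappa>)"

definition charts_at :: "('a, 'm::finite) chart set \<Rightarrow> 'a \<Rightarrow> ('a, 'm) chart set" where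
  "charts_at A p = {\<kappa> \<in> A. p \<in> fst \<kappa>}"

text \<open>Coordinate representation of a map; \<open>local_rep \<kappa> \<kappa>' id\<close> is the change of coordinates.\<close>

definition local_rep ::
    "('a, 'm::finite) chart \<Rightarrow> ('b, 'n::finite) chart \<Rightarrow> ('a \<Rightarrow> 'b) \<Rightarrow> real ^ 'm \<Rightarrow> real ^ 'n" where
  "local_rep \<kappa> \<mu> f = snd \<mu> \<circ> f \<circ> chart_inv \<kappa>"

definition smooth_atlas :: "'a topology \<Rightarrow> ('a, 'm::finite) chart set \<Rightarrow> bool" where
  "smooth_atlas M A \<longleftrightarrow>
     (\<Union>\<kappa>\<in>A. fst \<kappa>) = topspace M \<and>
     (\<forall>\<kappa>\<in>A. openin M (fst \<kappa>) \<and> open (chart_image \<kappa>) \<and>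
        homeomorphic_map (subtopology M (fst \<kappa>)) (top_of_set (chart_image \<kappa>)) (snd \<kappa>)) \<and>
     (\<forall>\<kappa>\<in>A. \<forall>\<kappa>'\<in>A. smooth_on (snd \<kappa> ` (fst \<kappa> \<inter> fst \<kappa>')) (local_rep \<kappa> \<kappa>' id))"

text \<open>Closed means compact without boundary. Second countability is automatic for a compact,
  locally Euclidean space. The atlas need not be maximal.\<close>

definition closed_manifold :: "'a topology \<Rightarrow> ('a, 'm::finite) chart set \<Rightarrow> bool" where
  "closed_manifold M A \<longleftrightarrow> Hausdorff_space M \<and> compact_space M \<and> smooth_atlas M A"

section \<open>Riemannian metrics\<close>

text \<open>A metric is given by its component matrices: \<open>g \<kappa> x $ i $ j\<close> is the value on the \<open>i\<close>-th and
  \<open>j\<close>-th coordinate fields of \<open>\<kappa>\<close> at the point with coordinates \<open>x\<close>. The components in different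
  charts are tied together by the transformation law of covariant 2-tensors.\<close>

type_synonym ('a, 'm) metric = "('a, 'm) chart \<Rightarrow> real ^ 'm \<Rightarrow> real ^ 'm ^ 'm"

definition riemannian_metric :: "('a, 'm::finite) chart set \<Rightarrow> ('a, 'm) metric \<Rightarrow> bool" where
  "riemannian_metric A g \<longleftrightarrow>
     (\<forall>\<kappa>\<in>A. smooth_on (chart_image \<kappa>) (g \<kappa>) \<and>
        (\<forall>x\<in>chart_image \<kappa>. transpose (g \<kappa> x) = g \<kappa> x \<and> (\<forall>v. v \<noteq> 0 \<longrightarrow> 0 < v \<bullet> (g \<kappa> x *v v)))) \<and>
     (\<forall>\<kappa>\<in>A. \<forall>\<kappa>'\<in>A. \<forall>x\<in>snd \<kappa> ` (fst \<kappa> \<inter> fst \<kappa>').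
        let J = matrix (frechet_derivative (local_rep \<kappa> \<kappa>' id) (at x))
        in g \<kappa> x = transpose J ** g \<kappa>' (local_rep \<kappa> \<kappa>' id x) ** J)"

section \<open>Curvature, energy density and tension field in coordinates\<close>

text \<open>Below, \<open>G\<close> and \<open>H\<close> are the component matrices of metrics in one chart of the domain and of
  the target respectively, and \<open>F\<close> is a coordinate representation of a map.\<close>

definition pd :: "'m::finite \<Rightarrow> (real ^ 'm \<Rightarrow> 'b::real_normed_vector) \<Rightarrow> real ^ 'm \<Rightarrow> 'b" where
  "pd i f x = frechet_derivative f (at x) (axis i 1)"

text \<open>\<open>christoffel G k i j\<close> is \<open>\<Gamma>\<^sup>k\<^sub>i\<^sub>j\<close>.\<close>

definition christoffel ::
    "(real ^ 'm::finite \<Rightarrow> real ^ 'm ^ 'm) \<Rightarrow> 'm \<Rightarrow> 'm \<Rightarrow> 'm \<Rightarrow> real ^ 'm \<Rightarrow> real" where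
  "christoffel G k i j x = (1 / 2) * (\<Sum>l\<in>UNIV. matrix_inv (G x) $ k $ l *
     (pd i (\<lambda>y. G y $ j $ l) x + pd j (\<lambda>y. G y $ i $ l) x - pd l (\<lambda>y. G y $ i $ j) x))"

text \<open>Sign convention: \<open>R(\<partial>\<^sub>i, \<partial>\<^sub>j) \<partial>\<^sub>k = \<nabla>\<^sub>i \<nabla>\<^sub>j \<partial>\<^sub>k - \<nabla>\<^sub>j \<nabla>\<^sub>i \<partial>\<^sub>k = \<Sum>\<^sub>l (riemann G l i j k) \<partial>\<^sub>l\<close>,
  and the Ricci tensor is the trace over \<open>i = l\<close>, so that round spheres have positive curvature.\<close>

definition riemann ::
    "(real ^ 'm::finite \<Rightarrow> real ^ 'm ^ 'm) \<Rightarrow> 'm \<Rightarrow> 'm \<Rightarrow> 'm \<Rightarrow> 'm \<Rightarrow> real ^ 'm \<Rightarrow> real" where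
  "riemann G l i j k x =
     pd i (christoffel G l j k) x - pd j (christoffel G l i k) x +
     (\<Sum>p\<in>UNIV. christoffel G l i p x * christoffel G p j k x -
        christoffel G l j p x * christoffel G p i k x)"

definition ricci :: "(real ^ 'm::finite \<Rightarrow> real ^ 'm ^ 'm) \<Rightarrow> real ^ 'm \<Rightarrow> real ^ 'm ^ 'm" where
  "ricci G x = (\<chi> j k. \<Sum>i\<in>UNIV. riemann G i i j k x)"

definition metric_trace :: "real ^ 'm ^ 'm \<Rightarrow> ('m::finite \<Rightarrow> 'm \<Rightarrow> 'b::real_vector) \<Rightarrow> 'b" where
  "metric_trace P S = (\<Sum>i\<in>UNIV. \<Sum>j\<in>UNIV. (matrix_inv P $ i $ j) *\<^sub>R S i j)"

definition scalar_curvature :: "(real ^ 'm::finite \<Rightarrow> real ^ 'm ^ 'm) \<Rightarrow> real ^ 'm \<Rightarrow> real" where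
  "scalar_curvature G x = metric_trace (G x) (\<lambda>i j. ricci G x $ i $ j)"

text \<open>The tensor \<open>\<nabla>\<phi> \<otimes> \<nabla>\<phi>\<close>.\<close>

definition grad_tensor_grad ::
    "(real ^ 'n::finite \<Rightarrow> real ^ 'n ^ 'n) \<Rightarrow> (real ^ 'm::finite \<Rightarrow> real ^ 'n) \<Rightarrow>
     real ^ 'm \<Rightarrow> real ^ 'm ^ 'm" where
  "grad_tensor_grad H F x = (\<chi> i j. pd i F x \<bullet> (H (F x) *v pd j F x))"

definition grad_norm_sq ::
    "(real ^ 'm::finite \<Rightarrow> real ^ 'm ^ 'm) \<Rightarrow> (real ^ 'n::finite \<Rightarrow> real ^ 'n ^ 'n) \<Rightarrow>
     (real ^ 'm \<Rightarrow> real ^ 'n) \<Rightarrow> real ^ 'm \<Rightarrow> real" where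
  "grad_norm_sq G H F x = metric_trace (G x) (\<lambda>i j. grad_tensor_grad H F x $ i $ j)"

text \<open>\<open>(\<nabla>d\<phi>)\<^sub>i\<^sub>j\<close>, with \<open>\<nabla>\<close> the connection induced on \<open>T\<^sup>*M \<otimes> \<phi>\<^sup>*TN\<close> by the two Levi-Civita
  connections.\<close>

definition hessian_map ::
    "(real ^ 'm::finite \<Rightarrow> real ^ 'm ^ 'm) \<Rightarrow> (real ^ 'n::finite \<Rightarrow> real ^ 'n ^ 'n) \<Rightarrow>
     (real ^ 'm \<Rightarrow> real ^ 'n) \<Rightarrow> real ^ 'm \<Rightarrow> 'm \<Rightarrow> 'm \<Rightarrow> real ^ 'n" where
  "hessian_map G H F x i j = (\<chi> a.
     pd i (pd j F) x $ a - (\<Sum>k\<in>UNIV. christoffel G k i j x * pd k F x $ a) +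
     (\<Sum>b\<in>UNIV. \<Sum>c\<in>UNIV. christoffel H a b c (F x) * pd i F x $ b * pd j F x $ c))"

definition tension ::
    "(real ^ 'm::finite \<Rightarrow> real ^ 'm ^ 'm) \<Rightarrow> (real ^ 'n::finite \<Rightarrow> real ^ 'n ^ 'n) \<Rightarrow>
     (real ^ 'm \<Rightarrow> real ^ 'n) \<Rightarrow> real ^ 'm \<Rightarrow> real ^ 'n" where
  "tension G H F x = metric_trace (G x) (hessian_map G H F x)"

section \<open>The flow\<close>

text \<open>The time interval \<open>[0,T)\<close>, where \<open>T = \<infinity>\<close> is allowed.\<close>

definition time_dom :: "ereal \<Rightarrow> real set" where
  "time_dom T = {t. 0 \<le> t \<and> ereal t < T}"

definition smooth_metric_family ::
    "('a, 'm::finite) chart set \<Rightarrow> real set \<Rightarrow> (real \<Rightarrow> ('a, 'm) metric) \<Rightarrow> bool" where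
  "smooth_metric_family A I g \<longleftrightarrow>
     (\<forall>t\<in>I. riemannian_metric A (g t)) \<and>
     (\<forall>\<kappa>\<in>A. smooth_on (chart_image \<kappa> \<times> I) (\<lambda>(x, t). g t \<kappa> x))"

definition smooth_map_family ::
    "'a topology \<Rightarrow> ('a, 'm::finite) chart set \<Rightarrow> 'b topology \<Rightarrow> ('b, 'n::finite) chart set \<Rightarrow>
     real set \<Rightarrow> (real \<Rightarrow> 'a \<Rightarrow> 'b) \<Rightarrow> bool" where
  "smooth_map_family M A N B I \<phi> \<longleftrightarrow>
     continuous_map (prod_topology M (top_of_set I)) N (\<lambda>(p, t). \<phi> t p) \<and>
     (\<forall>\<kappa>\<in>A. \<forall>\<mu>\<in>B.
        smooth_on {(x, t). x \<in> chart_image \<kappa> \<and> t \<in> I \<and> \<phi> t (chart_inv \<kappa> x) \<in> fst \<mu>}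
          (\<lambda>(x, t). local_rep \<kappa> \<mu> (\<phi> t) x))"

text \<open>The derivatives in time are one-sided at \<open>t = 0\<close>. Both equations are tensorial; they are
  required in all charts around the point and its image.\<close>

definition RH_flow ::
    "'a topology \<Rightarrow> ('a, 'm::finite) chart set \<Rightarrow>
     'b topology \<Rightarrow> ('b, 'n::finite) chart set \<Rightarrow> ('b, 'n) metric \<Rightarrow>
     (real \<Rightarrow> real) \<Rightarrow> real set \<Rightarrow> (real \<Rightarrow> ('a, 'm) metric) \<Rightarrow> (real \<Rightarrow> 'a \<Rightarrow> 'b) \<Rightarrow> bool" where
  "RH_flow M A N B \<gamma> \<alpha> I g \<phi> \<longleftrightarrow>
     smooth_on I \<alpha> \<and> smooth_metric_family A I g \<and> smooth_map_family M A N B I \<phi> \<and>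
     (\<forall>t\<in>I. \<forall>p\<in>topspace M. \<forall>\<kappa>\<in>charts_at A p. \<forall>\<mu>\<in>charts_at B (\<phi> t p).
        let x = snd \<kappa> p; F = local_rep \<kappa> \<mu> (\<phi> t) in
          ((\<lambda>s. g s \<kappa> x) has_vector_derivative
             (-2) *\<^sub>R ricci (g t \<kappa>) x + (2 * \<alpha> t) *\<^sub>R grad_tensor_grad (\<gamma> \<mu>) F x) (at t within I) \<and>
          ((\<lambda>s. local_rep \<kappa> \<mu> (\<phi> s) x) has_vector_derivative
             tension (g t \<kappa>) (\<gamma> \<mu>) F x) (at t within I))"

end

theory Submission
  imports Defs
begin

text \<open>Put \<open>S\<^sub>i\<^sub>j = R\<^sub>i\<^sub>j - \<alpha> \<langle>\<nabla>\<^sub>i\<phi>, \<nabla>\<^sub>j\<phi>\<rangle> = - \<partial>\<^sub>t g\<^sub>i\<^sub>j / 2\<close> and let \<open>S = R - \<alpha> |\<nabla>\<phi>|\<^sup>2\<close> be its trace. The variation of the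
  scalar curvature, the contracted Bianchi identity and \<open>\<partial>\<^sub>t \<phi> = \<tau>\<close> give
  \<open>\<partial>\<^sub>t S = \<Delta>S + 2 |S\<^sub>i\<^sub>j|\<^sup>2 + 2 \<alpha> |\<tau>|\<^sup>2 - \<alpha>' |\<nabla>\<phi>|\<^sup>2\<close>, so at a spatial minimum
  \<open>\<partial>\<^sub>t S \<ge> 2 S\<^sup>2 / m\<close>. If \<open>(t - \<epsilon>) S\<close> had a minimum below \<open>- m / 2\<close> over \<open>M \<times> [\<epsilon>, t\<^sub>1]\<close>, its time
  derivative there would be positive, which is absurd; hence \<open>S \<ge> - m / (2 t)\<close> as \<open>\<epsilon> \<rightarrow> 0\<close>, and
  \<open>\<alpha> |\<nabla>\<phi>|\<^sup>2 = R - S\<close> is bounded.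

  No tensoriality of the curvature has to be proved: \<open>S\<close> is the trace of \<open>- \<partial>\<^sub>t g / 2\<close>, and \<open>\<partial>\<^sub>t g\<close>
  transforms like \<open>g\<close> because changes of coordinates do not depend on time.\<close>

section \<open>The evolution of the trace as an identity in a differential ring\<close>

text \<open>Done with functions, every product rule in the evolution equation would need its own
  differentiability argument. Germs of smooth functions form a commutative ring whose elements can
  all be differentiated, so the equation becomes matrix algebra over a ring with commuting
  derivations; analysis returns only when germs are built and evaluated. A ring without division
  shapes the formulas: \<open>g\<close> and \<open>P\<close> are two matrices tied by
  \<open>g ** P = mat 1\<close>, and identities appear doubled. The constant m / 2: let
  \<open>K\<close> be \<partial>_t g with one index raised. Then trace K = -2 S and 4 |S_ij|^2 =
  trace (K ** K), so Cauchy-Schwarz for the m diagonal entries gives |S_ij|^2 \<ge> S^2 / m. For w =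
  (t - \<epsilon>) S the time derivative at a spatial minimum is therefore at least S (1 + 2 w / m),
  a product of two negative numbers as soon as w < - m / 2. The shift by \<epsilon> makes w vanish
  on the initial slice, so that the minimum is not attained there, and keeps the argument at
  positive times, where the domain is open and time derivatives are two-sided.\<close>

definition derivation :: "('r::comm_ring_1 \<Rightarrow> 'r) \<Rightarrow> bool" where
  "derivation \<delta> \<longleftrightarrow> (\<forall>a b. \<delta> (a + b) = \<delta> a + \<delta> b) \<and> (\<forall>a b. \<delta> (a * b) = \<delta> a * b + a * \<delta> b)"

lemma
  assumes "derivation \<delta>"
  shows derivation_add: "\<delta> (a + b) = \<delta> a + \<delta> b"
    and derivation_mult: "\<delta> (a * b) = \<delta> a * b + a * \<delta> b"
  using assms by (auto simp: derivation_def)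

lemma derivation_0: "derivation \<delta> \<Longrightarrow> \<delta> 0 = 0"
  using derivation_add[of \<delta> 0 0] by simp

lemma derivation_1: "derivation \<delta> \<Longrightarrow> \<delta> 1 = 0"
  using derivation_mult[of \<delta> 1 1] by simp

lemma derivation_minus: "derivation \<delta> \<Longrightarrow> \<delta> (- a) = - \<delta> a"
  using derivation_add[of \<delta> a "- a"] by (simp add: derivation_0 eq_neg_iff_add_eq_0 add.commute)

lemma derivation_diff: "derivation \<delta> \<Longrightarrow> \<delta> (a - b) = \<delta> a - \<delta> b"
  using derivation_add[of \<delta> a "- b"] by (simp add: derivation_minus)

lemma derivation_sum: "derivation \<delta> \<Longrightarrow> \<delta> (\<Sum>i\<in>I. f i) = (\<Sum>i\<in>I. \<delta> (f i))"
  by (induction I rule: infinite_finite_induct) (auto simp: derivation_0 derivation_add)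

definition dmat :: "('r \<Rightarrow> 'r) \<Rightarrow> 'r ^ 'n ^ 'm \<Rightarrow> 'r ^ 'n ^ 'm" where
  "dmat \<delta> A = (\<chi> i j. \<delta> (A $ i $ j))"

lemma dmat_nth [simp]: "dmat \<delta> A $ i $ j = \<delta> (A $ i $ j)"
  by (simp add: dmat_def)

lemma
  assumes "derivation \<delta>"
  shows dmat_add: "dmat \<delta> (A + B) = dmat \<delta> A + dmat \<delta> B"
    and dmat_diff: "dmat \<delta> (A - B) = dmat \<delta> A - dmat \<delta> B"
    and dmat_minus: "dmat \<delta> (- A) = - dmat \<delta> A"
    and dmat_mult: "dmat \<delta> (C ** D) = dmat \<delta> C ** D + C ** dmat \<delta> D"
  using assms by (simp_all add: vec_eq_iff derivation_add derivation_diff derivation_minus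
      matrix_matrix_mult_def derivation_sum derivation_mult sum.distrib)

lemma dmat_one: "derivation \<delta> \<Longrightarrow> dmat \<delta> (mat 1) = 0"
  by (simp add: vec_eq_iff mat_def derivation_0 derivation_1)

lemma dmat_transpose: "dmat \<delta> (transpose A) = transpose (dmat \<delta> A)"
  by (simp add: vec_eq_iff transpose_def)

lemma
  fixes A :: "'r::comm_ring_1 ^ 'n::finite ^ 'm::finite"
  shows matrix_diff_ldistrib: "A ** (B - C) = A ** B - A ** C"
    and matrix_minus_right: "A ** (- B) = - (A ** B)"
    and matrix_zero_right: "A ** (0 :: 'r ^ 'l ^ 'n) = 0"
  by (simp_all add: vec_eq_iff matrix_matrix_mult_def right_diff_distrib sum_subtractf sum_negf)

lemma
  fixes A :: "'r::comm_ring_1 ^ 'n::finite ^ 'm::finite"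
  shows matrix_add_rdistrib': "(A + B) ** C = A ** C + B ** C"
    and matrix_diff_rdistrib: "(A - B) ** C = A ** C - B ** C"
    and matrix_minus_left: "(- A) ** C = - (A ** C)"
    and matrix_zero_left: "(0 :: 'r ^ 'n ^ 'm) ** C = 0"
  by (simp_all add: vec_eq_iff matrix_matrix_mult_def left_diff_distrib distrib_right
      sum_subtractf sum_negf sum.distrib)

lemma
  fixes A :: "'r::comm_ring_1 ^ 'n::finite ^ 'm::finite"
  shows transpose_add: "transpose (A + B) = transpose A + transpose B"
    and transpose_diff: "transpose (A - B) = transpose A - transpose B"
  by (simp_all add: vec_eq_iff transpose_def)

text \<open>A normal form for noncommutative expressions: sums of right-nested products, in which
  equal terms can cancel.\<close>

lemmas matrix_ring_simps =
  matrix_add_ldistrib matrix_diff_ldistrib matrix_minus_right matrix_zero_right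
  matrix_add_rdistrib' matrix_diff_rdistrib matrix_minus_left matrix_zero_left
  matrix_mul_assoc[symmetric]

text \<open>Differentiate \<open>g ** P = mat 1\<close> and multiply by \<open>P\<close> from the
  left. Used for the space and for the time derivatives.\<close>

lemma dmat_inverse:
  assumes "derivation \<delta>" "g ** P = mat 1" "P ** g = mat 1"
  shows "dmat \<delta> P = - (P ** dmat \<delta> g ** P)"
proof -
  have "dmat \<delta> (g ** P) = 0"
    using assms by (simp add: dmat_one)
  then have "P ** (dmat \<delta> g ** P + g ** dmat \<delta> P) = 0"
    by (simp only: dmat_mult[OF assms(1)] matrix_zero_right)
  then have "P ** dmat \<delta> g ** P + (P ** g) ** dmat \<delta> P = 0"
    by (simp add: matrix_ring_simps)
  then show ?thesis
    using assms by (simp add: eq_neg_iff_add_eq_0 add.commute)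
qed

section \<open>Curvature of the Levi-Civita connection and the contracted Bianchi identity\<close>

text \<open>The ring stands for the functions near a point of space-time and \<open>d i\<close> for the coordinate
  derivations. \<open>\<Gamma> i $ l $ k\<close> is \<open>\<Gamma>\<^sup>l\<^sub>i\<^sub>k\<close>, so that \<open>\<Gamma> i\<close> is a connection matrix and \<open>F i j\<close> the
  curvature matrix; \<open>E i j\<close> is \<open>F i j\<close> with its lower index raised, which makes it skew. \<open>Q\<close> is the
  Ricci tensor with its second index raised, and \<open>div1\<close>, \<open>div2\<close> below are the covariant divergences of
  \<open>X\<^sup>i\<close> and of \<open>A\<^sub>m\<^sup>i\<close>.\<close>

locale levi_civita =
  fixes d :: "'m::finite \<Rightarrow> 'r::comm_ring_1 \<Rightarrow> 'r"
    and g P :: "'r ^ 'm ^ 'm" and \<Gamma> :: "'m \<Rightarrow> 'r ^ 'm ^ 'm"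
  assumes der: "derivation (d i)"
    and d_commute: "d i (d j a) = d j (d i a)"
    and g_sym: "transpose g = g" and gP: "g ** P = mat 1" and Pg: "P ** g = mat 1"
    and \<Gamma>_sym: "\<Gamma> i $ l $ k = \<Gamma> k $ l $ i"
    and twice_eq_0: "\<And>x :: 'r. x + x = 0 \<Longrightarrow> x = 0"
    and compat: "dmat (d i) g = transpose (\<Gamma> i) ** g + g ** \<Gamma> i"
begin

definition F where
  "F i j = dmat (d i) (\<Gamma> j) - dmat (d j) (\<Gamma> i) + \<Gamma> i ** \<Gamma> j - \<Gamma> j ** \<Gamma> i"

definition E where "E i j = F i j ** P"

definition Ric where "Ric = (\<chi> j k. \<Sum>i\<in>UNIV. F i j $ i $ k)"

definition Q where "Q = Ric ** P"

definition R where "R = trace Q"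

lemma P_sym: "transpose P = P"
proof -
  have "transpose P = transpose P ** (g ** P)" by (simp add: gP)
  also have "\<dots> = transpose (g ** P) ** P"
    by (simp add: matrix_transpose_mul g_sym matrix_mul_assoc)
  finally show ?thesis by (simp add: gP)
qed

lemma P_sym': "P $ i $ j = P $ j $ i"
  using arg_cong[OF P_sym, of "\<lambda>A. A $ i $ j"] by (simp add: transpose_def)

lemma dmat_commute: "dmat (d i) (dmat (d j) A) = dmat (d j) (dmat (d i) A)"
  by (simp add: vec_eq_iff d_commute)

lemma dP: "dmat (d i) P = - (\<Gamma> i ** P + P ** transpose (\<Gamma> i))"
proof -
  have "dmat (d i) P = - (P ** (transpose (\<Gamma> i) ** g + g ** \<Gamma> i) ** P)"
    by (simp add: dmat_inverse[OF der gP Pg] compat)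
  also have "P ** (transpose (\<Gamma> i) ** g + g ** \<Gamma> i) ** P
      = P ** transpose (\<Gamma> i) ** (g ** P) + (P ** g) ** \<Gamma> i ** P"
    by (simp add: matrix_ring_simps)
  finally show ?thesis by (simp add: gP Pg add.commute)
qed

lemma F_antisym: "F j i = - F i j"
  by (simp add: F_def)

lemma E_antisym: "E j i = - E i j"
  by (simp add: E_def F_antisym[of i j] matrix_minus_left)

text \<open>Second derivatives of \<open>g\<close> commute. When both orders are expanded with
  \<open>compat\<close>, the mixed terms cancel and the curvature acting on \<open>g\<close> from
  both sides remains.\<close>

lemma gF: "g ** F i j + transpose (F i j) ** g = 0"
proof -
  have dd: "dmat (d i) (dmat (d j) g) =
      transpose (dmat (d i) (\<Gamma> j)) ** g + transpose (\<Gamma> j) ** (transpose (\<Gamma> i) ** g + g ** \<Gamma> i)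
      + (transpose (\<Gamma> i) ** g + g ** \<Gamma> i) ** \<Gamma> j + g ** dmat (d i) (\<Gamma> j)" for i j
    by (simp add: compat dmat_add dmat_mult der dmat_transpose[symmetric])
  show ?thesis
    using dmat_commute[of i j g] unfolding dd F_def
    by (simp add: matrix_ring_simps transpose_add transpose_diff matrix_transpose_mul algebra_simps)
qed

lemma E_skew: "transpose (E i j) = - E i j"
proof -
  have "P ** (g ** F i j + transpose (F i j) ** g) ** P = 0"
    by (simp add: gF matrix_zero_right matrix_zero_left)
  then have "(P ** g) ** F i j ** P + P ** transpose (F i j) ** (g ** P) = 0"
    by (simp add: matrix_ring_simps)
  then show ?thesis
    by (simp add: gP Pg E_def matrix_transpose_mul P_sym eq_neg_iff_add_eq_0 add.commute)
qed

lemma E_skew': "E i j $ l $ k = - E i j $ k $ l"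
  using arg_cong[OF E_skew, of "\<lambda>A. A $ k $ l"] by (simp add: transpose_def)

lemma E_antisym': "E i j $ l $ k = - E j i $ l $ k"
  by (simp add: E_antisym[of i j])

text \<open>A covariant derivative with Christoffel corrections for the two matrix indices only.
  Those for \<open>i\<close> and \<open>j\<close> would cancel in the cyclic sum of
  \<open>bianchi\<close>; in single traces their absence shows as extra terms.\<close>

definition DE where "DE m i j = dmat (d m) (E i j) + \<Gamma> m ** E i j + E i j ** transpose (\<Gamma> m)"

text \<open>Second Bianchi identity. As \<open>P\<close> is parallel, it reduces to the curvature
  matrices, where second derivatives cancel in pairs by \<open>dmat_commute\<close> and the
  remaining products cancel by associativity.\<close>

lemma bianchi: "DE m i j + DE i j m + DE j m i = 0"
proof -
  have DF: "DE m i j = (dmat (d m) (F i j) + \<Gamma> m ** F i j - F i j ** \<Gamma> m) ** P" for m i j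
    by (simp add: DE_def E_def dmat_mult der dP matrix_ring_simps)
  have "dmat (d m) (F i j) + \<Gamma> m ** F i j - F i j ** \<Gamma> m
    + (dmat (d i) (F j m) + \<Gamma> i ** F j m - F j m ** \<Gamma> i)
    + (dmat (d j) (F m i) + \<Gamma> j ** F m i - F m i ** \<Gamma> j) = 0"
    using dmat_commute[of m i "\<Gamma> j"] dmat_commute[of i j "\<Gamma> m"] dmat_commute[of j m "\<Gamma> i"]
    by (simp add: F_def dmat_add dmat_diff dmat_mult der matrix_ring_simps algebra_simps)
  then have "(dmat (d m) (F i j) + \<Gamma> m ** F i j - F i j ** \<Gamma> m
    + (dmat (d i) (F j m) + \<Gamma> i ** F j m - F j m ** \<Gamma> i)
    + (dmat (d j) (F m i) + \<Gamma> j ** F m i - F m i ** \<Gamma> j)) ** P = 0"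
    by (simp add: matrix_zero_left)
  then show ?thesis
    unfolding DF by (simp add: matrix_add_rdistrib')
qed

lemma Q_eq: "Q $ m $ k = (\<Sum>j\<in>UNIV. E j m $ j $ k)"
proof -
  have "Q $ m $ k = (\<Sum>p\<in>UNIV. \<Sum>i\<in>UNIV. F i m $ i $ p * P $ p $ k)"
    by (simp add: Q_def Ric_def matrix_matrix_mult_def sum_distrib_right)
  also have "\<dots> = (\<Sum>i\<in>UNIV. \<Sum>p\<in>UNIV. F i m $ i $ p * P $ p $ k)"
    by (rule sum.swap)
  finally show ?thesis by (simp add: E_def matrix_matrix_mult_def)
qed

lemma R_eq: "R = (\<Sum>i\<in>UNIV. \<Sum>j\<in>UNIV. E i j $ i $ j)"
  unfolding R_def trace_def Q_eq by (rule sum.swap)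

definition div2 :: "'r ^ 'm ^ 'm \<Rightarrow> 'm \<Rightarrow> 'r" where
  "div2 A m = (\<Sum>i\<in>UNIV. d i (A $ m $ i)) +
     (\<Sum>i\<in>UNIV. \<Sum>p\<in>UNIV. \<Gamma> i $ i $ p * A $ m $ p) - (\<Sum>i\<in>UNIV. \<Sum>p\<in>UNIV. \<Gamma> i $ p $ m * A $ p $ i)"


definition div1 :: "'r ^ 'm \<Rightarrow> 'r" where
  "div1 X = (\<Sum>i\<in>UNIV. d i (X $ i)) + (\<Sum>i\<in>UNIV. \<Sum>p\<in>UNIV. \<Gamma> i $ i $ p * X $ p)"

text \<open>Exchanging the indices shows that the sum is its own negative; \<open>twice_eq_0\<close>
  replaces division by 2.\<close>

lemma sum_sym_skew:
  assumes "\<And>i j. a i j = a j i" "\<And>i j. b i j = - b j i"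
  shows "(\<Sum>i\<in>UNIV. \<Sum>j\<in>UNIV. a i j * b i (j::'m)) = (0::'r)"
proof (rule twice_eq_0)
  have "(\<Sum>i\<in>UNIV. \<Sum>j\<in>UNIV. a i j * b i j) = (\<Sum>j\<in>UNIV. \<Sum>i\<in>UNIV. a i j * b i j)"
    by (rule sum.swap)
  also have "\<dots> = - (\<Sum>j\<in>UNIV. \<Sum>i\<in>UNIV. a j i * b j i)"
  proof -
    have "a i j * b i j = - (a j i * b j i)" for i j
      by (subst assms(1), subst assms(2)) simp
    then show ?thesis unfolding sum_negf[symmetric] by (intro sum.cong refl)
  qed
  finally show "(\<Sum>i\<in>UNIV. \<Sum>j\<in>UNIV. a i j * b i j) + (\<Sum>i\<in>UNIV. \<Sum>j\<in>UNIV. a i j * b i j) = 0"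
    by (simp add: eq_neg_iff_add_eq_0)
qed

lemma DE_antisym: "DE m j i = - DE m i j"
  by (simp add: DE_def E_antisym[of i j] dmat_minus der matrix_ring_simps)

lemma DE_skew: "transpose (DE m i j) = - DE m i j"
  by (simp add: DE_def transpose_add matrix_transpose_mul dmat_transpose[symmetric] E_skew
      dmat_minus der matrix_ring_simps algebra_simps)

lemma DE_skew': "DE m i j $ l $ k = - DE m i j $ k $ l"
  using arg_cong[OF DE_skew, of "\<lambda>A. A $ k $ l"] by (simp add: transpose_def)

lemma Q_eq': "(\<Sum>j\<in>UNIV. E i j $ p $ j) = Q $ i $ p"
  unfolding Q_eq by (subst E_skew', subst E_antisym') simp

text \<open>The first of the three traces of \<open>bianchi\<close>. The remainder behind
  \<open>d m R\<close> comes from the uncorrected lower indices; it supplies, twice, the third sum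
  of \<open>div2\<close>, which the other two traces lack.\<close>

lemma trace_DE_1:
  "(\<Sum>i\<in>UNIV. \<Sum>j\<in>UNIV. DE m i j $ i $ j) = d m R + 2 * (\<Sum>i\<in>UNIV. \<Sum>p\<in>UNIV. \<Gamma> i $ p $ m * Q $ p $ i)"
proof -
  have a: "(\<Sum>i\<in>UNIV. \<Sum>j\<in>UNIV. \<Sum>p\<in>UNIV. \<Gamma> m $ i $ p * E i j $ p $ j)
      = (\<Sum>i\<in>UNIV. \<Sum>p\<in>UNIV. \<Gamma> i $ p $ m * Q $ p $ i)"
  proof -
    have "(\<Sum>i\<in>UNIV. \<Sum>j\<in>UNIV. \<Sum>p\<in>UNIV. \<Gamma> m $ i $ p * E i j $ p $ j)
        = (\<Sum>i\<in>UNIV. \<Sum>p\<in>UNIV. \<Sum>j\<in>UNIV. \<Gamma> m $ i $ p * E i j $ p $ j)"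
      by (rule sum.cong[OF refl], rule sum.swap)
    also have "\<dots> = (\<Sum>i\<in>UNIV. \<Sum>p\<in>UNIV. \<Gamma> p $ i $ m * Q $ i $ p)"
      by (simp add: sum_distrib_left[symmetric] Q_eq' \<Gamma>_sym[of m])
    also have "\<dots> = (\<Sum>p\<in>UNIV. \<Sum>i\<in>UNIV. \<Gamma> p $ i $ m * Q $ i $ p)"
      by (rule sum.swap)
    finally show ?thesis .
  qed
  have b: "(\<Sum>i\<in>UNIV. \<Sum>j\<in>UNIV. \<Sum>p\<in>UNIV. E i j $ i $ p * \<Gamma> m $ j $ p)
      = (\<Sum>i\<in>UNIV. \<Sum>p\<in>UNIV. \<Gamma> i $ p $ m * Q $ p $ i)"
  proof -
    have "(\<Sum>i\<in>UNIV. \<Sum>j\<in>UNIV. \<Sum>p\<in>UNIV. E i j $ i $ p * \<Gamma> m $ j $ p)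
        = (\<Sum>i\<in>UNIV. \<Sum>p\<in>UNIV. \<Sum>j\<in>UNIV. E i j $ i $ p * \<Gamma> m $ j $ p)"
      by (rule sum.cong[OF refl], rule sum.swap)
    also have "\<dots> = (\<Sum>p\<in>UNIV. \<Sum>i\<in>UNIV. \<Sum>j\<in>UNIV. E i j $ i $ p * \<Gamma> m $ j $ p)"
      by (rule sum.swap)
    also have "\<dots> = (\<Sum>p\<in>UNIV. \<Sum>j\<in>UNIV. \<Sum>i\<in>UNIV. E i j $ i $ p * \<Gamma> m $ j $ p)"
      by (rule sum.cong[OF refl], rule sum.swap)
    also have "\<dots> = (\<Sum>p\<in>UNIV. \<Sum>j\<in>UNIV. \<Gamma> p $ j $ m * Q $ j $ p)"
      by (simp only: sum_distrib_right[symmetric] Q_eq[symmetric] \<Gamma>_sym[of m] mult.commute[of "Q $ _ $ _"])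
    finally show ?thesis .
  qed
  show ?thesis
    by (simp add: DE_def sum.distrib matrix_matrix_mult_def transpose_def a b R_eq
        derivation_sum[OF der])
qed

lemma trace_DE_2:
  "(\<Sum>i\<in>UNIV. \<Sum>j\<in>UNIV. DE i j m $ i $ j) =
     - (\<Sum>i\<in>UNIV. d i (Q $ m $ i)) - (\<Sum>i\<in>UNIV. \<Sum>p\<in>UNIV. \<Gamma> i $ i $ p * Q $ m $ p)"
proof -
  have q: "(\<Sum>j\<in>UNIV. E j m $ i $ j) = - Q $ m $ i" for i
    unfolding Q_eq by (subst E_skew') (simp add: sum_negf)
  have a: "(\<Sum>i\<in>UNIV. \<Sum>j\<in>UNIV. \<Sum>p\<in>UNIV. \<Gamma> i $ i $ p * E j m $ p $ j)
     = - (\<Sum>i\<in>UNIV. \<Sum>p\<in>UNIV. \<Gamma> i $ i $ p * Q $ m $ p)"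
  proof -
    have "(\<Sum>i\<in>UNIV. \<Sum>j\<in>UNIV. \<Sum>p\<in>UNIV. \<Gamma> i $ i $ p * E j m $ p $ j)
        = (\<Sum>i\<in>UNIV. \<Sum>p\<in>UNIV. \<Sum>j\<in>UNIV. \<Gamma> i $ i $ p * E j m $ p $ j)"
      by (rule sum.cong[OF refl], rule sum.swap)
    then show ?thesis
      by (simp add: sum_distrib_left[symmetric] q sum_negf)
  qed
  \<comment> \<open>The Christoffel symbol is symmetric in the summed indices \<open>i\<close> and
    \<open>p\<close>, and \<open>E j m\<close> is skew in them.\<close>
  have b: "(\<Sum>i\<in>UNIV. \<Sum>j\<in>UNIV. \<Sum>p\<in>UNIV. E j m $ i $ p * \<Gamma> i $ j $ p) = 0"
  proof -
    have "(\<Sum>i\<in>UNIV. \<Sum>p\<in>UNIV. \<Gamma> i $ j $ p * E j m $ i $ p) = 0" for j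
      by (rule sum_sym_skew) (rule \<Gamma>_sym, rule E_skew')
    moreover have "(\<Sum>i\<in>UNIV. \<Sum>j\<in>UNIV. \<Sum>p\<in>UNIV. E j m $ i $ p * \<Gamma> i $ j $ p)
        = (\<Sum>j\<in>UNIV. \<Sum>i\<in>UNIV. \<Sum>p\<in>UNIV. \<Gamma> i $ j $ p * E j m $ i $ p)"
      by (subst sum.swap) (simp add: mult.commute)
    ultimately show ?thesis by simp
  qed
  show ?thesis
    by (simp add: DE_def sum.distrib matrix_matrix_mult_def transpose_def a b
        derivation_sum[OF der, symmetric] q derivation_minus[OF der] sum_negf sum_subtractf)
qed

lemma trace_DE_3: "(\<Sum>i\<in>UNIV. \<Sum>j\<in>UNIV. DE j m i $ i $ j) = (\<Sum>i\<in>UNIV. \<Sum>j\<in>UNIV. DE i j m $ i $ j)"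
proof -
  have "DE j m i $ i $ j = DE j i m $ j $ i" for i j
    by (simp add: DE_antisym[of j m i] DE_skew'[of j i m i j])
  then have "(\<Sum>i\<in>UNIV. \<Sum>j\<in>UNIV. DE j m i $ i $ j) = (\<Sum>i\<in>UNIV. \<Sum>j\<in>UNIV. DE j i m $ j $ i)"
    by simp
  also have "\<dots> = (\<Sum>j\<in>UNIV. \<Sum>i\<in>UNIV. DE j i m $ j $ i)"
    by (rule sum.swap)
  finally show ?thesis .
qed

lemma contracted_bianchi: "d m R = 2 * div2 Q m"
proof -
  have "(\<Sum>i\<in>UNIV. \<Sum>j\<in>UNIV. (DE m i j + DE i j m + DE j m i) $ i $ j) = 0"
    by (simp only: bianchi) simp
  then have "(\<Sum>i\<in>UNIV. \<Sum>j\<in>UNIV. DE m i j $ i $ j) + (\<Sum>i\<in>UNIV. \<Sum>j\<in>UNIV. DE i j m $ i $ j)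
      + (\<Sum>i\<in>UNIV. \<Sum>j\<in>UNIV. DE j m i $ i $ j) = 0"
    by (simp only: vector_add_component sum.distrib)
  then have "d m R - 2 * div2 Q m = 0"
    unfolding trace_DE_1 trace_DE_3 trace_DE_2 div2_def
    by (simp only: mult_2 diff_conv_add_uminus minus_add_distrib minus_minus ac_simps)
  then show ?thesis by simp
qed

end

lemma matrix_mult_nth: "(A ** B) $ i $ j = (\<Sum>k\<in>UNIV. A $ i $ k * B $ k $ j)"
  by (simp add: matrix_matrix_mult_def)

lemma matrix_mult_transpose_nth: "(A ** transpose B) $ i $ j = (\<Sum>k\<in>UNIV. A $ i $ k * B $ j $ k)"
  by (simp add: matrix_matrix_mult_def transpose_def)

lemma trace_transpose: "trace (transpose A) = trace A"
  by (simp add: trace_def transpose_def)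

lemma derivation_trace: "derivation \<delta> \<Longrightarrow> \<delta> (trace A) = trace (dmat \<delta> A)"
  by (simp add: trace_def derivation_sum)

context levi_civita
begin

text \<open>The hypothesis says that \<open>B i\<close> is the covariant derivative of the mixed
  tensor \<open>A\<close>. The connection terms then cancel against those in \<open>div2\<close>,
  and in \<open>d_trace_cov\<close> they form a commutator, which has trace zero.\<close>

lemma div2_cov:
  assumes "\<And>i. dmat (d i) A = B i + transpose (\<Gamma> i) ** A - A ** transpose (\<Gamma> i)"
  shows "div2 A m = (\<Sum>i\<in>UNIV. B i $ m $ i)"
proof -
  have "d i (A $ m $ i) = B i $ m $ i + (\<Sum>p\<in>UNIV. \<Gamma> i $ p $ m * A $ p $ i) - (\<Sum>p\<in>UNIV. A $ m $ p * \<Gamma> i $ i $ p)" for i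
    using arg_cong[OF assms[of i], of "\<lambda>A. A $ m $ i"]
    by (simp add: matrix_mult_transpose_nth) (simp add: matrix_matrix_mult_def transpose_def)
  then show ?thesis
    by (simp add: div2_def sum.distrib sum_subtractf mult.commute)
qed

lemma d_trace_cov:
  assumes "dmat (d i) A = B + transpose (\<Gamma> i) ** A - A ** transpose (\<Gamma> i)"
  shows "d i (trace A) = trace B"
  using trace_mul_sym[of "transpose (\<Gamma> i)" A]
  by (simp add: derivation_trace der assms trace_add trace_sub)

lemma div2_add: "div2 (A + B) m = div2 A m + div2 B m"
  by (simp add: div2_def derivation_add[OF der] sum.distrib algebra_simps)

lemma div2_scale:
  assumes "\<And>i. d i c = 0"
  shows "div2 (\<chi> i j. c * A $ i $ j) m = c * div2 A m"
  by (simp add: div2_def derivation_mult[OF der] assms sum_distrib_left algebra_simps)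

lemma div1_add: "div1 (A + B) = div1 A + div1 B"
  by (simp add: div1_def derivation_add[OF der] sum.distrib algebra_simps)

lemma div1_scale:
  assumes "\<And>i. d i c = 0"
  shows "div1 (c *s A) = c * div1 A"
  by (simp add: div1_def derivation_mult[OF der] assms sum_distrib_left algebra_simps)

text \<open>\<open>P\<close> is parallel, so raising an index commutes with the divergence. For
  \<open>s\<close> the differential of a function the right side is its Laplacian.\<close>

lemma div1_raise:
  "div1 (P *v s) = (\<Sum>i\<in>UNIV. \<Sum>m\<in>UNIV. P $ i $ m * (d i (s $ m) - (\<Sum>k\<in>UNIV. \<Gamma> i $ k $ m * s $ k)))"
proof -
  have "d i (P $ i $ m) = - (\<Sum>p\<in>UNIV. \<Gamma> i $ i $ p * P $ p $ m) - (\<Sum>p\<in>UNIV. P $ i $ p * \<Gamma> i $ m $ p)" for i m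
    using arg_cong[OF dP[of i], of "\<lambda>A. A $ i $ m"]
    by (simp add: matrix_mult_transpose_nth) (simp add: matrix_matrix_mult_def)
  then have "(\<Sum>i\<in>UNIV. d i ((P *v s) $ i)) = (\<Sum>i\<in>UNIV. \<Sum>m\<in>UNIV. P $ i $ m * d i (s $ m))
      - (\<Sum>i\<in>UNIV. \<Sum>m\<in>UNIV. \<Sum>p\<in>UNIV. \<Gamma> i $ i $ p * P $ p $ m * s $ m)
      - (\<Sum>i\<in>UNIV. \<Sum>m\<in>UNIV. \<Sum>p\<in>UNIV. P $ i $ p * \<Gamma> i $ m $ p * s $ m)"
    by (simp add: matrix_vector_mult_def derivation_sum[OF der] derivation_mult[OF der] sum.distrib
        sum_subtractf sum_negf sum_distrib_right left_diff_distrib)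
  moreover have "(\<Sum>i\<in>UNIV. \<Sum>m\<in>UNIV. \<Sum>p\<in>UNIV. \<Gamma> i $ i $ p * P $ p $ m * s $ m)
      = (\<Sum>i\<in>UNIV. \<Sum>p\<in>UNIV. \<Gamma> i $ i $ p * (P *v s) $ p)"
    by (subst sum.swap) (simp add: matrix_vector_mult_def sum_distrib_left mult.assoc)
  moreover have "(\<Sum>i\<in>UNIV. \<Sum>m\<in>UNIV. \<Sum>p\<in>UNIV. P $ i $ p * \<Gamma> i $ m $ p * s $ m)
      = (\<Sum>i\<in>UNIV. \<Sum>m\<in>UNIV. \<Sum>k\<in>UNIV. P $ i $ m * (\<Gamma> i $ k $ m * s $ k))"
    by (subst sum.swap) (simp add: mult.assoc)
  ultimately show ?thesis
    by (simp add: div1_def right_diff_distrib sum_subtractf sum_distrib_left)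
qed

end

section \<open>Variation of the scalar curvature\<close>

locale evolving_metric = levi_civita d g P \<Gamma>
  for d :: "'m::finite \<Rightarrow> 'r::comm_ring_1 \<Rightarrow> 'r" and g P \<Gamma> +
  fixes dt :: "'r \<Rightarrow> 'r"
  assumes dt_der: "derivation dt" and dt_commute: "dt (d i a) = d i (dt a)"
begin

text \<open>\<open>V\<close> and \<open>W\<close> are the two traces of the tensor \<open>\<partial>\<^sub>t \<Gamma>\<close>; the divergence of their difference \<open>X\<close>
  is the second-order part of \<open>\<partial>\<^sub>t R\<close>.\<close>

definition h where "h = dmat dt g"
definition K where "K = h ** P"
definition C where "C i = dmat dt (\<Gamma> i)"
definition V :: "'r ^ 'm" where "V = (\<chi> l. \<Sum>j\<in>UNIV. (C j ** P) $ l $ j)"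
definition W :: "'r ^ 'm" where "W = (\<chi> i. trace (C i))"

lemma dmat_dt_commute: "dmat dt (dmat (d i) A) = dmat (d i) (dmat dt A)"
  by (simp add: vec_eq_iff dt_commute)

lemma C_sym: "C i $ l $ k = C k $ l $ i"
  by (simp add: C_def \<Gamma>_sym[of i])

lemma dtP: "dmat dt P = - (P ** h ** P)"
  by (simp add: dmat_inverse[OF dt_der gP Pg] h_def)

lemma dh: "dmat (d i) h = transpose (C i) ** g + g ** C i + transpose (\<Gamma> i) ** h + h ** \<Gamma> i"
  by (simp add: h_def dmat_dt_commute[symmetric] compat dmat_add dmat_mult dt_der dmat_transpose
      C_def algebra_simps)

text \<open>The time derivative of \<open>compat\<close>: the covariant derivative of \<partial>_t g
  is given by the tensor \<partial>_t \<Gamma>. The form is the one that \<open>div2_cov\<close> and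
  \<open>d_trace_cov\<close> expect.\<close>

lemma dK: "dmat (d i) K = transpose (C i) + g ** C i ** P + transpose (\<Gamma> i) ** K - K ** transpose (\<Gamma> i)"
proof -
  have "dmat (d i) K = transpose (C i) ** (g ** P) + g ** C i ** P + transpose (\<Gamma> i) ** K - K ** transpose (\<Gamma> i)"
    by (simp add: K_def dmat_mult der dh dP matrix_ring_simps algebra_simps)
  then show ?thesis by (simp add: gP)
qed

lemma d_trace_K: "d i (trace K) = 2 * W $ i"
proof -
  have "trace (g ** C i ** P) = trace (C i ** (P ** g))"
    using trace_mul_sym[of g "C i ** P"] by (simp add: matrix_mul_assoc)
  then show ?thesis
    using d_trace_cov[OF dK, of i] by (simp add: trace_add trace_transpose Pg W_def)
qed

lemma div2_K: "div2 K m = W $ m + (g *v V) $ m"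
proof -
  have "(\<Sum>i\<in>UNIV. C i $ i $ m) = W $ m"
    by (simp add: W_def trace_def C_sym[of _ _ m])
  moreover have "(\<Sum>i\<in>UNIV. (g ** C i ** P) $ m $ i) = (g *v V) $ m"
  proof -
    have "(\<Sum>i\<in>UNIV. (g ** (C i ** P)) $ m $ i) = (\<Sum>i\<in>UNIV. \<Sum>l\<in>UNIV. g $ m $ l * (C i ** P) $ l $ i)"
      by (simp add: matrix_mult_nth[of g])
    also have "\<dots> = (\<Sum>l\<in>UNIV. \<Sum>i\<in>UNIV. g $ m $ l * (C i ** P) $ l $ i)"
      by (rule sum.swap)
    finally show ?thesis
      by (simp add: matrix_vector_mult_def V_def sum_distrib_left matrix_mul_assoc)
  qed
  ultimately show ?thesis
    using div2_cov[OF dK, of m] by (simp add: sum.distrib transpose_def)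
qed

definition X :: "'r ^ 'm" where "X = P *v (\<chi> m. div2 K m - d m (trace K))"

text \<open>Links the two forms of the variation of R: its second-order part is div (div h) -
  \<Delta> (tr h) in terms of the metric, and the divergence of the difference of the traces of
  \<partial>_t \<Gamma> in terms of the connection.\<close>

lemma X_eq: "X = V - P *v W"
proof -
  have "X = P *v (g *v V - W)"
    by (simp add: X_def div2_K d_trace_K vec_eq_iff matrix_vector_mult_def algebra_simps)
  also have "\<dots> = (P ** g) *v V - P *v W"
    by (simp add: matrix_vector_mult_diff_distrib matrix_vector_mul_assoc)
  finally show ?thesis by (simp add: Pg)
qed

text \<open>There is no Christoffel term for the index \<open>j\<close>: it would be symmetric in
  \<open>i\<close> and \<open>j\<close>, and only \<open>DB i j - DB j i\<close> is used.\<close>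

definition DB where "DB i j = dmat (d i) (C j ** P) + \<Gamma> i ** (C j ** P) + C j ** P ** transpose (\<Gamma> i)"

text \<open>The Palatini identity; the last term arises because the index is raised with a moving
  metric.\<close>

lemma dt_E: "dmat dt (E i j) = DB i j - DB j i - E i j ** K"
  by (simp add: E_def F_def dmat_mult dmat_add dmat_diff dt_der der dtP dP dmat_dt_commute
      C_def DB_def K_def matrix_ring_simps algebra_simps)

lemma trace_DB:
  "(\<Sum>i\<in>UNIV. \<Sum>j\<in>UNIV. (DB i j - DB j i) $ i $ j) = div1 X"
proof -
  have w: "(\<Sum>i\<in>UNIV. (C i ** P) $ i $ j) = (P *v W) $ j" for j
  proof -
    have "(\<Sum>i\<in>UNIV. (C i ** P) $ i $ j) = (\<Sum>p\<in>UNIV. \<Sum>i\<in>UNIV. C i $ i $ p * P $ p $ j)"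
      by (subst sum.swap) (simp add: matrix_matrix_mult_def)
    also have "\<dots> = (P *v W) $ j"
      by (simp add: matrix_vector_mult_def W_def trace_def C_sym[of _ _ p for p] sum_distrib_right
          P_sym'[of j] mult.commute sum_distrib_left)
    finally show ?thesis .
  qed
  have v: "(\<Sum>j\<in>UNIV. (C j ** P) $ l $ j) = V $ l" for l
    by (simp add: V_def)
  \<comment> \<open>The cross term that both traces produce, by the symmetries of
    \<open>\<Gamma>\<close> and \<open>C\<close>; it cancels in their difference.\<close>
  let ?Z = "\<Sum>i\<in>UNIV. \<Sum>j\<in>UNIV. \<Sum>p\<in>UNIV. (C j ** P) $ i $ p * \<Gamma> i $ j $ p"
  have a: "(\<Sum>i\<in>UNIV. \<Sum>j\<in>UNIV. DB i j $ i $ j) = (\<Sum>i\<in>UNIV. d i (V $ i)) +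
      (\<Sum>i\<in>UNIV. \<Sum>p\<in>UNIV. \<Gamma> i $ i $ p * V $ p) + ?Z"
  proof -
    have "(\<Sum>i\<in>UNIV. \<Sum>j\<in>UNIV. \<Sum>p\<in>UNIV. \<Gamma> i $ i $ p * (C j ** P) $ p $ j)
      = (\<Sum>i\<in>UNIV. \<Sum>p\<in>UNIV. \<Gamma> i $ i $ p * V $ p)"
    proof -
      have "(\<Sum>i\<in>UNIV. \<Sum>j\<in>UNIV. \<Sum>p\<in>UNIV. \<Gamma> i $ i $ p * (C j ** P) $ p $ j)
        = (\<Sum>i\<in>UNIV. \<Sum>p\<in>UNIV. \<Sum>j\<in>UNIV. \<Gamma> i $ i $ p * (C j ** P) $ p $ j)"
        by (rule sum.cong[OF refl], rule sum.swap)
      then show ?thesis by (simp add: sum_distrib_left[symmetric] v)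
    qed
    then show ?thesis
      by (simp add: DB_def sum.distrib matrix_mult_nth[of "\<Gamma> i" for i]
          matrix_mult_transpose_nth
          derivation_sum[OF der, symmetric] v)
  qed
  have b: "(\<Sum>i\<in>UNIV. \<Sum>j\<in>UNIV. DB j i $ i $ j) = (\<Sum>j\<in>UNIV. d j ((P *v W) $ j)) +
      ?Z + (\<Sum>j\<in>UNIV. \<Sum>p\<in>UNIV. \<Gamma> j $ j $ p * (P *v W) $ p)"
  proof -
    have 1: "(\<Sum>i\<in>UNIV. \<Sum>j\<in>UNIV. \<Sum>p\<in>UNIV. \<Gamma> j $ i $ p * (C i ** P) $ p $ j) = ?Z"
    proof -
      have "(\<Sum>j\<in>UNIV. \<Sum>p\<in>UNIV. \<Gamma> j $ i $ p * (C i ** P) $ p $ j)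
          = (\<Sum>p\<in>UNIV. \<Sum>j\<in>UNIV. (C i ** P) $ p $ j * \<Gamma> p $ i $ j)" for i
        by (subst sum.swap) (simp add: mult.commute \<Gamma>_sym[of _ i])
      then show ?thesis
        by (subst sum.swap[of _ UNIV UNIV, where g = "\<lambda>i j. \<Sum>p\<in>UNIV. (C j ** P) $ i $ p * \<Gamma> i $ j $ p"]) simp
    qed
    have 2: "(\<Sum>i\<in>UNIV. \<Sum>j\<in>UNIV. \<Sum>p\<in>UNIV. (C i ** P) $ i $ p * \<Gamma> j $ j $ p)
       = (\<Sum>j\<in>UNIV. \<Sum>p\<in>UNIV. \<Gamma> j $ j $ p * (P *v W) $ p)"
    proof -
      have "(\<Sum>i\<in>UNIV. \<Sum>j\<in>UNIV. \<Sum>p\<in>UNIV. (C i ** P) $ i $ p * \<Gamma> j $ j $ p)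
        = (\<Sum>j\<in>UNIV. \<Sum>i\<in>UNIV. \<Sum>p\<in>UNIV. (C i ** P) $ i $ p * \<Gamma> j $ j $ p)"
        by (rule sum.swap)
      also have "\<dots> = (\<Sum>j\<in>UNIV. \<Sum>p\<in>UNIV. \<Sum>i\<in>UNIV. (C i ** P) $ i $ p * \<Gamma> j $ j $ p)"
        by (rule sum.cong[OF refl], rule sum.swap)
      finally show ?thesis
        by (simp only: sum_distrib_right[symmetric] w mult.commute[of "(P *v W) $ _"])
    qed
    have 3: "(\<Sum>i\<in>UNIV. \<Sum>j\<in>UNIV. d j ((C i ** P) $ i $ j)) = (\<Sum>j\<in>UNIV. d j ((P *v W) $ j))"
      by (subst sum.swap) (simp add: derivation_sum[OF der, symmetric] w)
    show ?thesis
      by (simp add: DB_def sum.distrib matrix_mult_nth[of "\<Gamma> i" for i]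
          matrix_mult_transpose_nth 1 2 3)
  qed
  show ?thesis
    by (simp add: sum_subtractf a b X_eq div1_def derivation_diff[OF der] right_diff_distrib)
qed

lemma dt_R: "dt R = - trace (Q ** K) + div1 X"
proof -
  have "(\<Sum>i\<in>UNIV. \<Sum>j\<in>UNIV. (E i j ** K) $ i $ j) = trace (Q ** K)"
  proof -
    have "(\<Sum>i\<in>UNIV. \<Sum>j\<in>UNIV. (E i j ** K) $ i $ j)
        = (\<Sum>j\<in>UNIV. \<Sum>i\<in>UNIV. \<Sum>k\<in>UNIV. E i j $ i $ k * K $ k $ j)"
      by (subst sum.swap) (simp add: matrix_matrix_mult_def)
    also have "\<dots> = (\<Sum>j\<in>UNIV. \<Sum>k\<in>UNIV. \<Sum>i\<in>UNIV. E i j $ i $ k * K $ k $ j)"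
      by (rule sum.cong[OF refl], rule sum.swap)
    finally show ?thesis
      by (simp add: sum_distrib_right[symmetric] Q_eq[symmetric] trace_def matrix_matrix_mult_def)
  qed
  moreover have "dt R = (\<Sum>i\<in>UNIV. \<Sum>j\<in>UNIV. (dmat dt (E i j)) $ i $ j)"
    by (simp add: R_eq derivation_sum[OF dt_der])
  ultimately show ?thesis
    using trace_DB by (simp add: dt_E sum_subtractf)
qed

end

section \<open>The map and the coupled flow\<close>

text \<open>\<open>\<Lambda> c $ a $ b\<close> is the Christoffel symbol \<open>\<Gamma>\<^sup>a\<^sub>c\<^sub>b\<close> of the target along \<open>\<phi>\<close>, and \<open>Lam \<delta>\<close>, \<open>cov \<delta>\<close> are
  the connection matrix and the covariant derivative pulled back by \<open>\<phi>\<close> in the direction \<open>\<delta>\<close>. Since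
  \<open>\<partial>\<^sub>t \<phi> = \<tau>\<close>, the derivatives of \<open>\<tau>\<close> cancel and no curvature of the target enters.\<close>

locale map_jet = evolving_metric d g P \<Gamma> dt
  for d :: "'m::finite \<Rightarrow> 'r::comm_ring_1 \<Rightarrow> 'r" and g P \<Gamma> dt +
  fixes \<phi> :: "'r ^ 'n::finite" and H :: "'r ^ 'n ^ 'n" and \<Lambda> :: "'n \<Rightarrow> 'r ^ 'n ^ 'n"
begin

definition Lam where "Lam \<delta> = (\<chi> a b. \<Sum>c\<in>UNIV. \<Lambda> c $ a $ b * \<delta> (\<phi> $ c))"

definition u where "u i = (\<chi> a. d i (\<phi> $ a))"

definition cov where "cov \<delta> v = (\<chi> a. \<delta> (v $ a)) + Lam \<delta> *v v"

definition hess where "hess i j = cov (d i) (u j) - (\<Sum>k\<in>UNIV. \<Gamma> i $ k $ j *s u k)"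

definition \<tau> where "\<tau> = (\<Sum>i\<in>UNIV. \<Sum>j\<in>UNIV. P $ i $ j *s hess i j)"

definition ip where "ip v w = (\<Sum>a\<in>UNIV. \<Sum>b\<in>UNIV. H $ a $ b * (v $ a * w $ b))"

definition e where "e = (\<chi> i j. ip (u i) (u j))"

end

text \<open>All that remains of the target is its metric and connection along the map.
  \<open>compat_d\<close> and \<open>compat_dt\<close> are metric compatibility in the target
  combined with the chain rule, once for each kind of derivation.\<close>

locale rh_flow_jet = map_jet d g P \<Gamma> dt \<phi> H \<Lambda>
  for d :: "'m::finite \<Rightarrow> 'r::comm_ring_1 \<Rightarrow> 'r" and g P \<Gamma> dt
    and \<phi> :: "'r ^ 'n::finite" and H \<Lambda> +
  fixes \<alpha> :: 'r
  assumes \<Lambda>_sym: "\<Lambda> c $ a $ b = \<Lambda> b $ a $ c" and H_sym: "H $ a $ b = H $ b $ a"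
    and compat_d: "dmat (d i) H = transpose (Lam (d i)) ** H + H ** Lam (d i)"
    and compat_dt: "dmat dt H = transpose (Lam dt) ** H + H ** Lam dt"
    and d_\<alpha>: "d i \<alpha> = 0"
    and flow_g: "dt (g $ j $ k) = - 2 * Ric $ j $ k + 2 * \<alpha> * e $ j $ k"
    and flow_\<phi>: "dt (\<phi> $ a) = \<tau> $ a"
begin

lemma ip_sym: "ip v w = ip w v"
  unfolding ip_def by (subst sum.swap) (simp add: H_sym mult.commute)

lemma ip_add_left: "ip (v + w) z = ip v z + ip w z"
  by (simp add: ip_def sum.distrib algebra_simps)

lemma ip_scale_left: "ip (c *s v) z = c * ip v z"
  by (simp add: ip_def sum_distrib_left ac_simps)

lemma ip_sum_left: "ip (\<Sum>i\<in>I. f i) z = (\<Sum>i\<in>I. ip (f i) z)"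
  by (induction I rule: infinite_finite_induct) (auto simp: ip_add_left, auto simp: ip_def)

text \<open>The product rule for the pulled-back connection, with \<open>\<delta>\<close> arbitrary
  because it serves both \<open>d i\<close> and \<open>dt\<close>.\<close>

lemma derivation_ip:
  assumes "derivation \<delta>" "dmat \<delta> H = transpose (Lam \<delta>) ** H + H ** Lam \<delta>"
  shows "\<delta> (ip v w) = ip (cov \<delta> v) w + ip v (cov \<delta> w)"
proof -
  have H: "\<delta> (H $ a $ b) = (\<Sum>c\<in>UNIV. Lam \<delta> $ c $ a * H $ c $ b) + (\<Sum>c\<in>UNIV. H $ a $ c * Lam \<delta> $ c $ b)" for a b
    using arg_cong[OF assms(2), of "\<lambda>A. A $ a $ b"] by (simp add: matrix_matrix_mult_def transpose_def)
  have 1: "(\<Sum>a\<in>UNIV. \<Sum>b\<in>UNIV. \<Sum>c\<in>UNIV. Lam \<delta> $ c $ a * H $ c $ b * (v $ a * w $ b))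
     = (\<Sum>a\<in>UNIV. \<Sum>b\<in>UNIV. H $ a $ b * ((Lam \<delta> *v v) $ a * w $ b))"
  proof -
    have "(\<Sum>a\<in>UNIV. \<Sum>b\<in>UNIV. \<Sum>c\<in>UNIV. Lam \<delta> $ c $ a * H $ c $ b * (v $ a * w $ b))
      = (\<Sum>a\<in>UNIV. \<Sum>c\<in>UNIV. \<Sum>b\<in>UNIV. Lam \<delta> $ c $ a * H $ c $ b * (v $ a * w $ b))"
      by (rule sum.cong[OF refl], rule sum.swap)
    also have "\<dots> = (\<Sum>c\<in>UNIV. \<Sum>a\<in>UNIV. \<Sum>b\<in>UNIV. Lam \<delta> $ c $ a * H $ c $ b * (v $ a * w $ b))"
      by (rule sum.swap)
    also have "\<dots> = (\<Sum>c\<in>UNIV. \<Sum>b\<in>UNIV. \<Sum>a\<in>UNIV. Lam \<delta> $ c $ a * H $ c $ b * (v $ a * w $ b))"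
      by (rule sum.cong[OF refl], rule sum.swap)
    finally show ?thesis
      by (simp add: matrix_vector_mult_def sum_distrib_left sum_distrib_right ac_simps)
  qed
  have 2: "(\<Sum>a\<in>UNIV. \<Sum>b\<in>UNIV. \<Sum>c\<in>UNIV. H $ a $ c * Lam \<delta> $ c $ b * (v $ a * w $ b))
     = (\<Sum>a\<in>UNIV. \<Sum>b\<in>UNIV. H $ a $ b * (v $ a * (Lam \<delta> *v w) $ b))"
  proof -
    have "(\<Sum>a\<in>UNIV. \<Sum>b\<in>UNIV. \<Sum>c\<in>UNIV. H $ a $ c * Lam \<delta> $ c $ b * (v $ a * w $ b))
      = (\<Sum>a\<in>UNIV. \<Sum>c\<in>UNIV. \<Sum>b\<in>UNIV. H $ a $ c * Lam \<delta> $ c $ b * (v $ a * w $ b))"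
      by (rule sum.cong[OF refl], rule sum.swap)
    then show ?thesis
      by (simp add: matrix_vector_mult_def sum_distrib_left sum_distrib_right ac_simps)
  qed
  have "\<delta> (ip v w) = (\<Sum>a\<in>UNIV. \<Sum>b\<in>UNIV. \<Sum>c\<in>UNIV. Lam \<delta> $ c $ a * H $ c $ b * (v $ a * w $ b))
      + (\<Sum>a\<in>UNIV. \<Sum>b\<in>UNIV. \<Sum>c\<in>UNIV. H $ a $ c * Lam \<delta> $ c $ b * (v $ a * w $ b))
      + (\<Sum>a\<in>UNIV. \<Sum>b\<in>UNIV. H $ a $ b * (\<delta> (v $ a) * w $ b)) + (\<Sum>a\<in>UNIV. \<Sum>b\<in>UNIV. H $ a $ b * (v $ a * \<delta> (w $ b)))"
    by (simp add: ip_def derivation_sum[OF assms(1)] derivation_mult[OF assms(1)] H distrib_right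
        distrib_left sum.distrib sum_distrib_right)
  then show ?thesis
    unfolding 1 2 by (simp add: cov_def ip_def distrib_left distrib_right sum.distrib)
qed

text \<open>Both connections are torsion-free and the coordinate derivations commute.\<close>

lemma hess_sym: "hess i j = hess j i"
proof -
  have "(Lam (d i) *v u j) $ a = (Lam (d j) *v u i) $ a" for a
  proof -
    have "(Lam (d i) *v u j) $ a = (\<Sum>b\<in>UNIV. \<Sum>c\<in>UNIV. \<Lambda> c $ a $ b * d i (\<phi> $ c) * d j (\<phi> $ b))"
      by (simp add: matrix_vector_mult_def Lam_def u_def sum_distrib_right)
    also have "\<dots> = (\<Sum>c\<in>UNIV. \<Sum>b\<in>UNIV. \<Lambda> c $ a $ b * d i (\<phi> $ c) * d j (\<phi> $ b))"
      by (rule sum.swap)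
    also have "\<dots> = (\<Sum>c\<in>UNIV. \<Sum>b\<in>UNIV. \<Lambda> b $ a $ c * d j (\<phi> $ b) * d i (\<phi> $ c))"
      by (intro sum.cong refl) (subst \<Lambda>_sym, simp add: ac_simps)
    also have "\<dots> = (Lam (d j) *v u i) $ a"
      by (simp add: matrix_vector_mult_def Lam_def u_def sum_distrib_right)
    finally show ?thesis .
  qed
  moreover have "(\<Sum>k\<in>UNIV. \<Gamma> i $ k $ j *s u k) = (\<Sum>k\<in>UNIV. \<Gamma> j $ k $ i *s u k)"
    by (intro sum.cong refl) (subst \<Gamma>_sym, simp)
  ultimately show ?thesis
    by (simp add: hess_def cov_def vec_eq_iff u_def d_commute[of i j])
qed

text \<open>Mixed covariant derivatives of a map agree since the target connection is torsion-free,
  and \<partial>_t \<phi> is \<tau>. The only commutation is that of derivatives of \<phi> itself,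
  which produces no curvature.\<close>

lemma cov_dt_u: "cov dt (u i) = cov (d i) \<tau>"
proof -
  have "(Lam dt *v u i) $ a = (Lam (d i) *v \<tau>) $ a" for a
  proof -
    have "(Lam dt *v u i) $ a = (\<Sum>b\<in>UNIV. \<Sum>c\<in>UNIV. \<Lambda> c $ a $ b * \<tau> $ c * d i (\<phi> $ b))"
      by (simp add: matrix_vector_mult_def Lam_def u_def sum_distrib_right flow_\<phi>)
    also have "\<dots> = (\<Sum>c\<in>UNIV. \<Sum>b\<in>UNIV. \<Lambda> c $ a $ b * \<tau> $ c * d i (\<phi> $ b))"
      by (rule sum.swap)
    also have "\<dots> = (\<Sum>c\<in>UNIV. \<Sum>b\<in>UNIV. \<Lambda> b $ a $ c * d i (\<phi> $ b) * \<tau> $ c)"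
      by (intro sum.cong refl) (subst \<Lambda>_sym, simp add: ac_simps)
    also have "\<dots> = (Lam (d i) *v \<tau>) $ a"
      by (simp add: matrix_vector_mult_def Lam_def sum_distrib_right)
    finally show ?thesis .
  qed
  then show ?thesis
    by (simp add: cov_def vec_eq_iff u_def dt_commute flow_\<phi>)
qed

lemma cov_u: "cov (d i) (u j) = hess i j + (\<Sum>k\<in>UNIV. \<Gamma> i $ k $ j *s u k)"
  by (simp add: hess_def)

definition A where "A i = (\<chi> m l. ip (hess i m) (u l))"

text \<open>\<nabla>\<phi> \<otimes> \<nabla>\<phi> with its second index raised; its trace
  \<open>N\<close> is |\<nabla>\<phi>|^2.\<close>

definition L where "L = e ** P"

definition N where "N = trace L"

definition \<sigma> where "\<sigma> = (\<chi> m. ip \<tau> (u m))"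

definition B where "B = (\<chi> i j. ip (cov (d i) \<tau>) (u j))"

definition S where "S = R - \<alpha> * N"

lemma e_sym: "transpose e = e"
  by (simp add: e_def transpose_def vec_eq_iff ip_sym)

lemma de: "dmat (d i) e = A i + transpose (A i) + transpose (\<Gamma> i) ** e + e ** \<Gamma> i"
proof -
  have a: "ip (cov (d i) (u m)) (u l) = A i $ m $ l + (transpose (\<Gamma> i) ** e) $ m $ l" for m l
    by (simp add: cov_u ip_add_left ip_sum_left ip_scale_left A_def transpose_def matrix_matrix_mult_def e_def)
  have "d i (e $ m $ l) = ip (cov (d i) (u m)) (u l) + ip (cov (d i) (u l)) (u m)" for m l
    using derivation_ip[OF der compat_d, of i "u m" "u l"] by (simp add: e_def ip_sym[of "u m"])
  then have "dmat (d i) e = A i + transpose (\<Gamma> i) ** e + transpose (A i + transpose (\<Gamma> i) ** e)"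
    by (simp add: a vec_eq_iff transpose_def[of "_ + _"])
  then show ?thesis
    by (simp add: transpose_add matrix_transpose_mul e_sym algebra_simps)
qed

lemma dL: "dmat (d i) L = (A i + transpose (A i)) ** P + transpose (\<Gamma> i) ** L - L ** transpose (\<Gamma> i)"
  by (simp add: L_def dmat_mult der de dP matrix_ring_simps algebra_simps)

text \<open>The stress-energy identity of the map, the counterpart of
  \<open>contracted_bianchi\<close>: one half of the divergence contracts the Hessian to \<tau>, the
  other is half the derivative of \<open>N\<close> by the symmetry of the Hessian.\<close>

lemma div2_L: "2 * div2 L m = 2 * \<sigma> $ m + d m N"
proof -
  have 1: "(\<Sum>i\<in>UNIV. (transpose (A i) ** P) $ m $ i) = \<sigma> $ m"
  proof -
    have "(\<Sum>i\<in>UNIV. (transpose (A i) ** P) $ m $ i) = (\<Sum>i\<in>UNIV. \<Sum>l\<in>UNIV. P $ i $ l * ip (hess i l) (u m))"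
      by (simp add: matrix_matrix_mult_def transpose_def A_def P_sym'[of _ i for i] mult.commute)
    then show ?thesis
      by (simp add: \<sigma>_def \<tau>_def ip_sum_left ip_scale_left)
  qed
  have 2: "(\<Sum>i\<in>UNIV. (A i ** P) $ m $ i) = trace (A m ** P)"
    unfolding trace_def matrix_mult_nth A_def
    by (rule sum.cong[OF refl], rule sum.cong[OF refl]) (simp add: hess_sym[of m])
  have "trace (transpose (A m) ** P) = trace (A m ** P)"
    using trace_transpose[of "transpose (A m) ** P"] trace_mul_sym[of P "A m"]
    by (simp add: matrix_transpose_mul P_sym)
  then show ?thesis
    unfolding N_def using div2_cov[OF dL, of m] d_trace_cov[OF dL, of m] 1 2
    by (simp add: matrix_ring_simps sum.distrib trace_add distrib_left)
qed

text \<open>The product rule for \<langle>\<tau>, \<nabla>\<phi>\<rangle>. The trace of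
  \<open>B ** P\<close>, which contains the derivatives of \<tau>, occurs again in
  \<open>dt_N\<close> and cancels in \<open>evolution_S\<close>; the square of \<tau>
  survives.\<close>

lemma div1_P\<sigma>: "div1 (P *v \<sigma>) = trace (B ** P) + ip \<tau> \<tau>"
proof -
  have "d i (\<sigma> $ m) - (\<Sum>k\<in>UNIV. \<Gamma> i $ k $ m * \<sigma> $ k) = B $ i $ m + ip (hess i m) \<tau>" for i m
    by (simp add: \<sigma>_def derivation_ip[OF der compat_d] B_def ip_sym[of \<tau>]
        ip_sym[of "u m" "cov (d i) \<tau>"] cov_u ip_add_left
        ip_sum_left ip_scale_left)
  then have "div1 (P *v \<sigma>) = (\<Sum>i\<in>UNIV. \<Sum>m\<in>UNIV. P $ i $ m * (B $ i $ m + ip (hess i m) \<tau>))"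
    unfolding div1_raise by simp
  also have "\<dots> = trace (B ** P) + ip (\<Sum>i\<in>UNIV. \<Sum>j\<in>UNIV. P $ i $ j *s hess i j) \<tau>"
    by (simp add: distrib_left sum.distrib trace_def matrix_matrix_mult_def P_sym'[of _ i for i] mult.commute
        ip_sum_left ip_scale_left)
  finally show ?thesis by (simp add: \<tau>_def)
qed

lemma dt_N: "dt N = 2 * trace (B ** P) - trace (L ** K)"
proof -
  have "dt (e $ i $ j) = B $ i $ j + B $ j $ i" for i j
    using derivation_ip[OF dt_der compat_dt, of "u i" "u j"]
    by (simp add: e_def B_def cov_dt_u ip_sym[of "u i"])
  then have "dmat dt e = B + transpose B"
    by (simp add: vec_eq_iff transpose_def)
  then have "dmat dt L = B ** P + transpose B ** P - L ** K"
    by (simp add: L_def dmat_mult dt_der dtP K_def matrix_ring_simps)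
  moreover have "trace (transpose B ** P) = trace (B ** P)"
    using trace_transpose[of "transpose B ** P"] trace_mul_sym[of P B]
    by (simp add: matrix_transpose_mul P_sym)
  ultimately show ?thesis
    by (simp add: N_def derivation_trace dt_der trace_add trace_sub)
qed

text \<open>The metric equation with an index raised, written as a sum of two scaled matrices so
  that \<open>div2_add\<close> and \<open>div2_scale\<close> apply.\<close>

lemma K_eq: "K = (\<chi> i j. (-2) * Q $ i $ j) + (\<chi> i j. (2 * \<alpha>) * L $ i $ j)"
proof -
  have "h $ j $ k = (-2) * Ric $ j $ k + 2 * \<alpha> * e $ j $ k" for j k
    by (simp add: h_def flow_g)
  then have "K $ i $ j = (-2) * Q $ i $ j + (2 * \<alpha>) * L $ i $ j" for i j
    by (simp only: K_def Q_def L_def matrix_mult_nth distrib_right sum.distrib sum_distrib_left mult.assoc)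
  then show ?thesis
    by (simp add: vec_eq_iff)
qed

lemma trace_K: "trace K = - 2 * S"
  by (simp add: K_eq trace_add S_def R_def N_def) (simp add: trace_def sum_distrib_left algebra_simps sum_negf)

lemma d_numeral: "d i 2 = 0" "d i (- 2) = 0"
  using derivation_add[OF der, of i 1 1] derivation_minus[OF der, of i 2]
  by (auto simp: derivation_1[OF der])

lemma d_2\<alpha>: "d i (2 * \<alpha>) = 0"
  by (simp add: derivation_mult[OF der] d_numeral d_\<alpha>)

text \<open>The two divergence identities give div K = - dS + 2 \<alpha> \<sigma>, and - d (trace K)
  = 2 dS. This is where the derivatives of R and of |\<nabla>\<phi>|^2 combine into those of
  \<open>S\<close>.\<close>

lemma X_flow: "X = P *v (\<chi> m. d m S) + (2 * \<alpha>) *s (P *v \<sigma>)"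
proof -
  have "div2 K m - d m (trace K) = d m S + 2 * \<alpha> * \<sigma> $ m" for m
  proof -
    have "div2 K m = - (2 * div2 Q m) + \<alpha> * (2 * div2 L m)"
      by (simp only: K_eq div2_add div2_scale[OF d_numeral(2)] div2_scale[OF d_2\<alpha>]) (simp add: ac_simps)
    also have "\<dots> = - d m S + 2 * \<alpha> * \<sigma> $ m"
      by (simp only: contracted_bianchi[symmetric] div2_L)
        (simp add: S_def derivation_diff[OF der] derivation_mult[OF der] d_\<alpha> algebra_simps)
    finally show ?thesis
      by (simp add: trace_K derivation_minus[OF der] derivation_mult[OF der] d_numeral)
  qed
  then show ?thesis
    by (simp add: X_def vec_eq_iff matrix_vector_mult_def distrib_left sum.distrib sum_distrib_left ac_simps)
qed

text \<open>Twice the equation of the overview, as trace (K ** K) is 4 |S_ij|^2. The double sum is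
  the Laplacian of \<open>S\<close>.\<close>

theorem evolution_S:
  "2 * dt S = trace (K ** K) +
     2 * (\<Sum>i\<in>UNIV. \<Sum>m\<in>UNIV. P $ i $ m * (d i (d m S) - (\<Sum>k\<in>UNIV. \<Gamma> i $ k $ m * d k S)))
     + 4 * \<alpha> * ip \<tau> \<tau> - 2 * dt \<alpha> * N"
proof -
  \<comment> \<open>Only one of the two factors is expanded, because \<open>dt_R\<close> and
    \<open>dt_N\<close> deliver pairings of \<open>Q\<close> and \<open>L\<close> with
    \<open>K\<close>.\<close>
  have KK: "trace (K ** K) = - (2 * trace (Q ** K)) + 2 * \<alpha> * trace (L ** K)"
  proof -
    have "trace (K ** K) = (\<Sum>i\<in>UNIV. \<Sum>j\<in>UNIV. K $ i $ j * K $ j $ i)"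
      by (simp add: trace_def matrix_matrix_mult_def)
    also have "\<dots> = (\<Sum>i\<in>UNIV. \<Sum>j\<in>UNIV. ((-2) * Q $ i $ j + (2 * \<alpha>) * L $ i $ j) * K $ j $ i)"
      by (subst (1) K_eq) simp
    also have "\<dots> = (-2) * trace (Q ** K) + (2 * \<alpha>) * trace (L ** K)"
      by (simp only: trace_def matrix_mult_nth distrib_right sum.distrib sum_distrib_left mult.assoc)
    finally show ?thesis by simp
  qed
  have dtR: "dt R = - trace (Q ** K) + div1 (P *v (\<chi> m. d m S)) + 2 * \<alpha> * (trace (B ** P) + ip \<tau> \<tau>)"
    by (simp add: dt_R X_flow div1_add div1_scale[OF d_2\<alpha>] div1_P\<sigma>)
  have dtS: "dt S = dt R - dt \<alpha> * N - \<alpha> * dt N"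
    by (simp add: S_def derivation_diff[OF dt_der] derivation_mult[OF dt_der])
  have "2 * dt S = 2 * div1 (P *v (\<chi> m. d m S)) + 4 * \<alpha> * ip \<tau> \<tau> - 2 * dt \<alpha> * N
      + (- (2 * trace (Q ** K)) + 2 * \<alpha> * trace (L ** K))"
    unfolding dtS dtR dt_N by (simp add: algebra_simps)
  then show ?thesis
    unfolding KK[symmetric] div1_raise by (simp add: algebra_simps)
qed

end

section \<open>Smooth functions\<close>

lemma Ck_on_cong:
  assumes "open S" "\<And>x. x \<in> S \<Longrightarrow> f x = g x" "Ck_on k S f"
  shows "Ck_on k S g"
  using assms(2,3)
proof (induction k arbitrary: f g)
  case 0
  then show ?case by (simp cong: continuous_on_cong)
next
  case (Suc k)
  have diff: "f differentiable at x" if "x \<in> S" for x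
    using Suc.prems that by simp
  then have "g differentiable at x" if "x \<in> S" for x
    using diff[OF that] has_derivative_transform_within_open[of f _ x UNIV S g] assms(1) that Suc.prems(1)
    unfolding differentiable_def by blast
  moreover have "Ck_on k S (\<lambda>x. frechet_derivative g (at x) v)" for v
  proof (rule Suc.IH)
    show "frechet_derivative f (at x) v = frechet_derivative g (at x) v" if "x \<in> S" for x
      using frechet_derivative_transform_within_open[OF diff[OF that] assms(1) that Suc.prems(1)] by simp
    show "Ck_on k S (\<lambda>x. frechet_derivative f (at x) v)"
      using Suc.prems by simp
  qed
  ultimately show ?case by simp
qed

lemma Ck_on_subset: "Ck_on k S f \<Longrightarrow> U \<subseteq> S \<Longrightarrow> Ck_on k U f"
  by (induction k arbitrary: f) (auto intro: continuous_on_subset)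

lemma Ck_on_Suc_imp: "Ck_on (Suc k) S f \<Longrightarrow> Ck_on k S f"
proof (induction k arbitrary: f)
  case 0
  then show ?case
    by (auto intro!: continuous_at_imp_continuous_on differentiable_imp_continuous_within)
qed auto

lemma Ck_on_local:
  assumes "\<And>x. x \<in> S \<Longrightarrow> \<exists>U. open U \<and> x \<in> U \<and> Ck_on k U f"
  shows "Ck_on k S f"
  using assms
proof (induction k arbitrary: f)
  case 0
  have "isCont f x" if "x \<in> S" for x
    using 0[OF that] continuous_on_eq_continuous_at by auto
  then show ?case
    by (simp add: continuous_at_imp_continuous_on)
next
  case (Suc k)
  have "f differentiable at x" if "x \<in> S" for x
    using Suc.prems[OF that] by auto
  moreover have "Ck_on k S (\<lambda>x. frechet_derivative f (at x) v)" for v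
  proof (rule Suc.IH)
    fix x assume "x \<in> S"
    from Suc.prems[OF this] show "\<exists>U. open U \<and> x \<in> U \<and> Ck_on k U (\<lambda>x. frechet_derivative f (at x) v)"
      by auto
  qed
  ultimately show ?case by simp
qed

text \<open>On an open set the local extensions agree with \<open>f\<close> near each point and so
  have the same derivatives.\<close>

lemma smooth_on_open: "open S \<Longrightarrow> smooth_on S f \<longleftrightarrow> (\<forall>k. Ck_on k S f)"
proof
  assume S: "open S" and f: "smooth_on S f"
  show "\<forall>k. Ck_on k S f"
  proof (intro allI Ck_on_local)
    fix k x assume "x \<in> S"
    then obtain U F where U: "open U" "x \<in> U" "\<forall>k. Ck_on k U F" "\<forall>y\<in>S \<inter> U. F y = f y"
      using f unfolding smooth_on_def by blast
    have "Ck_on k (S \<inter> U) f"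
      by (rule Ck_on_cong[of _ F]) (use U S in \<open>auto intro: Ck_on_subset\<close>)
    then show "\<exists>U. open U \<and> x \<in> U \<and> Ck_on k U f"
      using U S \<open>x \<in> S\<close> by (intro exI[of _ "S \<inter> U"]) auto
  qed
next
  assume "open S" "\<forall>k. Ck_on k S f"
  then show "smooth_on S f"
    unfolding smooth_on_def by (intro ballI exI[of _ S] exI[of _ f]) simp
qed

lemma smooth_on_subset_cong:
  assumes "smooth_on S f" "U \<subseteq> S" "\<And>x. x \<in> U \<Longrightarrow> f x = g x"
  shows "smooth_on U g"
  unfolding smooth_on_def
proof
  fix x assume x: "x \<in> U"
  then have "x \<in> S" using assms(2) by auto
  from bspec[OF assms(1)[unfolded smooth_on_def] this] obtain V F where V: "open V" "x \<in> V" "\<forall>k. Ck_on k V F" "\<forall>y\<in>S \<inter> V. F y = f y"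
    by (elim exE conjE)
  show "\<exists>V F. open V \<and> x \<in> V \<and> (\<forall>k. Ck_on k V F) \<and> (\<forall>y\<in>U \<inter> V. F y = g y)"
    using V assms(2,3) by (intro exI[of _ V] exI[of _ F]) (auto simp: subset_iff)
qed

lemma smooth_on_subset: "smooth_on S f \<Longrightarrow> U \<subseteq> S \<Longrightarrow> smooth_on U f"
  by (rule smooth_on_subset_cong[OF _ _ refl])

lemma smooth_on_cong: "smooth_on S f \<Longrightarrow> (\<And>x. x \<in> S \<Longrightarrow> f x = g x) \<Longrightarrow> smooth_on S g"
  by (rule smooth_on_subset_cong[OF _ subset_refl])

lemma smooth_on_differentiable:
  assumes "open S" "smooth_on S f" "x \<in> S"
  shows "f differentiable at x"
proof -
  have "Ck_on (Suc 0) S f" using assms by (simp add: smooth_on_open del: Ck_on.simps)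
  then show ?thesis using assms by simp
qed

lemma smooth_on_frechet_derivative:
  assumes "open S" "smooth_on S f"
  shows "smooth_on S (\<lambda>x. frechet_derivative f (at x) v)"
proof -
  have "Ck_on k S (\<lambda>x. frechet_derivative f (at x) v)" for k
  proof -
    have "Ck_on (Suc k) S f" using assms by (simp add: smooth_on_open del: Ck_on.simps)
    then show ?thesis by simp
  qed
  then show ?thesis using assms by (simp add: smooth_on_open)
qed

lemma smooth_on_continuous: "open S \<Longrightarrow> smooth_on S f \<Longrightarrow> continuous_on S f"
  unfolding smooth_on_open using Ck_on.simps(1) by blast

lemma Ck_on_const: "Ck_on k S (\<lambda>x. c)"
  by (induction k arbitrary: c) auto

lemma Ck_on_linear:
  assumes "bounded_linear f"
  shows "Ck_on k S f"
proof (cases k)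
  case 0
  then show ?thesis using assms by (simp add: linear_continuous_on)
next
  case (Suc n)
  have "frechet_derivative f (at x) = f" for x
    using frechet_derivative_at[OF bounded_linear_imp_has_derivative[OF assms]] by simp
  then show ?thesis
    using Suc assms by (simp add: bounded_linear_imp_differentiable Ck_on_const)
qed

lemma Ck_on_add:
  assumes "open S" "Ck_on k S f" "Ck_on k S g"
  shows "Ck_on k S (\<lambda>x. f x + g x)"
  using assms(2,3)
proof (induction k arbitrary: f g)
  case 0
  then show ?case by (simp add: continuous_on_add)
next
  case (Suc k)
  have der: "((\<lambda>x. f x + g x) has_derivative (\<lambda>v. frechet_derivative f (at x) v
      + frechet_derivative g (at x) v)) (at x)" if "x \<in> S" for x
    using Suc.prems that by (intro has_derivative_add) (auto simp: frechet_derivative_works[symmetric])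
  have "Ck_on k S (\<lambda>x. frechet_derivative (\<lambda>x. f x + g x) (at x) v)" for v
  proof (rule Ck_on_cong[OF assms(1)])
    show "Ck_on k S (\<lambda>x. frechet_derivative f (at x) v + frechet_derivative g (at x) v)"
      using Suc.prems by (intro Suc.IH) auto
    show "frechet_derivative f (at x) v + frechet_derivative g (at x) v
       = frechet_derivative (\<lambda>x. f x + g x) (at x) v" if "x \<in> S" for x
      using fun_cong[OF frechet_derivative_at[OF der[OF that]], of v] .
  qed
  then show ?case
    using Suc.prems by (auto intro: differentiable_add)
qed

text \<open>One induction for real products, scalar multiples and inner products alike.\<close>

lemma (in bounded_bilinear) Ck_on:
  assumes "open S" "Ck_on k S f" "Ck_on k S g"
  shows "Ck_on k S (\<lambda>x. prod (f x) (g x))"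
  using assms(2,3)
proof (induction k arbitrary: f g)
  case 0
  then show ?case by (simp add: continuous_on)
next
  case (Suc k)
  have der: "((\<lambda>x. prod (f x) (g x)) has_derivative (\<lambda>v. prod (f x) (frechet_derivative g (at x) v)
      + prod (frechet_derivative f (at x) v) (g x))) (at x)" if "x \<in> S" for x
    using Suc.prems that by (intro FDERIV) (auto simp: frechet_derivative_works[symmetric])
  have "Ck_on k S (\<lambda>x. frechet_derivative (\<lambda>x. prod (f x) (g x)) (at x) v)" for v
  proof (rule Ck_on_cong[OF assms(1)])
    show "Ck_on k S (\<lambda>x. prod (f x) (frechet_derivative g (at x) v)
      + prod (frechet_derivative f (at x) v) (g x))"
      using Suc.prems Suc.prems[THEN Ck_on_Suc_imp] by (intro Ck_on_add assms(1) Suc.IH) auto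
    show "prod (f x) (frechet_derivative g (at x) v) + prod (frechet_derivative f (at x) v) (g x)
       = frechet_derivative (\<lambda>x. prod (f x) (g x)) (at x) v" if "x \<in> S" for x
      using fun_cong[OF frechet_derivative_at[OF der[OF that]], of v] .
  qed
  then show ?case
    using der by (auto simp: differentiable_def)
qed

lemma Ck_on_sum:
  assumes "open S" "\<And>i. i \<in> I \<Longrightarrow> Ck_on k S (f i)"
  shows "Ck_on k S (\<lambda>x. \<Sum>i\<in>I. f i x)"
  using assms(2)
  by (induction I rule: infinite_finite_induct) (auto intro: Ck_on_const Ck_on_add assms(1))

lemma Ck_on_inverse:
  fixes f :: "'e::euclidean_space \<Rightarrow> real"
  assumes "open S" "Ck_on k S f" "\<And>x. x \<in> S \<Longrightarrow> f x \<noteq> 0"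
  shows "Ck_on k S (\<lambda>x. inverse (f x))"
  using assms(2)
proof (induction k)
  case 0
  then show ?case using assms by (simp add: continuous_on_inverse)
next
  case (Suc k)
  have der: "((\<lambda>x. inverse (f x)) has_derivative
     (\<lambda>v. - (inverse (f x) * frechet_derivative f (at x) v * inverse (f x)))) (at x)" if "x \<in> S" for x
    using Suc.prems that assms(3) by (intro Deriv.has_derivative_inverse) (auto simp: frechet_derivative_works[symmetric])
  have "Ck_on k S (\<lambda>x. frechet_derivative (\<lambda>x. inverse (f x)) (at x) v)" for v
  proof (rule Ck_on_cong[OF assms(1)])
    show "Ck_on k S (\<lambda>x. (-1) * (inverse (f x) * frechet_derivative f (at x) v * inverse (f x)))"
      using Suc.prems Suc.IH Ck_on_Suc_imp[of k S f]
      by (intro bounded_bilinear.Ck_on[OF bounded_bilinear_mult] assms(1) Ck_on_const) auto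
    show "(-1) * (inverse (f x) * frechet_derivative f (at x) v * inverse (f x))
       = frechet_derivative (\<lambda>x. inverse (f x)) (at x) v" if "x \<in> S" for x
      using fun_cong[OF frechet_derivative_at[OF der[OF that]], of v] by simp
  qed
  then show ?case
    using der by (auto simp: differentiable_def)
qed

text \<open>The chain rule differentiates \<open>h\<close> in a direction that depends on
  \<open>x\<close>, whereas \<open>Ck_on\<close> speaks of fixed directions. Expanding the direction
  in the basis leaves products to which the induction hypothesis applies.\<close>

lemma Ck_on_compose:
  fixes f :: "'e::euclidean_space \<Rightarrow> 'f::euclidean_space" and h :: "'f \<Rightarrow> 'b::real_normed_vector"
  assumes "open S" "open V" "f ` S \<subseteq> V" "Ck_on k S f" "Ck_on k V h"
  shows "Ck_on k S (\<lambda>x. h (f x))"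
  using assms(4,5)
proof (induction k arbitrary: h)
  case 0
  then show ?case
    using assms(3) continuous_on_compose2[of V h S f] by auto
next
  case (Suc k)
  have hd: "h differentiable at (f x)" and fd: "f differentiable at x" if "x \<in> S" for x
    using Suc.prems that assms(3) by auto
  have eq: "frechet_derivative (\<lambda>x. h (f x)) (at x) v
     = (\<Sum>b\<in>Basis. (frechet_derivative f (at x) v \<bullet> b) *\<^sub>R frechet_derivative h (at (f x)) b)"
    if "x \<in> S" for x v
  proof -
    have "frechet_derivative (\<lambda>x. h (f x)) (at x) v = frechet_derivative h (at (f x)) (frechet_derivative f (at x) v)"
      using frechet_derivative_compose[OF fd hd, OF that that] by (simp add: o_def)
    also have "\<dots> = frechet_derivative h (at (f x))
         (\<Sum>b\<in>Basis. (frechet_derivative f (at x) v \<bullet> b) *\<^sub>R b)"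
      by (simp add: euclidean_representation)
    also have "\<dots> = (\<Sum>b\<in>Basis. (frechet_derivative f (at x) v \<bullet> b) *\<^sub>R frechet_derivative h (at (f x)) b)"
      using linear_frechet_derivative[OF hd[OF that]] by (simp add: linear_sum linear_cmul)
    finally show ?thesis .
  qed
  have "Ck_on k S (\<lambda>x. frechet_derivative (\<lambda>x. h (f x)) (at x) v)" for v
  proof (rule Ck_on_cong[OF assms(1)])
    have "Ck_on k S (\<lambda>x. frechet_derivative h (at (f x)) b)" for b
      using Suc.IH[of "\<lambda>y. frechet_derivative h (at y) b"] Suc.prems Ck_on_Suc_imp[of k S f] by simp
    then show "Ck_on k S (\<lambda>x. \<Sum>b\<in>Basis. (frechet_derivative f (at x) v \<bullet> b) *\<^sub>R frechet_derivative h (at (f x)) b)"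
      using Suc.prems assms(1)
      by (intro Ck_on_sum bounded_bilinear.Ck_on[OF bounded_bilinear_scaleR]
          bounded_bilinear.Ck_on[OF bounded_bilinear_inner] Ck_on_const) auto
  qed (simp add: eq)
  moreover have "(\<lambda>x. h (f x)) differentiable at x" if "x \<in> S" for x
    using differentiable_chain_at[OF fd[OF that] hd[OF that]] by (simp add: o_def)
  ultimately show ?case by simp
qed

context
  fixes S :: "'e::euclidean_space set"
  assumes S: "open S"
begin

lemma smooth_on_const: "smooth_on S (\<lambda>x. c)"
  by (simp add: smooth_on_open[OF S] Ck_on_const)

lemma smooth_on_add: "smooth_on S f \<Longrightarrow> smooth_on S g \<Longrightarrow> smooth_on S (\<lambda>x. f x + g x)"
  by (simp add: smooth_on_open[OF S] Ck_on_add[OF S])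

lemma smooth_on_scaleR: "smooth_on S f \<Longrightarrow> smooth_on S g \<Longrightarrow> smooth_on S (\<lambda>x. f x *\<^sub>R g x)"
  by (simp add: smooth_on_open[OF S] bounded_bilinear.Ck_on[OF bounded_bilinear_scaleR S])

lemma smooth_on_mult:
  fixes f g :: "'e \<Rightarrow> real"
  shows "smooth_on S f \<Longrightarrow> smooth_on S g \<Longrightarrow> smooth_on S (\<lambda>x. f x * g x)"
  by (simp add: smooth_on_open[OF S] bounded_bilinear.Ck_on[OF bounded_bilinear_mult S])

lemma smooth_on_minus: "smooth_on S f \<Longrightarrow> smooth_on S (\<lambda>x. - f x)"
  using smooth_on_scaleR[OF smooth_on_const[of "-1"]] by simp

lemma smooth_on_diff: "smooth_on S f \<Longrightarrow> smooth_on S g \<Longrightarrow> smooth_on S (\<lambda>x. f x - g x)"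
  using smooth_on_add[OF _ smooth_on_minus] by simp

lemma smooth_on_sum: "(\<And>i. i \<in> I \<Longrightarrow> smooth_on S (f i)) \<Longrightarrow> smooth_on S (\<lambda>x. \<Sum>i\<in>I. f i x)"
  by (simp add: smooth_on_open[OF S] Ck_on_sum[OF S])

lemma smooth_on_prod:
  fixes f :: "'i \<Rightarrow> 'e \<Rightarrow> real"
  shows "(\<And>i. i \<in> I \<Longrightarrow> smooth_on S (f i)) \<Longrightarrow> smooth_on S (\<lambda>x. \<Prod>i\<in>I. f i x)"
  by (induction I rule: infinite_finite_induct) (auto intro: smooth_on_const smooth_on_mult)

lemma smooth_on_divide:
  fixes f g :: "'e \<Rightarrow> real"
  shows "smooth_on S f \<Longrightarrow> smooth_on S g \<Longrightarrow> (\<And>x. x \<in> S \<Longrightarrow> g x \<noteq> 0) \<Longrightarrow> smooth_on S (\<lambda>x. f x / g x)"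
  using smooth_on_mult[of f "\<lambda>x. inverse (g x)"]
  by (simp add: smooth_on_open[OF S] Ck_on_inverse[OF S] divide_inverse)

lemma smooth_on_compose:
  fixes f :: "'e \<Rightarrow> 'f::euclidean_space"
  assumes "open V" "f ` S \<subseteq> V" "smooth_on S f" "smooth_on V h"
  shows "smooth_on S (\<lambda>x. h (f x))"
  using assms by (simp add: smooth_on_open[OF S] smooth_on_open Ck_on_compose[OF S])

lemma smooth_on_linear: "bounded_linear f \<Longrightarrow> smooth_on S f"
  by (simp add: smooth_on_open[OF S] Ck_on_linear)

lemma smooth_on_vec_nth:
  fixes f :: "'e \<Rightarrow> 'f::euclidean_space ^ 'n::finite"
  shows "smooth_on S f \<Longrightarrow> smooth_on S (\<lambda>x. f x $ i)"
  by (rule smooth_on_compose[of UNIV f "\<lambda>y. y $ i"])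
    (auto simp: smooth_on_open intro: Ck_on_linear bounded_linear_vec_nth)

lemma smooth_on_det:
  fixes A :: "'e \<Rightarrow> real ^ 'n ^ 'n::finite"
  assumes "\<And>i j. smooth_on S (\<lambda>x. A x $ i $ j)"
  shows "smooth_on S (\<lambda>x. det (A x))"
  unfolding det_def by (intro smooth_on_sum smooth_on_mult smooth_on_const smooth_on_prod assms)

end

section \<open>Inverses of matrices depending smoothly on a point\<close>

lemma det_ne_0_pos_def:
  fixes A :: "real ^ 'n ^ 'n::finite"
  assumes "\<And>v. v \<noteq> 0 \<Longrightarrow> 0 < v \<bullet> (A *v v)"
  shows "det A \<noteq> 0"
proof -
  have "A *v v = 0 \<Longrightarrow> v = 0" for v
    using assms[of v] by (cases "v = 0") auto
  then have "\<exists>B. B ** A = mat 1"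
    by (simp add: matrix_left_invertible_ker)
  then show ?thesis
    using invertible_det_nz invertible_left_inverse by blast
qed

lemma matrix_inv_mult:
  fixes A :: "real ^ 'n ^ 'n::finite"
  assumes "det A \<noteq> 0"
  shows "A ** matrix_inv A = mat 1" "matrix_inv A ** A = mat 1"
proof -
  have "\<exists>B. A ** B = mat 1 \<and> B ** A = mat 1"
    using assms invertible_det_nz[of A] by (simp add: invertible_def)
  from someI_ex[OF this] show "A ** matrix_inv A = mat 1" "matrix_inv A ** A = mat 1"
    by (simp_all add: matrix_inv_def)
qed

text \<open>Cramer's rule for a unit vector as right side. It exhibits the entries of the inverse as
  quotients of polynomials in the entries of \<open>A\<close>, which gives their smoothness.\<close>

lemma matrix_inv_cramer:
  fixes A :: "real ^ 'n ^ 'n::finite"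
  assumes "det A \<noteq> 0"
  shows "matrix_inv A $ k $ l = det (\<chi> i j. if j = k then axis l 1 $ i else A $ i $ j) / det A"
proof -
  have "A *v (matrix_inv A *v axis l 1) = axis l 1"
    by (simp add: matrix_vector_mul_assoc matrix_inv_mult[OF assms])
  then have "(matrix_inv A *v axis l 1) $ k = det (\<chi> i j. if j = k then axis l 1 $ i else A $ i $ j) / det A"
    using cramer[OF assms, of "matrix_inv A *v axis l 1" "axis l 1"] by simp
  then show ?thesis
    by (simp add: matrix_vector_mult_basis column_def)
qed

lemma smooth_on_matrix_inv:
  fixes A :: "'e::euclidean_space \<Rightarrow> real ^ 'n ^ 'n::finite"
  assumes "open S" "\<And>i j. smooth_on S (\<lambda>x. A x $ i $ j)" "\<And>x. x \<in> S \<Longrightarrow> det (A x) \<noteq> 0"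
  shows "smooth_on S (\<lambda>x. matrix_inv (A x) $ k $ l)"
proof (rule smooth_on_cong)
  have "smooth_on S (\<lambda>x. (\<chi> i j. if j = k then axis l 1 $ i else A x $ i $ j) $ i $ j)" for i j
    by (cases "j = k") (simp_all add: assms smooth_on_const)
  then show "smooth_on S (\<lambda>x. det (\<chi> i j. if j = k then axis l 1 $ i else A x $ i $ j) / det (A x))"
    using assms by (intro smooth_on_divide smooth_on_det)
qed (simp add: matrix_inv_cramer assms)

section \<open>Symmetry of second derivatives\<close>

lemma line_has_derivative:
  fixes k :: "'e::euclidean_space \<Rightarrow> 'b::real_normed_vector"
  assumes "k differentiable (at (y + s *\<^sub>R u))"
  shows "((\<lambda>s. k (y + s *\<^sub>R u)) has_vector_derivative frechet_derivative k (at (y + s *\<^sub>R u)) u) (at s)"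
proof -
  have "(k has_derivative frechet_derivative k (at (y + s *\<^sub>R u))) (at (y + s *\<^sub>R u))"
    using assms by (simp add: frechet_derivative_works[symmetric])
  moreover have "((\<lambda>s. y + s *\<^sub>R u) has_derivative (\<lambda>r. r *\<^sub>R u)) (at s)"
    by (auto intro!: derivative_eq_intros)
  ultimately have "((\<lambda>s. k (y + s *\<^sub>R u)) has_derivative
      (\<lambda>r. frechet_derivative k (at (y + s *\<^sub>R u)) (r *\<^sub>R u))) (at s)"
    using has_derivative_compose by blast
  moreover have "frechet_derivative k (at (y + s *\<^sub>R u)) (r *\<^sub>R u)
      = r *\<^sub>R frechet_derivative k (at (y + s *\<^sub>R u)) u" for r
    using linear_frechet_derivative[OF assms] by (simp add: linear_cmul)
  ultimately show ?thesis
    by (simp add: has_vector_derivative_def)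
qed

text \<open>Two applications of the mean value theorem: along \<open>v\<close> to the difference of
  two parallel slices, then along \<open>w\<close> to the derivative of \<open>f\<close> in
  direction \<open>v\<close>.\<close>

lemma second_difference:
  fixes f :: "'e::euclidean_space \<Rightarrow> real"
  assumes S: "open S" "smooth_on S f" and h: "0 < h"
    and in_S: "\<And>s t. 0 \<le> s \<Longrightarrow> s \<le> h \<Longrightarrow> 0 \<le> t \<Longrightarrow> t \<le> h \<Longrightarrow> x + s *\<^sub>R v + t *\<^sub>R w \<in> S"
  shows "\<exists>s t. 0 < s \<and> s < h \<and> 0 < t \<and> t < h \<and>
    f (x + h *\<^sub>R v + h *\<^sub>R w) - f (x + h *\<^sub>R v) - (f (x + h *\<^sub>R w) - f x) =
     h * h * frechet_derivative (\<lambda>y. frechet_derivative f (at y) v) (at (x + s *\<^sub>R v + t *\<^sub>R w)) w"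
proof -
  have line: "((\<lambda>s. k (y + s *\<^sub>R u)) has_field_derivative frechet_derivative k (at (y + s *\<^sub>R u)) u) (at s)"
    if "smooth_on S k" "y + s *\<^sub>R u \<in> S" for k :: "'e \<Rightarrow> real" and y u s
    using line_has_derivative[OF smooth_on_differentiable[OF S(1) that]]
    by (simp add: has_real_derivative_iff_has_vector_derivative)
  define p where "p s = f (x + h *\<^sub>R w + s *\<^sub>R v) - f (x + s *\<^sub>R v)" for s
  define D where "D y = frechet_derivative f (at y) v" for y
  have D: "smooth_on S D"
    unfolding D_def by (rule smooth_on_frechet_derivative[OF S])
  have "\<exists>s. 0 < s \<and> s < h \<and> p h - p 0 = (h - 0) * (D (x + h *\<^sub>R w + s *\<^sub>R v) - D (x + s *\<^sub>R v))"
  proof (rule MVT2[OF h])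
    fix s assume s: "0 \<le> s" "s \<le> h"
    have "x + h *\<^sub>R w + s *\<^sub>R v \<in> S" "x + s *\<^sub>R v \<in> S"
      using in_S[OF s, of h] in_S[OF s, of 0] h by (simp_all add: ac_simps)
    then show "(p has_real_derivative D (x + h *\<^sub>R w + s *\<^sub>R v) - D (x + s *\<^sub>R v)) (at s)"
      unfolding p_def D_def by (intro DERIV_diff line S)
  qed
  then obtain s where s: "0 < s" "s < h" "p h - p 0 = h * (D (x + h *\<^sub>R w + s *\<^sub>R v) - D (x + s *\<^sub>R v))"
    by auto
  have "\<exists>t. 0 < t \<and> t < h \<and> D (x + s *\<^sub>R v + h *\<^sub>R w) - D (x + s *\<^sub>R v + 0 *\<^sub>R w)
     = (h - 0) * frechet_derivative D (at (x + s *\<^sub>R v + t *\<^sub>R w)) w"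
    by (rule MVT2[OF h]) (use in_S s in \<open>auto intro!: line D\<close>)
  then obtain t where "0 < t" "t < h" "D (x + s *\<^sub>R v + h *\<^sub>R w) - D (x + s *\<^sub>R v)
     = h * frechet_derivative D (at (x + s *\<^sub>R v + t *\<^sub>R w)) w"
    by auto
  with s show ?thesis
    unfolding p_def D_def by (intro exI[of _ s] exI[of _ t]) (auto simp: ac_simps)
qed

text \<open>The second difference is symmetric in \<open>v\<close> and \<open>w\<close>, so the two
  mixed derivatives agree at points arbitrarily close to \<open>x\<close>; continuity brings them
  together at \<open>x\<close>.\<close>

theorem frechet_derivative_commute:
  fixes f :: "'e::euclidean_space \<Rightarrow> real"
  assumes S: "open S" "smooth_on S f" and x: "x \<in> S"
  shows "frechet_derivative (\<lambda>y. frechet_derivative f (at y) v) (at x) w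
       = frechet_derivative (\<lambda>y. frechet_derivative f (at y) w) (at x) v"
proof -
  define a where "a y = frechet_derivative (\<lambda>y. frechet_derivative f (at y) v) (at y) w" for y
  define b where "b y = frechet_derivative (\<lambda>y. frechet_derivative f (at y) w) (at y) v" for y
  have "isCont k x" if "smooth_on S k" for k :: "'e \<Rightarrow> real"
    using smooth_on_continuous[OF S(1) that] S x by (auto simp: continuous_on_eq_continuous_at)
  then have cont: "isCont a x" "isCont b x"
    unfolding a_def b_def by (simp_all add: smooth_on_frechet_derivative S)
  have "\<bar>a x - b x\<bar> \<le> \<epsilon>" if "\<epsilon> > 0" for \<epsilon>
  proof -
    have "\<forall>\<^sub>F y in nhds x. \<bar>a y - a x\<bar> < \<epsilon> / 2 \<and> \<bar>b y - b x\<bar> < \<epsilon> / 2 \<and> y \<in> S"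
    proof (intro eventually_conj)
      have lim: "(a \<longlongrightarrow> a x) (nhds x)" "(b \<longlongrightarrow> b x) (nhds x)"
        using cont by (auto simp: isCont_def tendsto_at_iff_tendsto_nhds)
      from that have "\<epsilon> / 2 > 0" by simp
      from tendstoD[OF lim(1) this] tendstoD[OF lim(2) this]
      show "\<forall>\<^sub>F y in nhds x. \<bar>a y - a x\<bar> < \<epsilon> / 2" "\<forall>\<^sub>F y in nhds x. \<bar>b y - b x\<bar> < \<epsilon> / 2"
        by (simp_all only: dist_real_def)
      show "\<forall>\<^sub>F y in nhds x. y \<in> S"
        using S x by (simp add: eventually_nhds_in_open)
    qed
    then obtain \<delta> where \<delta>: "\<delta> > 0"
      "\<And>y. dist y x < \<delta> \<Longrightarrow> \<bar>a y - a x\<bar> < \<epsilon> / 2 \<and> \<bar>b y - b x\<bar> < \<epsilon> / 2 \<and> y \<in> S"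
      unfolding eventually_nhds_metric by blast
    \<comment> \<open>Keeps the parallelogram with sides \<open>h *\<^sub>R v\<close> and
      \<open>h *\<^sub>R w\<close> inside the ball of radius \<open>\<delta>\<close>; the summand 1
      covers v = w = 0.\<close>
    define h where "h = \<delta> / (2 * (norm v + norm w + 1))"
    have c: "norm v + norm w + 1 > 0"
      using norm_ge_zero[of v] norm_ge_zero[of w] by linarith
    have h: "0 < h" "h * (norm v + norm w + 1) = \<delta> / 2"
    proof -
      show "0 < h" using \<delta>(1) c by (simp add: h_def)
      define c' where "c' = norm v + norm w + 1"
      show "h * (norm v + norm w + 1) = \<delta> / 2"
        using c unfolding h_def c'_def[symmetric] by simp
    qed
    have close: "dist (x + s *\<^sub>R v + t *\<^sub>R w) x < \<delta>" if "0 \<le> s" "s \<le> h" "0 \<le> t" "t \<le> h" for s t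
    proof -
      have "dist (x + s *\<^sub>R v + t *\<^sub>R w) x = norm (s *\<^sub>R v + t *\<^sub>R w)"
        by (simp add: dist_norm)
      also have "\<dots> \<le> s * norm v + t * norm w"
        using norm_triangle_ineq[of "s *\<^sub>R v" "t *\<^sub>R w"] that by simp
      also have "\<dots> \<le> h * norm v + h * norm w"
        using that by (intro add_mono mult_right_mono) auto
      also have "\<dots> < \<delta>"
        using h \<delta>(1) by (simp add: algebra_simps)
      finally show ?thesis .
    qed
    have close': "dist (x + s *\<^sub>R w + t *\<^sub>R v) x < \<delta>" if "0 \<le> s" "s \<le> h" "0 \<le> t" "t \<le> h" for s t
      using close[of t s] that by (simp add: ac_simps)
    obtain s t where st: "0 < s" "s < h" "0 < t" "t < h"
      "f (x + h *\<^sub>R v + h *\<^sub>R w) - f (x + h *\<^sub>R v) - (f (x + h *\<^sub>R w) - f x) = h * h * a (x + s *\<^sub>R v + t *\<^sub>R w)"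
      using second_difference[OF S h(1), of x v w] close \<delta>(2) unfolding a_def by blast
    obtain s' t' where st': "0 < s'" "s' < h" "0 < t'" "t' < h"
      "f (x + h *\<^sub>R w + h *\<^sub>R v) - f (x + h *\<^sub>R w) - (f (x + h *\<^sub>R v) - f x) = h * h * b (x + s' *\<^sub>R w + t' *\<^sub>R v)"
      using second_difference[OF S h(1), of x w v] close' \<delta>(2) unfolding b_def by blast
    have "h * h * a (x + s *\<^sub>R v + t *\<^sub>R w) = h * h * b (x + s' *\<^sub>R w + t' *\<^sub>R v)"
    proof -
      have eq: "x + h *\<^sub>R w + h *\<^sub>R v = x + h *\<^sub>R v + h *\<^sub>R w"
        by (simp add: ac_simps)
      show ?thesis using st(5) st'(5) unfolding eq by linarith
    qed
    then have "a (x + s *\<^sub>R v + t *\<^sub>R w) = b (x + s' *\<^sub>R w + t' *\<^sub>R v)"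
      using h by simp
    moreover have "\<bar>a (x + s *\<^sub>R v + t *\<^sub>R w) - a x\<bar> < \<epsilon> / 2" "\<bar>b (x + s' *\<^sub>R w + t' *\<^sub>R v) - b x\<bar> < \<epsilon> / 2"
      using \<delta>(2) close close' st st' by auto
    ultimately show ?thesis by linarith
  qed
  then have "\<bar>a x - b x\<bar> \<le> 0"
    by (rule dense_ge)
  then have "a x = b x" by simp
  then show ?thesis by (simp add: a_def b_def)
qed

section \<open>The differential ring of germs\<close>

text \<open>A partial equivalence: a function is related to itself exactly if it is smooth near 0,
  so every germ can be differentiated. The base point is fixed because a type cannot depend on a
  point; \<open>germ_at\<close> translates.\<close>

definition germ_rel :: "('e::euclidean_space \<Rightarrow> real) \<Rightarrow> ('e \<Rightarrow> real) \<Rightarrow> bool" where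
  "germ_rel f g \<longleftrightarrow> (\<exists>U. open U \<and> 0 \<in> U \<and> smooth_on U f \<and> (\<forall>x\<in>U. f x = g x))"

lemma germ_relI:
  "open U \<Longrightarrow> 0 \<in> U \<Longrightarrow> smooth_on U f \<Longrightarrow> (\<And>x. x \<in> U \<Longrightarrow> f x = g x) \<Longrightarrow> germ_rel f g"
  unfolding germ_rel_def by blast

lemma germ_relE:
  assumes "germ_rel f g"
  obtains U where "open U" "0 \<in> U" "smooth_on U f" "smooth_on U g" "\<forall>x\<in>U. f x = g x"
proof -
  obtain U where U: "open U" "0 \<in> U" "smooth_on U f" "\<forall>x\<in>U. f x = g x"
    using assms unfolding germ_rel_def by (elim exE conjE)
  then have "smooth_on U g"
    using smooth_on_cong[OF U(3)] by simp
  with U show ?thesis by (intro that) auto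
qed

lemma part_equivp_germ_rel: "part_equivp (germ_rel :: ('e::euclidean_space \<Rightarrow> real) \<Rightarrow> _)"
proof (rule part_equivpI)
  show "\<exists>f :: 'e \<Rightarrow> real. germ_rel f f"
    by (rule exI[of _ "\<lambda>_. 0"], rule germ_relI[of UNIV]) (auto intro: smooth_on_const)
  show "symp (germ_rel :: ('e \<Rightarrow> real) \<Rightarrow> _)"
  proof (rule sympI)
    fix f g :: "'e \<Rightarrow> real" assume "germ_rel f g"
    then show "germ_rel g f"
      by (elim germ_relE, intro germ_relI) auto
  qed
  show "transp (germ_rel :: ('e \<Rightarrow> real) \<Rightarrow> _)"
  proof (rule transpI)
    fix f g h :: "'e \<Rightarrow> real" assume "germ_rel f g" "germ_rel g h"
    obtain U where "open U" "0 \<in> U" "smooth_on U f" "smooth_on U g" "\<forall>x\<in>U. f x = g x"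
      using \<open>germ_rel f g\<close> by (rule germ_relE)
    moreover obtain V where "open V" "0 \<in> V" "smooth_on V g" "smooth_on V h" "\<forall>x\<in>V. g x = h x"
      using \<open>germ_rel g h\<close> by (rule germ_relE)
    ultimately show "germ_rel f h"
      by (intro germ_relI[of "U \<inter> V"]) (auto intro: smooth_on_subset)
  qed
qed

quotient_type (overloaded) 'e germ = "'e::euclidean_space \<Rightarrow> real" / partial: germ_rel
  by (rule part_equivp_germ_rel)

lemma germ_rel_pointwise:
  assumes "germ_rel f f'" "germ_rel g g'"
    and "\<And>U. open U \<Longrightarrow> smooth_on U f \<Longrightarrow> smooth_on U g \<Longrightarrow> smooth_on U (\<lambda>x. p (f x) (g x))"
  shows "germ_rel (\<lambda>x. p (f x) (g x)) (\<lambda>x. p (f' x) (g' x))"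
proof -
  obtain U where U: "open U" "0 \<in> U" "smooth_on U f" "smooth_on U f'" "\<forall>x\<in>U. f x = f' x"
    using assms(1) by (rule germ_relE)
  obtain V where V: "open V" "0 \<in> V" "smooth_on V g" "smooth_on V g'" "\<forall>x\<in>V. g x = g' x"
    using assms(2) by (rule germ_relE)
  show ?thesis
    by (rule germ_relI[of "U \<inter> V"])
      (use U V in \<open>auto intro!: assms(3) intro: smooth_on_subset\<close>)
qed

instantiation germ :: (euclidean_space) comm_ring_1
begin

lift_definition zero_germ :: "'a germ" is "\<lambda>_. 0"
  by (rule germ_relI[of UNIV]) (auto intro: smooth_on_const)

lift_definition one_germ :: "'a germ" is "\<lambda>_. 1"
  by (rule germ_relI[of UNIV]) (auto intro: smooth_on_const)

lift_definition plus_germ :: "'a germ \<Rightarrow> 'a germ \<Rightarrow> 'a germ" is "\<lambda>f g x. f x + g x"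
  by (rule germ_rel_pointwise) (auto intro: smooth_on_add)

lift_definition minus_germ :: "'a germ \<Rightarrow> 'a germ \<Rightarrow> 'a germ" is "\<lambda>f g x. f x - g x"
  by (rule germ_rel_pointwise) (auto intro: smooth_on_diff)

lift_definition times_germ :: "'a germ \<Rightarrow> 'a germ \<Rightarrow> 'a germ" is "\<lambda>f g x. f x * g x"
  by (rule germ_rel_pointwise) (auto intro: smooth_on_mult)

lift_definition uminus_germ :: "'a germ \<Rightarrow> 'a germ" is "\<lambda>f x. - f x"
  using germ_rel_pointwise[where p = "\<lambda>a b. - a"] smooth_on_minus by blast

instance
proof
  fix a b c :: "'a germ"
  have refl: "germ_rel f f \<Longrightarrow> germ_rel g g \<Longrightarrow> germ_rel (\<lambda>x. f x + g x) (\<lambda>x. f x + g x)"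
    "germ_rel f f \<Longrightarrow> germ_rel g g \<Longrightarrow> germ_rel (\<lambda>x. f x - g x) (\<lambda>x. f x - g x)"
    "germ_rel f f \<Longrightarrow> germ_rel g g \<Longrightarrow> germ_rel (\<lambda>x. f x * g x) (\<lambda>x. f x * g x)"
    for f g :: "'a \<Rightarrow> real"
    by (rule germ_rel_pointwise; auto intro: smooth_on_add smooth_on_diff smooth_on_mult)+
  show "a + b + c = a + (b + c)" "a + b = b + a" "0 + a = a" "a - b = a + - b"
    "a * b * c = a * (b * c)" "a * b = b * a" "1 * a = a"
    by (transfer, auto simp: ac_simps intro!: refl)+
  show "- a + a = 0"
    by (transfer, rule germ_relI[of UNIV]) (auto intro: smooth_on_const)
  show "(a + b) * c = a * c + b * c"
    by (transfer, auto simp: distrib_right intro!: refl)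
  show "(0 :: 'a germ) \<noteq> 1"
    by transfer (auto simp: germ_rel_def)
qed

end

lift_definition germ_value :: "'e::euclidean_space germ \<Rightarrow> real" is "\<lambda>f. f 0"
  by (auto elim: germ_relE)

lift_definition germ_deriv :: "'e::euclidean_space \<Rightarrow> 'e germ \<Rightarrow> 'e germ"
  is "\<lambda>v f x. frechet_derivative f (at x) v"
proof -
  fix v and f g :: "'e \<Rightarrow> real" assume "germ_rel f g"
  then obtain U where U: "open U" "0 \<in> U" "smooth_on U f" "smooth_on U g" "\<forall>x\<in>U. f x = g x"
    by (rule germ_relE)
  show "germ_rel (\<lambda>x. frechet_derivative f (at x) v) (\<lambda>x. frechet_derivative g (at x) v)"
    using frechet_derivative_transform_within_open[OF smooth_on_differentiable[OF U(1,3)] U(1)] U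
    by (intro germ_relI[of U]) (auto intro: smooth_on_frechet_derivative)
qed

definition germ_at :: "'e::euclidean_space \<Rightarrow> ('e \<Rightarrow> real) \<Rightarrow> 'e germ" where
  "germ_at z f = abs_germ (\<lambda>x. f (z + x))"

lemma germ_value_simps:
  "germ_value 0 = 0" "germ_value 1 = 1" "germ_value (a + b) = germ_value a + germ_value b"
  "germ_value (a - b) = germ_value a - germ_value b" "germ_value (- a) = - germ_value a"
  "germ_value (a * b) = germ_value a * germ_value b"
  by (transfer, simp)+

lemma germ_value_sum: "germ_value (\<Sum>i\<in>I. f i) = (\<Sum>i\<in>I. germ_value (f i))"
  by (induction I rule: infinite_finite_induct) (auto simp: germ_value_simps)

lemma germ_value_numeral: "germ_value (numeral n) = numeral n"
proof (induction n)
  case (Bit0 n)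
  then show ?case by (simp only: numeral_Bit0 germ_value_simps)
next
  case (Bit1 n)
  then show ?case by (simp only: numeral_Bit1 germ_value_simps)
qed (simp add: germ_value_simps)

lemma germ_double_eq_0: "(a :: 'e::euclidean_space germ) + a = 0 \<Longrightarrow> a = 0"
proof transfer
  fix f :: "'e \<Rightarrow> real" assume f: "germ_rel f f" and "germ_rel (\<lambda>x. f x + f x) (\<lambda>_. 0)"
  obtain U where "open U" "0 \<in> U" "smooth_on U f" "smooth_on U f" "\<forall>x\<in>U. f x = f x"
    using f by (rule germ_relE)
  moreover obtain V where "open V" "0 \<in> V" "smooth_on V (\<lambda>x. f x + f x)" "smooth_on V (\<lambda>_ :: 'e. 0 :: real)"
      "\<forall>x\<in>V. f x + f x = 0"
    using \<open>germ_rel (\<lambda>x. f x + f x) (\<lambda>_. 0)\<close> by (rule germ_relE)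
  ultimately show "germ_rel f (\<lambda>_. 0)"
    by (intro germ_relI[of "U \<inter> V"]) (auto intro: smooth_on_subset)
qed

lemma derivation_germ_deriv: "derivation (germ_deriv v)"
  unfolding derivation_def
proof (intro conjI allI)
  fix a b :: "'a germ"
  show "germ_deriv v (a + b) = germ_deriv v a + germ_deriv v b"
  proof transfer
    fix v and f g :: "'a \<Rightarrow> real" assume "germ_rel f f" "germ_rel g g"
    obtain U where "open U" "0 \<in> U" "smooth_on U f" "smooth_on U f" "\<forall>x\<in>U. f x = f x"
      using \<open>germ_rel f f\<close> by (rule germ_relE)
    moreover obtain V where "open V" "0 \<in> V" "smooth_on V g" "smooth_on V g" "\<forall>x\<in>V. g x = g x"
      using \<open>germ_rel g g\<close> by (rule germ_relE)
    ultimately have W: "open (U \<inter> V)" "0 \<in> U \<inter> V" "smooth_on (U \<inter> V) f" "smooth_on (U \<inter> V) g"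
      by (auto intro: smooth_on_subset)
    show "germ_rel (\<lambda>x. frechet_derivative (\<lambda>x. f x + g x) (at x) v)
       (\<lambda>x. frechet_derivative f (at x) v + frechet_derivative g (at x) v)"
    proof (rule germ_relI[OF W(1,2)])
      show "smooth_on (U \<inter> V) (\<lambda>x. frechet_derivative (\<lambda>x. f x + g x) (at x) v)"
        by (intro smooth_on_frechet_derivative smooth_on_add W)
      show "frechet_derivative (\<lambda>x. f x + g x) (at x) v
        = frechet_derivative f (at x) v + frechet_derivative g (at x) v" if "x \<in> U \<inter> V" for x
      proof -
        have "((\<lambda>x. f x + g x) has_derivative
          (\<lambda>v. frechet_derivative f (at x) v + frechet_derivative g (at x) v)) (at x)"
          using smooth_on_differentiable[OF W(1)] W(3,4) that
          by (intro has_derivative_add) (auto simp: frechet_derivative_works[symmetric])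
        from fun_cong[OF frechet_derivative_at[OF this], of v] show ?thesis by simp
      qed
    qed
  qed
next
  fix a b :: "'a germ"
  show "germ_deriv v (a * b) = germ_deriv v a * b + a * germ_deriv v b"
  proof transfer
    fix v and f g :: "'a \<Rightarrow> real" assume "germ_rel f f" "germ_rel g g"
    obtain U where "open U" "0 \<in> U" "smooth_on U f" "smooth_on U f" "\<forall>x\<in>U. f x = f x"
      using \<open>germ_rel f f\<close> by (rule germ_relE)
    moreover obtain V where "open V" "0 \<in> V" "smooth_on V g" "smooth_on V g" "\<forall>x\<in>V. g x = g x"
      using \<open>germ_rel g g\<close> by (rule germ_relE)
    ultimately have W: "open (U \<inter> V)" "0 \<in> U \<inter> V" "smooth_on (U \<inter> V) f" "smooth_on (U \<inter> V) g"
      by (auto intro: smooth_on_subset)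
    show "germ_rel (\<lambda>x. frechet_derivative (\<lambda>x. f x * g x) (at x) v)
       (\<lambda>x. frechet_derivative f (at x) v * g x + f x * frechet_derivative g (at x) v)"
    proof (rule germ_relI[OF W(1,2)])
      show "smooth_on (U \<inter> V) (\<lambda>x. frechet_derivative (\<lambda>x. f x * g x) (at x) v)"
        by (intro smooth_on_frechet_derivative smooth_on_mult W)
      show "frechet_derivative (\<lambda>x. f x * g x) (at x) v
        = frechet_derivative f (at x) v * g x + f x * frechet_derivative g (at x) v" if "x \<in> U \<inter> V" for x
      proof -
        have "((\<lambda>x. f x * g x) has_derivative
          (\<lambda>v. f x * frechet_derivative g (at x) v + frechet_derivative f (at x) v * g x)) (at x)"
          using smooth_on_differentiable[OF W(1)] W(3,4) that
          by (intro has_derivative_mult) (auto simp: frechet_derivative_works[symmetric])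
        from fun_cong[OF frechet_derivative_at[OF this], of v] show ?thesis by simp
      qed
    qed
  qed
qed

lemma germ_deriv_commute: "germ_deriv v (germ_deriv w a) = germ_deriv w (germ_deriv v a)"
proof transfer
  fix v w and f :: "'a \<Rightarrow> real" assume "germ_rel f f"
  then obtain U where U: "open U" "0 \<in> U" "smooth_on U f" "smooth_on U f" "\<forall>x\<in>U. f x = f x"
    by (rule germ_relE)
  show "germ_rel (\<lambda>x. frechet_derivative (\<lambda>x. frechet_derivative f (at x) w) (at x) v)
     (\<lambda>x. frechet_derivative (\<lambda>x. frechet_derivative f (at x) v) (at x) w)"
    by (rule germ_relI[OF U(1,2)])
      (use U in \<open>auto intro!: smooth_on_frechet_derivative frechet_derivative_commute\<close>)
qed

context
  fixes W :: "'e::euclidean_space set" and z :: 'e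
  assumes W: "open W" "z \<in> W"
begin

lemma smooth_on_shift:
  assumes "smooth_on W f"
  shows "smooth_on ((+) z -` W) (\<lambda>x. f (z + x))"
proof (rule smooth_on_compose)
  show op: "open ((+) z -` W)"
    using W by (intro open_vimage continuous_intros)
  show "smooth_on ((+) z -` W) ((+) z)"
    by (intro smooth_on_add[OF op] smooth_on_const[OF op] smooth_on_linear[OF op] bounded_linear_ident)
qed (use W assms in auto)

lemma germ_rel_at:
  assumes "smooth_on W f" "\<And>x. x \<in> W \<Longrightarrow> f x = g x"
  shows "germ_rel (\<lambda>x. f (z + x)) (\<lambda>x. g (z + x))"
proof (rule germ_relI[of "(+) z -` W"])
  show "open ((+) z -` W)"
    using W by (intro open_vimage continuous_intros)
qed (use W assms smooth_on_shift in auto)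

text \<open>The gate from analysis to algebra: identities between component functions on a
  neighbourhood become equations in the ring.\<close>

lemma germ_at_cong: "smooth_on W f \<Longrightarrow> (\<And>x. x \<in> W \<Longrightarrow> f x = g x) \<Longrightarrow> germ_at z f = germ_at z g"
  using germ_rel_at[of f g] Quotient_rel_abs[OF Quotient_germ] unfolding germ_at_def by blast

lemma germ_value_at: "smooth_on W f \<Longrightarrow> germ_value (germ_at z f) = f z"
  using germ_value.abs_eq[of "\<lambda>x. f (z + x)"] germ_rel_at[of f f]
  by (simp add: germ_at_def eq_onp_def)

lemma
  assumes "smooth_on W f" "smooth_on W g"
  shows germ_at_add: "germ_at z f + germ_at z g = germ_at z (\<lambda>x. f x + g x)"
    and germ_at_diff: "germ_at z f - germ_at z g = germ_at z (\<lambda>x. f x - g x)"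
    and germ_at_mult: "germ_at z f * germ_at z g = germ_at z (\<lambda>x. f x * g x)"
  using germ_rel_at[OF assms(1) refl] germ_rel_at[OF assms(2) refl]
  by (simp_all add: germ_at_def plus_germ.abs_eq minus_germ.abs_eq times_germ.abs_eq)

lemma germ_at_minus: "smooth_on W f \<Longrightarrow> - germ_at z f = germ_at z (\<lambda>x. - f x)"
  using germ_rel_at[of f f] by (simp add: germ_at_def uminus_germ.abs_eq)

lemma germ_at_0: "germ_at z (\<lambda>x. 0) = 0"
  by (simp add: germ_at_def zero_germ_def)

lemma germ_at_1: "germ_at z (\<lambda>x. 1) = 1"
  by (simp add: germ_at_def one_germ_def)

lemma germ_at_sum:
  assumes "\<And>i. i \<in> I \<Longrightarrow> smooth_on W (f i)"
  shows "(\<Sum>i\<in>I. germ_at z (f i)) = germ_at z (\<lambda>x. \<Sum>i\<in>I. f i x)"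
  using assms
  by (induction I rule: infinite_finite_induct)
    (simp_all add: germ_at_0 germ_at_add smooth_on_sum W)

lemma germ_at_numeral: "numeral n = germ_at z (\<lambda>x. numeral n)"
proof (induction n)
  case One
  then show ?case by (simp add: germ_at_1)
next
  case (Bit0 n)
  show ?case by (simp only: numeral_Bit0 Bit0.IH germ_at_add smooth_on_const[OF W(1)])
next
  case (Bit1 n)
  show ?case
    by (simp only: numeral_Bit1 Bit1.IH germ_at_1[symmetric] germ_at_add smooth_on_const[OF W(1)]
        smooth_on_add[OF W(1)])
qed

lemma germ_deriv_at:
  assumes "smooth_on W f"
  shows "germ_deriv v (germ_at z f) = germ_at z (\<lambda>x. frechet_derivative f (at x) v)"
proof -
  let ?S = "(+) z -` W"
  have op: "open ?S"
    using W by (intro open_vimage continuous_intros)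
  have "germ_rel (\<lambda>x. frechet_derivative (\<lambda>x. f (z + x)) (at x) v) (\<lambda>x. frechet_derivative f (at (z + x)) v)"
  proof (rule germ_relI[OF op])
    show "smooth_on ?S (\<lambda>x. frechet_derivative (\<lambda>x. f (z + x)) (at x) v)"
      by (rule smooth_on_frechet_derivative[OF op smooth_on_shift[OF assms]])
    show "frechet_derivative (\<lambda>x. f (z + x)) (at x) v = frechet_derivative f (at (z + x)) v" if "x \<in> ?S" for x
    proof -
      have "(f has_derivative frechet_derivative f (at (z + x))) (at (z + x))"
        using smooth_on_differentiable[OF W(1) assms, of "z + x"] that
        by (simp add: frechet_derivative_works[symmetric])
      moreover have "((+) z has_derivative (\<lambda>v. v)) (at x)"
        by (auto intro!: derivative_eq_intros)
      ultimately have "((\<lambda>x. f (z + x)) has_derivative frechet_derivative f (at (z + x))) (at x)"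
        using has_derivative_compose by blast
      from frechet_derivative_at[OF this] show ?thesis by simp
    qed
  qed (use W in auto)
  then have "abs_germ (\<lambda>x. frechet_derivative (\<lambda>x. f (z + x)) (at x) v) = abs_germ (\<lambda>x. frechet_derivative f (at (z + x)) v)"
    using Quotient_rel_abs[OF Quotient_germ] by blast
  then show ?thesis
    using germ_rel_at[OF assms refl] by (simp add: germ_at_def germ_deriv.abs_eq)
qed

end

section \<open>Positive semidefinite matrices and minima\<close>

lemma psd_row_zero:
  fixes P :: "real ^ 'm ^ 'm::finite"
  assumes sym: "\<And>i j. P $ i $ j = P $ j $ i" and psd: "\<And>v. 0 \<le> v \<bullet> (P *v v)"
    and k: "P $ k $ k = 0"
  shows "P $ k $ j = 0"
proof (rule ccontr)
  assume nz: "P $ k $ j \<noteq> 0"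
  \<comment> \<open>The solution of 2 s P_kj + P_jj = -1; the left side is the value of the form at
    \<open>?v\<close>.\<close>
  define s where "s = - (P $ j $ j + 1) / (2 * P $ k $ j)"
  let ?v = "s *\<^sub>R axis k 1 + axis j 1 :: real ^ 'm"
  have form: "axis a 1 \<bullet> (P *v axis b 1) = P $ a $ b" for a b
    by (simp add: inner_axis' matrix_vector_mult_basis column_def)
  have "?v \<bullet> (P *v ?v) = 2 * s * P $ k $ j + P $ j $ j"
    by (simp add: matrix_vector_right_distrib matrix_vector_mult_scaleR inner_add_left inner_add_right form k sym[of j k])
  also have "\<dots> = - 1"
    using nz by (simp add: s_def) (simp add: field_simps)
  finally show False using psd[of ?v] by simp
qed

text \<open>Symmetric elimination: subtracting \<open>P\<^sub>k P\<^sub>k\<^sup>T / P\<^sub>k\<^sub>k\<close> clears row and column \<open>k\<close>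
  and preserves semidefiniteness.\<close>

lemma psd_sum_outer_aux:
  fixes P :: "real ^ 'm ^ 'm::finite"
  assumes "finite I" "\<And>i j. P $ i $ j = P $ j $ i" "\<And>v. 0 \<le> v \<bullet> (P *v v)"
    "\<And>i j. i \<notin> I \<Longrightarrow> P $ i $ j = 0"
  shows "\<exists>v :: 'm \<Rightarrow> real ^ 'm. \<forall>i j. P $ i $ j = (\<Sum>k\<in>I. v k $ i * v k $ j)"
  using assms
proof (induction I arbitrary: P rule: finite_induct)
  case empty
  then show ?case by simp
next
  case (insert k I)
  note sym = insert.prems(1) and psd = insert.prems(2)
  show ?case
  proof (cases "P $ k $ k = 0")
    case True
    have "P $ i $ j = 0" if "i \<notin> I" for i j
      using that psd_row_zero[OF sym psd True] insert.prems(3) by (cases "i = k") auto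
    then obtain v :: "'m \<Rightarrow> real ^ 'm" where v: "\<forall>i j. P $ i $ j = (\<Sum>k\<in>I. v k $ i * v k $ j)"
      using insert.IH[OF sym psd] by blast
    have "\<forall>i j. P $ i $ j = (\<Sum>l\<in>insert k I. (if l = k then 0 else v l) $ i * (if l = k then 0 else v l) $ j)"
      using v insert.hyps by (auto intro!: sum.cong)
    then show ?thesis by (rule exI[of _ "\<lambda>l. if l = k then 0 else v l"])
  next
    case False
    have form: "axis a 1 \<bullet> (P *v axis b 1) = P $ a $ b" for a b
      by (simp add: inner_axis' matrix_vector_mult_basis column_def)
    have pos: "P $ k $ k > 0"
      using psd[of "axis k 1"] False by (simp add: form)
    define r where "r = (1 / sqrt (P $ k $ k)) *\<^sub>R P $ k"
    define P' where "P' = (\<chi> i j. P $ i $ j - r $ i * r $ j)"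
    have rr: "r $ i * r $ j = P $ k $ i * P $ k $ j / P $ k $ k" for i j
      using pos by (simp add: r_def)
    have "P' $ i $ j = P' $ j $ i" for i j
      by (simp add: P'_def sym[of i j])
    moreover have "0 \<le> w \<bullet> (P' *v w)" for w
    proof -
      \<comment> \<open>The form of \<open>P\<close> is minimal at this \<open>c\<close> along the
        line w - c e_k, and the minimum is the value of the reduced form of \<open>P'\<close> at
        \<open>w\<close>.\<close>
      define c where "c = (P $ k \<bullet> w) / P $ k $ k"
      have Pk: "axis k 1 \<bullet> (P *v w) = P $ k \<bullet> w"
        by (simp add: inner_axis') (simp add: matrix_vector_mult_def inner_vec_def)
      have Pk': "w \<bullet> (P *v axis k 1) = P $ k \<bullet> w"
        by (simp add: matrix_vector_mult_basis column_def inner_vec_def sym[of _ k] mult.commute)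
      have "w \<bullet> (P' *v w) = w \<bullet> (P *v w) - (r \<bullet> w)\<^sup>2"
        by (simp add: P'_def inner_vec_def matrix_vector_mult_def left_diff_distrib right_diff_distrib
            sum_subtractf power2_eq_square sum_distrib_left sum_distrib_right ac_simps)
      moreover have "(r \<bullet> w)\<^sup>2 = (P $ k \<bullet> w)\<^sup>2 / P $ k $ k"
        using pos by (simp add: r_def power_divide)
      moreover have "(w - c *\<^sub>R axis k 1) \<bullet> (P *v (w - c *\<^sub>R axis k 1))
          = w \<bullet> (P *v w) - 2 * c * (P $ k \<bullet> w) + c * c * P $ k $ k"
        by (simp add: matrix_vector_mult_diff_distrib matrix_vector_mult_scaleR inner_diff_left
            inner_diff_right form Pk Pk' algebra_simps)
      moreover have "- 2 * c * (P $ k \<bullet> w) + c * c * P $ k $ k = - ((P $ k \<bullet> w)\<^sup>2 / P $ k $ k)"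
        using pos by (simp add: c_def power2_eq_square field_simps)
      ultimately show ?thesis
        using psd[of "w - c *\<^sub>R axis k 1"] by linarith
    qed
    moreover have "P' $ i $ j = 0" if "i \<notin> I" for i j
    proof (cases "i = k")
      case True
      then show ?thesis using pos by (simp add: P'_def rr)
    next
      case False
      then have "P $ i $ j = 0" "P $ i $ k = 0" using insert.prems(3) that by auto
      then show ?thesis by (simp add: P'_def rr sym[of k i])
    qed
    ultimately obtain v :: "'m \<Rightarrow> real ^ 'm" where v: "\<forall>i j. P' $ i $ j = (\<Sum>k\<in>I. v k $ i * v k $ j)"
      using insert.IH[of P'] by blast
    have "P $ i $ j = (\<Sum>l\<in>insert k I. (v(k := r)) l $ i * (v(k := r)) l $ j)" for i j
    proof -
      have "P $ i $ j = r $ i * r $ j + P' $ i $ j" by (simp add: P'_def)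
      also have "P' $ i $ j = (\<Sum>l\<in>I. (v(k := r)) l $ i * (v(k := r)) l $ j)"
        using v insert.hyps by (auto intro!: sum.cong)
      finally show ?thesis using insert.hyps by simp
    qed
    then show ?thesis by blast
  qed
qed

lemma psd_factor:
  fixes P :: "real ^ 'm ^ 'm::finite"
  assumes "transpose P = P" "\<And>v. 0 \<le> v \<bullet> (P *v v)"
  obtains V :: "real ^ 'm ^ 'm" where "P = transpose V ** V"
proof -
  have "P $ i $ j = P $ j $ i" for i j
    using arg_cong[OF assms(1), of "\<lambda>A. A $ i $ j"] by (simp add: transpose_def)
  then obtain v :: "'m \<Rightarrow> real ^ 'm" where "\<forall>i j. P $ i $ j = (\<Sum>k\<in>UNIV. v k $ i * v k $ j)"
    using psd_sum_outer_aux[of UNIV P] assms(2) by auto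
  then have "P = transpose (\<chi> k i. v k $ i) ** (\<chi> k i. v k $ i)"
    by (simp add: vec_eq_iff matrix_matrix_mult_def transpose_def)
  then show ?thesis by (rule that)
qed

text \<open>With P = V^T V the contraction is the sum of the values of the form of \<open>A\<close>
  on the rows of \<open>V\<close>.\<close>

lemma trace_psd_nonneg:
  fixes P A :: "real ^ 'm ^ 'm::finite"
  assumes "transpose P = P" "\<And>v. 0 \<le> v \<bullet> (P *v v)"
    and A: "\<And>v :: real ^ 'm. 0 \<le> (\<Sum>i\<in>UNIV. \<Sum>j\<in>UNIV. v $ i * v $ j * A $ i $ j)"
  shows "0 \<le> (\<Sum>i\<in>UNIV. \<Sum>j\<in>UNIV. P $ i $ j * A $ i $ j)"
proof -
  obtain V :: "real ^ 'm ^ 'm" where V: "P = transpose V ** V"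
    by (rule psd_factor[OF assms(1,2)])
  have "(\<Sum>i\<in>UNIV. \<Sum>j\<in>UNIV. P $ i $ j * A $ i $ j)
     = (\<Sum>i\<in>UNIV. \<Sum>j\<in>UNIV. \<Sum>k\<in>UNIV. V $ k $ i * V $ k $ j * A $ i $ j)"
    by (simp add: V matrix_matrix_mult_def transpose_def sum_distrib_right)
  also have "\<dots> = (\<Sum>i\<in>UNIV. \<Sum>k\<in>UNIV. \<Sum>j\<in>UNIV. V $ k $ i * V $ k $ j * A $ i $ j)"
    by (rule sum.cong[OF refl], rule sum.swap)
  also have "\<dots> = (\<Sum>k\<in>UNIV. \<Sum>i\<in>UNIV. \<Sum>j\<in>UNIV. V $ k $ i * V $ k $ j * A $ i $ j)"
    by (rule sum.swap)
  also have "\<dots> \<ge> 0"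
    by (intro sum_nonneg A)
  finally show ?thesis .
qed

text \<open>\<open>M\<close> is \<open>h\<close> read in a frame that diagonalises \<open>P\<close>:
  it is symmetric and has the same traces. Cauchy-Schwarz on its diagonal produces the dimension,
  and adding the off-diagonal squares only helps.\<close>

lemma trace_squared_le:
  fixes P h :: "real ^ 'm ^ 'm::finite"
  assumes "transpose P = P" "\<And>v. 0 \<le> v \<bullet> (P *v v)" and h: "transpose h = h"
  shows "(trace (h ** P))\<^sup>2 \<le> real CARD('m) * trace ((h ** P) ** (h ** P))"
proof -
  obtain V :: "real ^ 'm ^ 'm" where V: "P = transpose V ** V"
    by (rule psd_factor[OF assms(1,2)])
  define M where "M = V ** h ** transpose V"
  have tr: "trace (h ** P) = trace M"
    using trace_mul_sym[of "h ** transpose V" V] by (simp add: M_def V matrix_mul_assoc)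
  have tr2: "trace ((h ** P) ** (h ** P)) = trace (M ** M)"
    using trace_mul_sym[of "h ** transpose V ** V ** h ** transpose V" V]
    by (simp add: M_def V matrix_mul_assoc)
  have M_sym: "M $ j $ i = M $ i $ j" for i j
  proof -
    have "transpose M = M" by (simp add: M_def matrix_transpose_mul h matrix_mul_assoc)
    from arg_cong[OF this, of "\<lambda>A. A $ i $ j"] show ?thesis by (simp add: transpose_def)
  qed
  have "(trace M)\<^sup>2 = (\<Sum>i\<in>UNIV. 1 * M $ i $ i)\<^sup>2"
    by (simp add: trace_def)
  also have "\<dots> \<le> (\<Sum>i::'m\<in>UNIV. 1\<^sup>2) * (\<Sum>i\<in>UNIV. (M $ i $ i)\<^sup>2)"
    by (rule Cauchy_Schwarz_ineq_sum)
  also have "\<dots> \<le> real CARD('m) * (\<Sum>i\<in>UNIV. \<Sum>j\<in>UNIV. (M $ i $ j)\<^sup>2)"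
    by (auto intro!: mult_left_mono sum_mono member_le_sum)
  also have "(\<Sum>i\<in>UNIV. \<Sum>j\<in>UNIV. (M $ i $ j)\<^sup>2) = trace (M ** M)"
    by (simp add: trace_def matrix_matrix_mult_def power2_eq_square M_sym)
  finally show ?thesis by (simp only: tr tr2)
qed

text \<open>Minimality is required along one line only, so that the lemma applies to spatial
  directions in space-time. A negative second derivative would make the first one negative just
  after the minimum, against the mean value theorem.\<close>

lemma local_min_along_line:
  fixes k :: "'e::euclidean_space \<Rightarrow> real"
  assumes W: "open W" "smooth_on W k" "z \<in> W"
    and min: "\<forall>\<^sub>F r in nhds 0. k z \<le> k (z + r *\<^sub>R v)"
  shows "frechet_derivative k (at z) v = 0"
    and "0 \<le> frechet_derivative (\<lambda>y. frechet_derivative k (at y) v) (at z) v"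
proof -
  define D where "D y = frechet_derivative k (at y) v" for y
  have D: "smooth_on W D"
    unfolding D_def by (rule smooth_on_frechet_derivative[OF W(1,2)])
  have line: "((\<lambda>s. f (z + s *\<^sub>R v)) has_field_derivative frechet_derivative f (at (z + s *\<^sub>R v)) v) (at s)"
    if "smooth_on W f" "z + s *\<^sub>R v \<in> W" for f :: "'e \<Rightarrow> real" and s
    using line_has_derivative[OF smooth_on_differentiable[OF W(1) that]]
    by (simp add: has_real_derivative_iff_has_vector_derivative)
  have "((\<lambda>s. z + s *\<^sub>R v) \<longlongrightarrow> z + 0 *\<^sub>R v) (nhds 0)"
    by (intro tendsto_intros filterlim_ident)
  then have "\<forall>\<^sub>F s in nhds 0. z + s *\<^sub>R v \<in> W"
    using W topological_tendstoD by fastforce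
  then obtain \<delta> where \<delta>: "\<delta> > 0" "\<And>s. \<bar>s\<bar> < \<delta> \<Longrightarrow> z + s *\<^sub>R v \<in> W \<and> k z \<le> k (z + s *\<^sub>R v)"
    using min eventually_conj unfolding eventually_nhds_metric dist_real_def by (metis (no_types, lifting) diff_zero min_less_iff_conj)
  have "D z = 0"
    using DERIV_local_min[OF line[OF W(2), of 0, simplified, OF W(3)] \<delta>(1)] \<delta>(2) by (simp add: D_def)
  then show "frechet_derivative k (at z) v = 0"
    by (simp add: D_def)
  have "0 \<le> frechet_derivative D (at z) v"
  proof (rule ccontr)
    assume "\<not> ?thesis"
    then obtain \<eta> where \<eta>: "\<eta> > 0" "\<And>h. 0 < h \<Longrightarrow> h < \<eta> \<Longrightarrow> D (z + h *\<^sub>R v) < 0"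
      using DERIV_neg_dec_right[OF line[OF D, of 0, simplified, OF W(3)]] \<open>D z = 0\<close> by auto
    define h where "h = min \<delta> \<eta> / 2"
    have h: "0 < h" "h < \<delta>" "h < \<eta>" using \<delta>(1) \<eta>(1) by (auto simp: h_def)
    have "\<exists>s. 0 < s \<and> s < h \<and> k (z + h *\<^sub>R v) - k (z + 0 *\<^sub>R v) = (h - 0) * D (z + s *\<^sub>R v)"
      by (rule MVT2[OF h(1)]) (use \<delta>(2) h in \<open>auto simp: D_def intro!: line W\<close>)
    then obtain s where s: "0 < s" "s < h" "k (z + h *\<^sub>R v) - k z = h * D (z + s *\<^sub>R v)"
      by auto
    have "h * D (z + s *\<^sub>R v) < 0"
      using \<eta>(2)[of s] s h by (simp add: mult_pos_neg)
    then show False using \<delta>(2)[of h] h s(3) by simp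
  qed
  then show "0 \<le> frechet_derivative (\<lambda>y. frechet_derivative k (at y) v) (at z) v"
    by (simp add: D_def[abs_def])
qed

section \<open>The flow in one chart\<close>

lemma frechet_derivative_vec_nth:
  fixes K :: "'e::euclidean_space \<Rightarrow> 'f::euclidean_space ^ 'n::finite"
  assumes "K differentiable at z"
  shows "frechet_derivative (\<lambda>z. K z $ a) (at z) v = frechet_derivative K (at z) v $ a"
proof -
  have "(K has_derivative frechet_derivative K (at z)) (at z)"
    using assms by (simp add: frechet_derivative_works[symmetric])
  then have "((\<lambda>z. K z $ a) has_derivative (\<lambda>v. frechet_derivative K (at z) v $ a)) (at z)"
    by (rule bounded_linear.has_derivative[OF bounded_linear_vec_nth])
  from fun_cong[OF frechet_derivative_at[OF this], of v] show ?thesis by simp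
qed

lemma pd_cong:
  assumes "open U" "x \<in> U" "f differentiable at x" "\<And>y. y \<in> U \<Longrightarrow> f y = g y"
  shows "pd i f x = pd i g x"
  unfolding pd_def using frechet_derivative_transform_within_open[OF assms(3,1,2,4)] by simp

text \<open>Curvature and tension are defined by differentiation in space at a fixed time, whereas
  the germs live on space-time; these two facts translate.\<close>

lemma
  fixes k :: "(real ^ 'm::finite) \<times> real \<Rightarrow> 'b::real_normed_vector"
  assumes "k differentiable at (x, t)"
  shows pd_slice: "pd i (\<lambda>y. k (y, t)) x = frechet_derivative k (at (x, t)) (axis i 1, 0)"
    and time_slice: "((\<lambda>s. k (x, s)) has_vector_derivative frechet_derivative k (at (x, t)) (0, 1)) (at t)"
proof -
  have k: "(k has_derivative frechet_derivative k (at (x, t))) (at (x, t))"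
    using assms by (simp add: frechet_derivative_works[symmetric])
  moreover have "((\<lambda>y. (y, t)) has_derivative (\<lambda>v. (v, 0))) (at x)"
    by (auto intro!: derivative_eq_intros)
  ultimately have d: "((\<lambda>y. k (y, t)) has_derivative (\<lambda>v. frechet_derivative k (at (x, t)) (v, 0))) (at x)"
    using has_derivative_compose by blast
  show "pd i (\<lambda>y. k (y, t)) x = frechet_derivative k (at (x, t)) (axis i 1, 0)"
    unfolding pd_def using fun_cong[OF frechet_derivative_at[OF d], of "axis i 1"] by simp
  show "((\<lambda>s. k (x, s)) has_vector_derivative frechet_derivative k (at (x, t)) (0, 1)) (at t)"
    using line_has_derivative[of k "(x, 0)" t "(0, 1)"] assms by simp
qed

lemma smooth_on_pd:
  assumes "open S" "smooth_on S f"
  shows "smooth_on S (pd i f)"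
  using smooth_on_frechet_derivative[OF assms] by (simp add: pd_def[abs_def])

context
  fixes U :: "(real ^ 'm::finite) set" and G :: "real ^ 'm \<Rightarrow> real ^ 'm ^ 'm"
  assumes U: "open U" and G: "smooth_on U G" and G_sym: "\<And>x. x \<in> U \<Longrightarrow> transpose (G x) = G x"
begin

lemma smooth_on_component: "smooth_on U (\<lambda>x. G x $ i $ j)"
  by (intro smooth_on_vec_nth U G)

lemma pd_metric_sym: "x \<in> U \<Longrightarrow> pd k (\<lambda>y. G y $ i $ j) x = pd k (\<lambda>y. G y $ j $ i) x"
proof (rule pd_cong[OF U])
  show "G y $ i $ j = G y $ j $ i" if "y \<in> U" for y
    using arg_cong[OF G_sym[OF that], of "\<lambda>A. A $ j $ i"] by (simp add: transpose_def)
qed (auto intro: smooth_on_differentiable[OF U smooth_on_component])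

lemma christoffel_sym: "x \<in> U \<Longrightarrow> christoffel G k i j x = christoffel G k j i x"
  unfolding christoffel_def using pd_metric_sym[of x _ i j] by (simp add: add.commute)

lemma smooth_on_christoffel:
  assumes "\<And>x. x \<in> U \<Longrightarrow> det (G x) \<noteq> 0"
  shows "smooth_on U (christoffel G k i j)"
proof -
  have "smooth_on U (\<lambda>x. christoffel G k i j x)"
    unfolding christoffel_def
    by (intro U smooth_on_mult smooth_on_const smooth_on_sum smooth_on_add smooth_on_diff
        smooth_on_pd smooth_on_component smooth_on_matrix_inv assms)
  then show ?thesis .
qed

text \<open>Lowering the index removes the inverse metric from the Christoffel symbol. In the sum of
  the two lowered symbols all derivatives but the wanted one cancel by the symmetry of
  \<open>G\<close>.\<close>

lemma christoffel_compat:
  assumes x: "x \<in> U" and "det (G x) \<noteq> 0"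
  shows "pd i (\<lambda>y. G y $ a $ b) x =
    (\<Sum>d\<in>UNIV. christoffel G d i a x * G x $ d $ b) + (\<Sum>d\<in>UNIV. G x $ a $ d * christoffel G d i b x)"
proof -
  have lower: "(\<Sum>d\<in>UNIV. G x $ b $ d * christoffel G d i a x) =
     (1 / 2) * (pd i (\<lambda>y. G y $ a $ b) x + pd a (\<lambda>y. G y $ i $ b) x - pd b (\<lambda>y. G y $ i $ a) x)" for a b
  proof -
    let ?X = "\<lambda>l. pd i (\<lambda>y. G y $ a $ l) x + pd a (\<lambda>y. G y $ i $ l) x - pd l (\<lambda>y. G y $ i $ a) x"
    have "(\<Sum>d\<in>UNIV. G x $ b $ d * christoffel G d i a x)
       = (\<Sum>d\<in>UNIV. \<Sum>l\<in>UNIV. (1 / 2) * (G x $ b $ d * matrix_inv (G x) $ d $ l * ?X l))"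
      by (simp add: christoffel_def sum_distrib_left ac_simps)
    also have "\<dots> = (\<Sum>l\<in>UNIV. \<Sum>d\<in>UNIV. (1 / 2) * (G x $ b $ d * matrix_inv (G x) $ d $ l * ?X l))"
      by (rule sum.swap)
    also have "\<dots> = (\<Sum>l\<in>UNIV. (1 / 2) * ((G x ** matrix_inv (G x)) $ b $ l * ?X l))"
      by (simp only: sum_distrib_left[symmetric] sum_distrib_right[symmetric] matrix_mult_nth)
    also have "\<dots> = (\<Sum>l\<in>UNIV. if b = l then (1 / 2) * ?X l else 0)"
      by (rule sum.cong) (auto simp: matrix_inv_mult[OF assms(2)] mat_def)
    finally show ?thesis by simp
  qed
  have "G x $ d $ b = G x $ b $ d" for d
    using arg_cong[OF G_sym[OF x], of "\<lambda>A. A $ b $ d"] by (simp add: transpose_def)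
  then have swap: "(\<Sum>d\<in>UNIV. christoffel G d i a x * G x $ d $ b) = (\<Sum>d\<in>UNIV. G x $ b $ d * christoffel G d i a x)"
    by (simp only: mult.commute)
  show ?thesis
    unfolding swap lower
    using pd_metric_sym[OF x, of i b a] pd_metric_sym[OF x, of a b i] pd_metric_sym[OF x, of b a i]
    by (simp add: field_simps)
qed

end

section \<open>Components of the flow on an open piece of space-time\<close>

text \<open>The image of \<open>W\<close> lies in one target chart. Since the set of points mapped
  into that chart moves with time, \<open>W\<close> is not taken to be a product.\<close>

locale rh_local =
  fixes W :: "((real ^ 'm::finite) \<times> real) set" and G :: "real \<Rightarrow> real ^ 'm \<Rightarrow> real ^ 'm ^ 'm"
    and V :: "(real ^ 'n::finite) set" and H :: "real ^ 'n \<Rightarrow> real ^ 'n ^ 'n"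
    and f :: "real \<Rightarrow> real ^ 'm \<Rightarrow> real ^ 'n" and \<alpha> :: "real \<Rightarrow> real"
  assumes W: "open W" and V: "open V"
    and smooth_G: "smooth_on W (\<lambda>z. G (snd z) (fst z))"
    and smooth_f: "smooth_on W (\<lambda>z. f (snd z) (fst z))"
    and smooth_\<alpha>: "smooth_on W (\<lambda>z. \<alpha> (snd z))"
    and smooth_H: "smooth_on V H"
    and f_in: "z \<in> W \<Longrightarrow> f (snd z) (fst z) \<in> V"
    and G_sym: "z \<in> W \<Longrightarrow> transpose (G (snd z) (fst z)) = G (snd z) (fst z)"
    and G_pos: "z \<in> W \<Longrightarrow> v \<noteq> 0 \<Longrightarrow> 0 < v \<bullet> (G (snd z) (fst z) *v v)"
    and H_sym: "y \<in> V \<Longrightarrow> transpose (H y) = H y"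
    and H_pos: "y \<in> V \<Longrightarrow> w \<noteq> 0 \<Longrightarrow> 0 < w \<bullet> (H y *v w)"
    and flow_G: "(x, t) \<in> W \<Longrightarrow> ((\<lambda>s. G s x) has_vector_derivative
        (-2) *\<^sub>R ricci (G t) x + (2 * \<alpha> t) *\<^sub>R grad_tensor_grad H (f t) x) (at t)"
    and flow_f: "(x, t) \<in> W \<Longrightarrow> ((\<lambda>s. f s x) has_vector_derivative tension (G t) H (f t) x) (at t)"
    and \<alpha>_nonneg: "z \<in> W \<Longrightarrow> 0 \<le> \<alpha> (snd z)"
    and \<alpha>_decreasing: "z \<in> W \<Longrightarrow> frechet_derivative (\<lambda>z. \<alpha> (snd z)) (at z) (0, 1) \<le> 0"
begin

definition gf where "gf i j z = G (snd z) (fst z) $ i $ j"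
definition Pf where "Pf i j z = matrix_inv (G (snd z) (fst z)) $ i $ j"
definition \<Gamma>f where "\<Gamma>f i l k z = christoffel (G (snd z)) l i k (fst z)"
definition \<phi>f where "\<phi>f a z = f (snd z) (fst z) $ a"
definition Hf where "Hf a b z = H (f (snd z) (fst z)) $ a $ b"
definition \<Lambda>f where "\<Lambda>f c a b z = christoffel H a c b (f (snd z) (fst z))"
definition \<alpha>f where "\<alpha>f z = \<alpha> (snd z)"
definition ds :: "'m \<Rightarrow> ((real ^ 'm) \<times> real \<Rightarrow> 'x::real_normed_vector) \<Rightarrow> (real ^ 'm) \<times> real \<Rightarrow> 'x"
  where "ds i k z = frechet_derivative k (at z) (axis i 1, 0)"
definition dT :: "((real ^ 'm) \<times> real \<Rightarrow> real) \<Rightarrow> (real ^ 'm) \<times> real \<Rightarrow> real"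
  where "dT k z = frechet_derivative k (at z) (0, 1)"
text \<open>Expressed through the metric alone, so that no target chart enters;
  \<open>Sf_eq_curvature\<close> recovers R - \<alpha> |\<nabla>\<phi>|^2.\<close>

definition Sf where "Sf z = - (1 / 2) * (\<Sum>i\<in>UNIV. \<Sum>k\<in>UNIV. dT (gf i k) z * Pf k i z)"

lemma det_G: "z \<in> W \<Longrightarrow> det (G (snd z) (fst z)) \<noteq> 0"
  using det_ne_0_pos_def[OF G_pos] by blast

lemma det_H: "y \<in> V \<Longrightarrow> det (H y) \<noteq> 0"
  using det_ne_0_pos_def[OF H_pos] by blast

lemma smooth_ds: "smooth_on W k \<Longrightarrow> smooth_on W (ds i k)"
  using smooth_on_frechet_derivative[OF W] by (simp add: ds_def[abs_def])

lemma smooth_dT: "smooth_on W k \<Longrightarrow> smooth_on W (dT k)"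
  using smooth_on_frechet_derivative[OF W] by (simp add: dT_def[abs_def])

lemma smooth_gf: "smooth_on W (gf i j)"
  unfolding gf_def[abs_def] by (intro smooth_on_vec_nth W smooth_G)

lemma smooth_Pf: "smooth_on W (Pf i j)"
  unfolding Pf_def[abs_def] by (intro smooth_on_matrix_inv W det_G smooth_on_vec_nth smooth_G)

lemma smooth_\<phi>f: "smooth_on W (\<phi>f a)"
  unfolding \<phi>f_def[abs_def] by (intro smooth_on_vec_nth W smooth_f)

lemma smooth_Hf: "smooth_on W (Hf a b)"
  unfolding Hf_def[abs_def]
  by (rule smooth_on_compose[OF W V, of _ "\<lambda>y. H y $ a $ b"])
    (use f_in in \<open>auto intro!: smooth_on_vec_nth V smooth_H smooth_f\<close>)

lemma smooth_\<Lambda>f: "smooth_on W (\<Lambda>f c a b)"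
  unfolding \<Lambda>f_def[abs_def]
  by (rule smooth_on_compose[OF W V, of _ "christoffel H a c b"])
    (use f_in in \<open>auto intro!: smooth_on_christoffel V smooth_H smooth_f H_sym det_H\<close>)

lemma smooth_\<alpha>f: "smooth_on W \<alpha>f"
  using smooth_\<alpha> by (simp add: \<alpha>f_def[abs_def])

lemma pd_ds: "smooth_on W k \<Longrightarrow> (x, t) \<in> W \<Longrightarrow> pd i (\<lambda>y. k (y, t)) x = ds i k (x, t)"
  using pd_slice[OF smooth_on_differentiable[OF W]] by (simp add: ds_def)

lemma slice_open: "open {y. (y, t) \<in> W}"
proof -
  have "open ((\<lambda>y. (y, t)) -` W)"
    by (intro open_vimage W continuous_intros)
  then show ?thesis by (simp add: vimage_def)
qed

lemma smooth_slice:
  assumes "smooth_on W k"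
  shows "smooth_on {y. (y, t) \<in> W} (\<lambda>y. k (y, t))"
proof (rule smooth_on_compose[OF slice_open W _ _ assms])
  have "bounded_linear (\<lambda>y :: real ^ 'm. (y, 0 :: real))"
    by (intro bounded_linear_Pair bounded_linear_ident bounded_linear_zero)
  then have "smooth_on {y. (y, t) \<in> W} (\<lambda>y. (y, 0) + (0, t))"
    by (intro smooth_on_add smooth_on_const smooth_on_linear slice_open)
  then show "smooth_on {y. (y, t) \<in> W} (\<lambda>y. (y, t))" by simp
qed auto

lemma ds_cong: "smooth_on W k \<Longrightarrow> (\<And>z. z \<in> W \<Longrightarrow> k z = k' z) \<Longrightarrow> z \<in> W \<Longrightarrow> ds i k z = ds i k' z"
  unfolding ds_def
  using frechet_derivative_transform_within_open[OF smooth_on_differentiable[OF W] W] by metis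

lemma ds_nth:
  fixes k :: "(real ^ 'm) \<times> real \<Rightarrow> 'x::euclidean_space ^ 'y::finite"
  shows "smooth_on W k \<Longrightarrow> z \<in> W \<Longrightarrow> ds i k z $ a = ds i (\<lambda>z. k z $ a) z"
  unfolding ds_def using frechet_derivative_vec_nth[OF smooth_on_differentiable[OF W]] by metis

lemma pd_G: "(x, t) \<in> W \<Longrightarrow> pd i (\<lambda>y. G t y $ a $ b) x = ds i (gf a b) (x, t)"
  using pd_ds[OF smooth_gf, of x t i a b] by (simp add: gf_def)

lemma pd_f: "(x, t) \<in> W \<Longrightarrow> pd i (f t) x = ds i (\<lambda>z. f (snd z) (fst z)) (x, t)"
  using pd_ds[OF smooth_f, of x t i] by simp

lemma pd_f_nth: "(x, t) \<in> W \<Longrightarrow> pd i (f t) x $ a = ds i (\<phi>f a) (x, t)"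
  by (simp add: pd_f ds_nth smooth_f \<phi>f_def[abs_def])

lemma pd_pd_f_nth:
  assumes "(x, t) \<in> W"
  shows "pd i (pd j (f t)) x $ a = ds i (ds j (\<phi>f a)) (x, t)"
proof -
  have sm: "smooth_on W (ds j (\<lambda>z. f (snd z) (fst z)))"
    by (rule smooth_ds[OF smooth_f])
  have "pd i (\<lambda>y. ds j (\<lambda>z. f (snd z) (fst z)) (y, t)) x = pd i (pd j (f t)) x"
    by (rule pd_cong[OF slice_open[of t]])
      (use assms smooth_on_differentiable[OF slice_open smooth_slice[OF sm]] pd_f in auto)
  then have "pd i (pd j (f t)) x $ a = ds i (ds j (\<lambda>z. f (snd z) (fst z))) (x, t) $ a"
    by (simp add: pd_ds[OF sm assms])
  also have "\<dots> = ds i (\<lambda>z. ds j (\<lambda>z. f (snd z) (fst z)) z $ a) (x, t)"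
    by (rule ds_nth[OF sm assms])
  also have "\<dots> = ds i (ds j (\<phi>f a)) (x, t)"
    by (rule ds_cong[OF smooth_on_vec_nth[OF W sm] _ assms])
      (simp add: ds_nth[OF smooth_f] \<phi>f_def[abs_def])
  finally show ?thesis .
qed

lemma slice_metric:
  "smooth_on {y. (y, t) \<in> W} (G t)" "\<And>y. y \<in> {y. (y, t) \<in> W} \<Longrightarrow> transpose (G t y) = G t y"
  using smooth_slice[OF smooth_G, of t] G_sym[of "(_, t)"] by auto

text \<open>\<open>smooth_on_christoffel\<close> works at a fixed time. Joint smoothness is read off
  from the same formula with \<open>pd\<close> replaced by space-time derivatives.\<close>

lemma smooth_\<Gamma>f: "smooth_on W (\<Gamma>f i l k)"
proof (rule smooth_on_cong)
  show "smooth_on W (\<lambda>z. (1 / 2) * (\<Sum>p\<in>UNIV. Pf l p z * (ds i (gf k p) z + ds k (gf i p) z - ds p (gf i k) z)))"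
    by (intro W smooth_on_mult smooth_on_const smooth_on_sum smooth_on_add smooth_on_diff
        smooth_ds smooth_gf smooth_Pf)
  show "(1 / 2) * (\<Sum>p\<in>UNIV. Pf l p z * (ds i (gf k p) z + ds k (gf i p) z - ds p (gf i k) z)) = \<Gamma>f i l k z"
    if "z \<in> W" for z
    using that by (cases z) (simp add: \<Gamma>f_def christoffel_def pd_G Pf_def)
qed

lemma \<Gamma>f_sym: "z \<in> W \<Longrightarrow> \<Gamma>f i l k z = \<Gamma>f k l i z"
  using christoffel_sym[OF slice_open slice_metric] by (cases z) (simp add: \<Gamma>f_def)

lemma ds_gf:
  "z \<in> W \<Longrightarrow> ds i (gf a b) z = (\<Sum>d\<in>UNIV. \<Gamma>f i d a z * gf d b z) + (\<Sum>d\<in>UNIV. gf a d z * \<Gamma>f i d b z)"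
  using christoffel_compat[OF slice_open slice_metric] det_G[of z]
  by (cases z) (simp add: \<Gamma>f_def gf_def[of _ _ "(x, t)" for x t] pd_G[symmetric])

lemma \<Lambda>f_sym: "z \<in> W \<Longrightarrow> \<Lambda>f c a b z = \<Lambda>f b a c z"
  using christoffel_sym[OF V smooth_H H_sym f_in] by (simp add: \<Lambda>f_def)

text \<open>The chain rule followed by metric compatibility in the target. The direction
  \<open>v\<close> is arbitrary, so this yields both \<open>compat_d\<close> and
  \<open>compat_dt\<close>.\<close>

lemma frechet_derivative_Hf:
  assumes z: "z \<in> W"
  shows "frechet_derivative (Hf a b) (at z) v =
    (\<Sum>d\<in>UNIV. (\<Sum>c\<in>UNIV. \<Lambda>f c d a z * frechet_derivative (\<phi>f c) (at z) v) * Hf d b z) +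
    (\<Sum>d\<in>UNIV. Hf a d z * (\<Sum>c\<in>UNIV. \<Lambda>f c d b z * frechet_derivative (\<phi>f c) (at z) v))"
proof -
  let ?\<Phi> = "\<lambda>z. f (snd z) (fst z)" and ?h = "\<lambda>y. H y $ a $ b"
  have h: "?h differentiable at (?\<Phi> z)"
    by (rule smooth_on_differentiable[OF V _ f_in[OF z]]) (intro smooth_on_vec_nth V smooth_H)
  define w where "w = frechet_derivative ?\<Phi> (at z) v"
  have w: "frechet_derivative (\<phi>f c) (at z) v = w $ c" for c
    unfolding w_def \<phi>f_def[abs_def]
    by (rule frechet_derivative_vec_nth[OF smooth_on_differentiable[OF W smooth_f z]])
  have "frechet_derivative (Hf a b) (at z) v = frechet_derivative ?h (at (?\<Phi> z)) w"
    using frechet_derivative_compose[OF smooth_on_differentiable[OF W smooth_f z] h]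
    by (simp add: o_def Hf_def[abs_def] w_def)
  also have "w = (\<Sum>c\<in>UNIV. w $ c *\<^sub>R axis c 1)"
    by (simp add: basis_expansion[of w, unfolded scalar_mult_eq_scaleR])
  also have "frechet_derivative ?h (at (?\<Phi> z)) \<dots> = (\<Sum>c\<in>UNIV. w $ c * pd c ?h (?\<Phi> z))"
    using linear_frechet_derivative[OF h] by (simp add: linear_sum linear_cmul pd_def)
  also have "\<dots> = (\<Sum>c\<in>UNIV. \<Sum>d\<in>UNIV. \<Lambda>f c d a z * w $ c * Hf d b z)
      + (\<Sum>c\<in>UNIV. \<Sum>d\<in>UNIV. Hf a d z * (\<Lambda>f c d b z * w $ c))"
    by (simp add: christoffel_compat[OF V smooth_H H_sym f_in[OF z] det_H[OF f_in[OF z]]]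
        \<Lambda>f_def Hf_def distrib_left sum.distrib sum_distrib_left ac_simps)
  also have "\<dots> = (\<Sum>d\<in>UNIV. \<Sum>c\<in>UNIV. \<Lambda>f c d a z * w $ c * Hf d b z)
      + (\<Sum>d\<in>UNIV. \<Sum>c\<in>UNIV. Hf a d z * (\<Lambda>f c d b z * w $ c))"
    by (intro arg_cong2[where f = "(+)"] sum.swap)
  finally show ?thesis
    by (simp only: w sum_distrib_left sum_distrib_right)
qed

lemma ds_\<alpha>f: "z \<in> W \<Longrightarrow> ds i \<alpha>f z = 0"
  using pd_ds[OF smooth_\<alpha>f, of "fst z" "snd z" i] by (simp add: \<alpha>f_def pd_def)

lemma dT_eqI:
  assumes "smooth_on W k" "(x, t) \<in> W" "((\<lambda>s. k (x, s)) has_vector_derivative D) (at t)"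
  shows "dT k (x, t) = D"
  using vector_derivative_unique_at[OF time_slice[OF smooth_on_differentiable[OF W assms(1,2)]] assms(3)]
  by (simp add: dT_def)

lemma dT_gf:
  assumes "(x, t) \<in> W"
  shows "dT (gf j k) (x, t) = - 2 * ricci (G t) x $ j $ k + 2 * \<alpha> t * grad_tensor_grad H (f t) x $ j $ k"
proof (rule dT_eqI[OF smooth_gf assms])
  have "((\<lambda>s. G s x $ j $ k) has_vector_derivative
     ((-2) *\<^sub>R ricci (G t) x + (2 * \<alpha> t) *\<^sub>R grad_tensor_grad H (f t) x) $ j $ k) (at t)"
    by (intro bounded_linear.has_vector_derivative[OF bounded_linear_vec_nth] flow_G assms)
  then show "((\<lambda>s. gf j k (x, s)) has_vector_derivative
     - 2 * ricci (G t) x $ j $ k + 2 * \<alpha> t * grad_tensor_grad H (f t) x $ j $ k) (at t)"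
    by (simp add: gf_def)
qed

lemma dT_\<phi>f:
  assumes "(x, t) \<in> W"
  shows "dT (\<phi>f a) (x, t) = tension (G t) H (f t) x $ a"
proof (rule dT_eqI[OF smooth_\<phi>f assms])
  show "((\<lambda>s. \<phi>f a (x, s)) has_vector_derivative tension (G t) H (f t) x $ a) (at t)"
    unfolding \<phi>f_def using bounded_linear.has_vector_derivative[OF bounded_linear_vec_nth flow_f[OF assms]]
    by simp
qed

text \<open>\<open>ricf\<close>, \<open>ef\<close> and \<open>hessf\<close> copy the expanded
  algebraic definitions of \<open>Ric\<close>, \<open>e\<close> and \<open>hess\<close> term by
  term, so that germs match them directly; the lemmas ending in \<open>_nth\<close> connect them
  with the coordinate definitions of curvature, energy and Hessian.\<close>

definition ricf where "ricf j k z = (\<Sum>i\<in>UNIV. ds i (\<Gamma>f j i k) z - ds j (\<Gamma>f i i k) z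
  + (\<Sum>p\<in>UNIV. \<Gamma>f i i p z * \<Gamma>f j p k z) - (\<Sum>p\<in>UNIV. \<Gamma>f j i p z * \<Gamma>f i p k z))"

definition ef where "ef i j z =
  (\<Sum>a\<in>UNIV. \<Sum>b\<in>UNIV. Hf a b z * (ds i (\<phi>f a) z * ds j (\<phi>f b) z))"

definition hessf where "hessf i j a z = ds i (ds j (\<phi>f a)) z
  + (\<Sum>b\<in>UNIV. (\<Sum>c\<in>UNIV. \<Lambda>f c a b z * ds i (\<phi>f c) z) * ds j (\<phi>f b) z)
  - (\<Sum>k\<in>UNIV. \<Gamma>f i k j z * ds k (\<phi>f a) z)"

lemmas smooth_intros_W = smooth_gf smooth_Pf smooth_\<Gamma>f smooth_\<phi>f smooth_Hf smooth_\<Lambda>f smooth_\<alpha>f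
  smooth_ds smooth_dT smooth_on_add[OF W] smooth_on_diff[OF W] smooth_on_mult[OF W]
  smooth_on_sum[OF W] smooth_on_minus[OF W] smooth_on_const[OF W]

lemma smooth_ricf: "smooth_on W (ricf j k)"
  unfolding ricf_def[abs_def] by (intro smooth_intros_W)

lemma smooth_ef: "smooth_on W (ef i j)"
  unfolding ef_def[abs_def] by (intro smooth_intros_W)

lemma smooth_hessf: "smooth_on W (hessf i j a)"
  unfolding hessf_def[abs_def] by (intro smooth_intros_W)

lemma ricci_nth:
  assumes "(x, t) \<in> W"
  shows "ricci (G t) x $ j $ k = ricf j k (x, t)"
proof -
  have "pd i (christoffel (G t) l j k) x = ds i (\<Gamma>f j l k) (x, t)" for i l j k
    using pd_ds[OF smooth_\<Gamma>f assms, of i j l k] by (simp add: \<Gamma>f_def)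
  then show ?thesis
    by (simp add: ricf_def ricci_def riemann_def \<Gamma>f_def[of _ _ _ "(x, t)"] sum_subtractf add_diff_eq)
qed

lemma grad_tensor_grad_nth:
  assumes "(x, t) \<in> W"
  shows "grad_tensor_grad H (f t) x $ i $ j = ef i j (x, t)"
  using assms
  by (simp add: ef_def grad_tensor_grad_def inner_vec_def matrix_vector_mult_def pd_f_nth Hf_def
      sum_distrib_left ac_simps)

lemma hessian_map_nth:
  assumes "(x, t) \<in> W"
  shows "hessian_map (G t) H (f t) x i j $ a = hessf i j a (x, t)"
proof -
  have "(\<Sum>b\<in>UNIV. (\<Sum>c\<in>UNIV. \<Lambda>f c a b (x, t) * ds i (\<phi>f c) (x, t)) * ds j (\<phi>f b) (x, t))
     = (\<Sum>b\<in>UNIV. \<Sum>c\<in>UNIV. \<Lambda>f b a c (x, t) * ds i (\<phi>f b) (x, t) * ds j (\<phi>f c) (x, t))"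
    unfolding sum_distrib_right by (rule sum.swap)
  then show ?thesis
    using assms by (simp add: hessf_def hessian_map_def pd_pd_f_nth pd_f_nth \<Gamma>f_def \<Lambda>f_def)
qed

lemma flow_G_components: "z \<in> W \<Longrightarrow> dT (gf j k) z = - 2 * ricf j k z + 2 * \<alpha>f z * ef j k z"
  by (cases z) (simp add: dT_gf ricci_nth grad_tensor_grad_nth \<alpha>f_def)

lemma flow_f_components:
  "z \<in> W \<Longrightarrow> dT (\<phi>f a) z = (\<Sum>i\<in>UNIV. \<Sum>j\<in>UNIV. Pf i j z * hessf i j a z)"
  by (cases z) (simp add: dT_\<phi>f tension_def metric_trace_def hessian_map_nth Pf_def)

lemma matrix_inv_G:
  assumes "z \<in> W"
  shows "(\<Sum>k\<in>UNIV. gf i k z * Pf k j z) = (if i = j then 1 else 0)"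
    and "(\<Sum>k\<in>UNIV. Pf i k z * gf k j z) = (if i = j then 1 else 0)"
  using arg_cong[OF matrix_inv_mult(1)[OF det_G[OF assms]], of "\<lambda>A. A $ i $ j"]
    arg_cong[OF matrix_inv_mult(2)[OF det_G[OF assms]], of "\<lambda>A. A $ i $ j"]
  by (simp_all add: matrix_mult_nth mat_def gf_def Pf_def)

lemma gf_sym: "z \<in> W \<Longrightarrow> gf i j z = gf j i z"
  using arg_cong[OF G_sym, of z "\<lambda>A. A $ j $ i"] by (simp add: gf_def transpose_def)

lemma Hf_sym: "z \<in> W \<Longrightarrow> Hf a b z = Hf b a z"
  using arg_cong[OF H_sym[OF f_in], of z "\<lambda>A. A $ b $ a"] by (simp add: Hf_def transpose_def)

lemma smooth_Sf: "smooth_on W Sf"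
  unfolding Sf_def[abs_def]
  by (intro W smooth_on_mult smooth_on_const smooth_on_sum smooth_dT smooth_gf smooth_Pf)

text \<open>\<open>evolution_S\<close> evaluated at \<open>z\<close>. The values of d\<phi> and
  \<tau> appear as mere witnesses \<open>v\<close> and \<open>t\<close>, since the signs of the
  terms depend only on their being quadratic forms.\<close>

theorem evolution_Sf:
  assumes z: "z \<in> W"
  obtains K :: "real ^ 'm ^ 'm" and e :: "real ^ 'm ^ 'm" and v :: "'m \<Rightarrow> real ^ 'n" and t :: "real ^ 'n"
  where "K = (\<chi> i j. dT (gf i j) z) ** (\<chi> i j. Pf i j z)"
    and "\<forall>i j. e $ i $ j = (\<Sum>a\<in>UNIV. \<Sum>b\<in>UNIV. Hf a b z * (v i $ a * v j $ b))"
    and "2 * dT Sf z = trace (K ** K) +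
      2 * (\<Sum>i\<in>UNIV. \<Sum>m\<in>UNIV. Pf i m z * (ds i (ds m Sf) z - (\<Sum>k\<in>UNIV. \<Gamma>f i k m z * ds k Sf z)))
      + 4 * \<alpha> (snd z) * (\<Sum>a\<in>UNIV. \<Sum>b\<in>UNIV. Hf a b z * (t $ a * t $ b))
      - 2 * dT \<alpha>f z * (\<Sum>i\<in>UNIV. \<Sum>j\<in>UNIV. e $ i $ j * Pf j i z)"
proof -
  define d :: "'m \<Rightarrow> ((real ^ 'm) \<times> real) germ \<Rightarrow> ((real ^ 'm) \<times> real) germ"
    where "d i = germ_deriv (axis i 1, 0)" for i
  define dt :: "((real ^ 'm) \<times> real) germ \<Rightarrow> ((real ^ 'm) \<times> real) germ"
    where "dt = germ_deriv (0, 1)"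
  define g where "g = (\<chi> i j. germ_at z (gf i j))"
  define P where "P = (\<chi> i j. germ_at z (Pf i j))"
  define \<Gamma> where "\<Gamma> i = (\<chi> l k. germ_at z (\<Gamma>f i l k))" for i
  define \<phi> where "\<phi> = (\<chi> a. germ_at z (\<phi>f a))"
  define Hm where "Hm = (\<chi> a b. germ_at z (Hf a b))"
  define \<Lambda> where "\<Lambda> c = (\<chi> a b. germ_at z (\<Lambda>f c a b))" for c
  note sm = smooth_intros_W smooth_ricf smooth_ef smooth_hessf smooth_Sf
  note push = germ_at_add[OF W z] germ_at_diff[OF W z] germ_at_mult[OF W z] germ_at_sum[OF W z]
    germ_at_minus[OF W z]
  note cong = germ_at_cong[OF W z]
  have d_at: "d i (germ_at z k) = germ_at z (ds i k)" if "smooth_on W k" for i k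
    using germ_deriv_at[OF W z that] by (simp add: d_def ds_def[abs_def])
  have dt_at: "dt (germ_at z k) = germ_at z (dT k)" if "smooth_on W k" for k
    using germ_deriv_at[OF W z that] by (simp add: dt_def dT_def[abs_def])
  have one: "germ_at z (\<lambda>z. if i = j then 1 else 0) = (mat 1 :: ((real ^ 'm) \<times> real) germ ^ 'm ^ 'm) $ i $ j"
    for i j :: 'm
    by (simp add: mat_def germ_at_1[OF W z] germ_at_0[OF W z])
  interpret evolving_metric d g P \<Gamma> dt
  proof
    show "derivation (d i)" "derivation dt" for i
      by (simp_all add: d_def dt_def derivation_germ_deriv)
    show "d i (d j a) = d j (d i a)" "dt (d i a) = d i (dt a)" for i j a
      by (simp_all add: d_def dt_def germ_deriv_commute)
    show "transpose g = g"
      by (simp add: g_def transpose_def vec_eq_iff) (auto intro: cong sm gf_sym)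
    show "g ** P = mat 1"
      by (simp add: g_def P_def matrix_matrix_mult_def vec_eq_iff push sm one[symmetric])
        (auto intro!: cong sm simp: matrix_inv_G)
    show "P ** g = mat 1"
      by (simp add: g_def P_def matrix_matrix_mult_def vec_eq_iff push sm one[symmetric])
        (auto intro!: cong sm simp: matrix_inv_G)
    show "\<Gamma> i $ l $ k = \<Gamma> k $ l $ i" for i l k
      by (simp add: \<Gamma>_def) (auto intro: cong sm \<Gamma>f_sym)
    show "a = 0" if "a + a = 0" for a :: "((real ^ 'm) \<times> real) germ"
      using that by (rule germ_double_eq_0)
    show "dmat (d i) g = transpose (\<Gamma> i) ** g + g ** \<Gamma> i" for i
      by (simp add: g_def \<Gamma>_def matrix_matrix_mult_def transpose_def vec_eq_iff push sm d_at)
        (auto intro!: cong sm simp: ds_gf)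
  qed
  \<comment> \<open>The locales are interpreted in stages: the flow equations of
    \<open>rh_flow_jet\<close> mention \<open>Ric\<close>, \<open>e\<close> and
    \<open>\<tau>\<close>, which have to be identified with component functions first.\<close>
  interpret map_jet d g P \<Gamma> dt \<phi> Hm \<Lambda> ..
  have Ric: "Ric $ j $ k = germ_at z (ricf j k)" for j k
    unfolding Ric_def F_def by (simp add: \<Gamma>_def matrix_matrix_mult_def push sm d_at)
      (auto intro!: cong sm simp: ricf_def)
  have e: "e $ i $ j = germ_at z (ef i j)" for i j
    unfolding e_def ip_def u_def by (simp add: Hm_def \<phi>_def push sm d_at)
      (auto intro!: cong sm simp: ef_def)
  have hess: "hess i j $ a = germ_at z (hessf i j a)" for i j a
    unfolding hess_def cov_def Lam_def u_def by (simp add: \<Gamma>_def \<Lambda>_def \<phi>_def matrix_vector_mult_def push sm d_at)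
      (auto intro!: cong sm simp: hessf_def)
  interpret rh_flow_jet d g P \<Gamma> dt \<phi> Hm \<Lambda> "germ_at z \<alpha>f"
  proof
    show "\<Lambda> c $ a $ b = \<Lambda> b $ a $ c" for c a b
      by (simp add: \<Lambda>_def) (auto intro: cong sm \<Lambda>f_sym)
    show "Hm $ a $ b = Hm $ b $ a" for a b
      by (simp add: Hm_def) (auto intro: cong sm Hf_sym)
    show "dmat (d i) Hm = transpose (Lam (d i)) ** Hm + Hm ** Lam (d i)" for i
      unfolding Lam_def by (simp add: Hm_def \<Lambda>_def \<phi>_def matrix_matrix_mult_def transpose_def vec_eq_iff push sm d_at)
        (auto intro!: cong sm simp: frechet_derivative_Hf ds_def)
    show "dmat dt Hm = transpose (Lam dt) ** Hm + Hm ** Lam dt"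
      unfolding Lam_def by (simp add: Hm_def \<Lambda>_def \<phi>_def matrix_matrix_mult_def transpose_def vec_eq_iff push sm dt_at)
        (auto intro!: cong sm simp: frechet_derivative_Hf dT_def)
    show "d i (germ_at z \<alpha>f) = 0" for i
      by (simp add: d_at sm germ_at_0[OF W z, symmetric]) (auto intro!: cong sm simp: ds_\<alpha>f)
    show "dt (g $ j $ k) = - 2 * Ric $ j $ k + 2 * germ_at z \<alpha>f * e $ j $ k" for j k
      by (simp add: g_def Ric e push sm dt_at germ_at_numeral[OF W z])
        (auto intro!: cong sm simp: flow_G_components)
    show "dt (\<phi> $ a) = \<tau> $ a" for a
      unfolding \<tau>_def by (simp add: P_def hess push sm dt_at) (simp add: \<phi>_def dt_at sm, auto intro!: cong sm simp: flow_f_components)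
  qed
  have K: "K $ i $ j = germ_at z (\<lambda>z. \<Sum>k\<in>UNIV. dT (gf i k) z * Pf k j z)" for i j
    unfolding K_def local.h_def matrix_mult_nth by (simp add: g_def P_def push sm dt_at)
  \<comment> \<open>\<open>S\<close> and \<open>Sf\<close> are both -1/2 of this trace; in the ring
    the factor 2 is cancelled by \<open>twice_eq_0\<close>.\<close>
  have "trace K = germ_at z (\<lambda>z. - (2 * Sf z))"
    by (simp add: trace_def K push sm) (auto intro!: cong sm simp: Sf_def)
  then have "- 2 * S = - (2 * germ_at z Sf)"
    by (simp add: trace_K push sm germ_at_numeral[OF W z])
  then have "(S - germ_at z Sf) + (S - germ_at z Sf) = 0"
    by (simp add: algebra_simps)
  then have S: "S = germ_at z Sf"
    using twice_eq_0 by fastforce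
  define K' where "K' = (\<chi> i j. germ_value (K $ i $ j))"
  define t' where "t' = (\<chi> a. germ_value (\<tau> $ a))"
  define e' where "e' = (\<chi> i j. germ_value (e $ i $ j))"
  define v' where "v' i = (\<chi> a. germ_value (u i $ a))" for i
  show ?thesis
  proof (rule that[of K' e' v' t'])
    show "K' = (\<chi> i j. dT (gf i j) z) ** (\<chi> i j. Pf i j z)"
      by (simp add: K'_def vec_eq_iff matrix_mult_nth K germ_value_at[OF W z] sm)
    show "\<forall>i j. e' $ i $ j = (\<Sum>a\<in>UNIV. \<Sum>b\<in>UNIV. Hf a b z * (v' i $ a * v' j $ b))"
      unfolding e'_def v'_def e_def ip_def by (simp add: Hm_def germ_value_simps germ_value_sum germ_value_at[OF W z] sm)
    show "2 * dT Sf z = trace (K' ** K') +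
      2 * (\<Sum>i\<in>UNIV. \<Sum>m\<in>UNIV. Pf i m z * (ds i (ds m Sf) z - (\<Sum>k\<in>UNIV. \<Gamma>f i k m z * ds k Sf z)))
      + 4 * \<alpha> (snd z) * (\<Sum>a\<in>UNIV. \<Sum>b\<in>UNIV. Hf a b z * (t' $ a * t' $ b))
      - 2 * dT \<alpha>f z * (\<Sum>i\<in>UNIV. \<Sum>j\<in>UNIV. e' $ i $ j * Pf j i z)"
      using arg_cong[OF evolution_S, of germ_value]
      unfolding S N_def L_def trace_def matrix_mult_nth ip_def
      by (simp add: dt_at d_at sm P_def \<Gamma>_def Hm_def germ_value_simps germ_value_sum germ_value_numeral
          germ_value_at[OF W z] \<alpha>f_def K'_def t'_def e'_def)
  qed
qed

end

section \<open>The differential inequality at a spatial minimum\<close>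

lemma matrix_inv_sym:
  fixes A :: "real ^ 'n ^ 'n::finite"
  assumes "det A \<noteq> 0" "transpose A = A"
  shows "transpose (matrix_inv A) = matrix_inv A"
proof -
  have "transpose (matrix_inv A) = transpose (matrix_inv A) ** (A ** matrix_inv A)"
    by (simp add: matrix_inv_mult[OF assms(1)])
  also have "\<dots> = transpose (A ** matrix_inv A) ** matrix_inv A"
    by (simp add: matrix_transpose_mul assms(2) matrix_mul_assoc)
  finally show ?thesis by (simp add: matrix_inv_mult[OF assms(1)])
qed

lemma matrix_inv_psd:
  fixes A :: "real ^ 'n ^ 'n::finite"
  assumes "\<And>v. v \<noteq> 0 \<Longrightarrow> 0 < v \<bullet> (A *v v)"
  shows "0 \<le> v \<bullet> (matrix_inv A *v v)"
proof -
  let ?w = "matrix_inv A *v v"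
  have "A *v ?w = v"
    by (simp add: matrix_vector_mul_assoc matrix_inv_mult[OF det_ne_0_pos_def[OF assms]])
  then have "v \<bullet> ?w = ?w \<bullet> (A *v ?w)"
    by (simp add: inner_commute)
  also have "\<dots> \<ge> 0"
    using assms[of ?w] by (cases "?w = 0") auto
  finally show ?thesis .
qed

text \<open>The form of the Gram matrix at \<open>x\<close> is the \<open>H\<close>-square of the
  combination of the \<open>v i\<close> with coefficients \<open>x\<close>.\<close>

lemma gram_trace_nonneg:
  fixes P :: "real ^ 'm ^ 'm::finite" and H :: "real ^ 'n ^ 'n::finite" and v :: "'m \<Rightarrow> real ^ 'n"
  assumes "transpose P = P" "\<And>x. 0 \<le> x \<bullet> (P *v x)" and H: "\<And>w. 0 \<le> w \<bullet> (H *v w)"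
  shows "0 \<le> (\<Sum>i\<in>UNIV. \<Sum>j\<in>UNIV. P $ i $ j * (\<Sum>a\<in>UNIV. \<Sum>b\<in>UNIV. H $ a $ b * (v i $ a * v j $ b)))"
proof -
  let ?A = "\<chi> i j. v i \<bullet> (H *v v j)"
  have ip: "x \<bullet> (H *v y) = (\<Sum>a\<in>UNIV. \<Sum>b\<in>UNIV. H $ a $ b * (x $ a * y $ b))" for x y
    by (simp add: inner_vec_def matrix_vector_mult_def sum_distrib_left ac_simps)
  have "0 \<le> (\<Sum>i\<in>UNIV. \<Sum>j\<in>UNIV. P $ i $ j * ?A $ i $ j)"
  proof (rule trace_psd_nonneg[OF assms(1,2)])
    fix x :: "real ^ 'm"
    let ?w = "\<Sum>i\<in>UNIV. x $ i *\<^sub>R v i"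
    have "0 \<le> ?w \<bullet> (H *v ?w)" by (rule H)
    also have "H *v ?w = (\<Sum>j\<in>UNIV. x $ j *\<^sub>R (H *v v j))"
      by (simp add: linear_sum[OF matrix_vector_mul_linear] matrix_vector_mult_scaleR)
    also have "?w \<bullet> \<dots> = (\<Sum>i\<in>UNIV. \<Sum>j\<in>UNIV. x $ i * x $ j * ?A $ i $ j)"
      by (simp only: inner_sum_left, simp add: inner_sum_right sum_distrib_left ac_simps)
    finally show "0 \<le> (\<Sum>i\<in>UNIV. \<Sum>j\<in>UNIV. x $ i * x $ j * ?A $ i $ j)" .
  qed
  then show ?thesis by (simp add: ip)
qed

lemma linear_space_direction:
  assumes "linear L"
  shows "L (w, 0) = (\<Sum>i\<in>UNIV. w $ i *\<^sub>R L (axis i 1 :: real ^ 'm::finite, 0 :: real))"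
proof -
  have eq: "(w, 0 :: real) = (\<Sum>i\<in>UNIV. w $ i *\<^sub>R (axis i 1, 0))"
    using basis_expansion[of w, unfolded scalar_mult_eq_scaleR]
    by (simp add: prod_eq_iff fst_sum snd_sum)
  show ?thesis
    by (simp only: eq linear_sum[OF assms] linear_cmul[OF assms])
qed

context rh_local
begin

lemma linear_frechet: "smooth_on W k \<Longrightarrow> z \<in> W \<Longrightarrow> linear (frechet_derivative k (at z))"
  using linear_frechet_derivative smooth_on_differentiable[OF W] by blast

lemma second_derivative_space_direction:
  fixes k :: "(real ^ 'm) \<times> real \<Rightarrow> real"
  assumes k: "smooth_on W k" and z: "z \<in> W"
  shows "frechet_derivative (\<lambda>y. frechet_derivative k (at y) (w, 0)) (at z) (w, 0)
    = (\<Sum>i\<in>UNIV. \<Sum>j\<in>UNIV. w $ i * w $ j * ds i (ds j k) z)"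
proof -
  have "frechet_derivative (\<lambda>y. frechet_derivative k (at y) (w, 0)) (at z) (w, 0)
    = (\<Sum>i\<in>UNIV. w $ i * frechet_derivative (\<lambda>y. frechet_derivative k (at y) (w, 0)) (at z) (axis i 1, 0))"
    by (subst linear_space_direction[OF linear_frechet[OF smooth_on_frechet_derivative[OF W k] z]]) simp
  also have "\<dots> = (\<Sum>i\<in>UNIV. w $ i * frechet_derivative (ds i k) (at z) (w, 0))"
    unfolding ds_def[abs_def] by (subst frechet_derivative_commute[OF W k z]) simp
  also have "\<dots> = (\<Sum>i\<in>UNIV. w $ i * (\<Sum>j\<in>UNIV. w $ j * ds j (ds i k) z))"
    by (subst linear_space_direction[OF linear_frechet[OF smooth_ds[OF k] z]]) (simp add: ds_def)
  also have "\<dots> = (\<Sum>i\<in>UNIV. \<Sum>j\<in>UNIV. w $ i * w $ j * ds i (ds j k) z)"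
    unfolding ds_def[abs_def] by (subst frechet_derivative_commute[OF W k z]) (simp add: sum_distrib_left ac_simps)
  finally show ?thesis .
qed

lemma P_facts:
  assumes "z \<in> W"
  shows "transpose (\<chi> i j. Pf i j z) = (\<chi> i j. Pf i j z)" "0 \<le> x \<bullet> ((\<chi> i j. Pf i j z) *v x)"
    "Pf i j z = Pf j i z"
proof -
  have P: "(\<chi> i j. Pf i j z) = matrix_inv (G (snd z) (fst z))"
    by (simp add: Pf_def vec_eq_iff)
  show sym: "transpose (\<chi> i j. Pf i j z) = (\<chi> i j. Pf i j z)"
    unfolding P by (rule matrix_inv_sym[OF det_G[OF assms] G_sym[OF assms]])
  show "0 \<le> x \<bullet> ((\<chi> i j. Pf i j z) *v x)"
    unfolding P by (rule matrix_inv_psd[OF G_pos[OF assms]])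
  show "Pf i j z = Pf j i z"
    using arg_cong[OF sym, of "\<lambda>A. A $ j $ i"] by (simp add: transpose_def)
qed

lemma H_psd: "z \<in> W \<Longrightarrow> 0 \<le> w \<bullet> ((\<chi> a b. Hf a b z) *v w)"
proof -
  assume z: "z \<in> W"
  have "(\<chi> a b. Hf a b z) = H (f (snd z) (fst z))"
    by (simp add: Hf_def vec_eq_iff)
  then show ?thesis
    using H_pos[OF f_in[OF z], of w] by (cases "w = 0") auto
qed

lemma Sf_eq_trace:
  assumes "(x, t) \<in> W" "((\<lambda>s. G s x) has_vector_derivative D) (at t)"
  shows "Sf (x, t) = - (1 / 2) * trace (D ** matrix_inv (G t x))"
proof -
  have "dT (gf i j) (x, t) = D $ i $ j" for i j
  proof (rule dT_eqI[OF smooth_gf assms(1)])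
    show "((\<lambda>s. gf i j (x, s)) has_vector_derivative D $ i $ j) (at t)"
      unfolding gf_def
      using bounded_linear.has_vector_derivative[OF bounded_linear_vec_nth
          bounded_linear.has_vector_derivative[OF bounded_linear_vec_nth assms(2)]] by simp
  qed
  then show ?thesis
    by (simp add: Sf_def trace_def matrix_mult_nth Pf_def)
qed

lemma Sf_eq_curvature:
  assumes "(x, t) \<in> W"
  shows "Sf (x, t) = scalar_curvature (G t) x - \<alpha> t * grad_norm_sq (G t) H (f t) x"
proof -
  have "Sf (x, t) = - (1 / 2) * (\<Sum>i\<in>UNIV. \<Sum>k\<in>UNIV. (- 2 * ricci (G t) x $ i $ k
      + 2 * \<alpha> t * grad_tensor_grad H (f t) x $ i $ k) * Pf i k (x, t))"
    unfolding Sf_def dT_gf[OF assms] by (simp only: P_facts(3)[OF assms, of _ i for i])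
  also have "\<dots> = (\<Sum>i\<in>UNIV. \<Sum>k\<in>UNIV. Pf i k (x, t) * ricci (G t) x $ i $ k
      - \<alpha> t * (Pf i k (x, t) * grad_tensor_grad H (f t) x $ i $ k))"
    unfolding sum_distrib_left by (intro sum.cong refl) (simp add: algebra_simps)
  finally show ?thesis
    by (simp add: scalar_curvature_def grad_norm_sq_def metric_trace_def Pf_def sum_subtractf sum_distrib_left)
qed

lemma grad_norm_sq_nonneg:
  assumes "(x, t) \<in> W"
  shows "0 \<le> grad_norm_sq (G t) H (f t) x"
  using gram_trace_nonneg[OF P_facts(1,2)[OF assms] H_psd[OF assms], of "\<lambda>i. \<chi> a. ds i (\<phi>f a) (x, t)"]
  by (simp add: grad_norm_sq_def metric_trace_def grad_tensor_grad_nth[OF assms] ef_def Pf_def)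

text \<open>The first derivatives vanish, so the Laplacian is the contraction of a nonnegative
  Hessian; the \<tau> term and, as \<alpha> does not increase, the \<alpha>' term have the right
  sign. What is left is trace (K ** K) against (trace K)^2 = 4 S^2.\<close>

theorem Sf_at_spatial_min:
  assumes z: "(x, t) \<in> W" and min: "\<forall>\<^sub>F y in nhds x. Sf (x, t) \<le> Sf (y, t)"
  shows "2 * (Sf (x, t))\<^sup>2 \<le> real CARD('m) * dT Sf (x, t)"
proof -
  let ?z = "(x, t)"
  obtain K :: "real ^ 'm ^ 'm" and \<tau> :: "real ^ 'n" and e :: "real ^ 'm ^ 'm" and v :: "'m \<Rightarrow> real ^ 'n" where
    K: "K = (\<chi> i j. dT (gf i j) ?z) ** (\<chi> i j. Pf i j ?z)"
    and e: "\<forall>i j. e $ i $ j = (\<Sum>a\<in>UNIV. \<Sum>b\<in>UNIV. Hf a b ?z * (v i $ a * v j $ b))"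
    and evo: "2 * dT Sf ?z = trace (K ** K) +
      2 * (\<Sum>i\<in>UNIV. \<Sum>m\<in>UNIV. Pf i m ?z * (ds i (ds m Sf) ?z - (\<Sum>k\<in>UNIV. \<Gamma>f i k m ?z * ds k Sf ?z)))
      + 4 * \<alpha> (snd ?z) * (\<Sum>a\<in>UNIV. \<Sum>b\<in>UNIV. Hf a b ?z * (\<tau> $ a * \<tau> $ b))
      - 2 * dT \<alpha>f ?z * (\<Sum>i\<in>UNIV. \<Sum>j\<in>UNIV. e $ i $ j * Pf j i ?z)"
    by (rule evolution_Sf[OF z])
  have line: "\<forall>\<^sub>F r in nhds 0. Sf ?z \<le> Sf (?z + r *\<^sub>R (w, 0))" for w
  proof -
    have "((\<lambda>r. x + r *\<^sub>R w) \<longlongrightarrow> x + 0 *\<^sub>R w) (nhds 0)"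
      by (intro tendsto_intros filterlim_ident)
    then have "filterlim (\<lambda>r. x + r *\<^sub>R w) (nhds x) (nhds 0)" by simp
    from eventually_compose_filterlim[OF min this] show ?thesis by simp
  qed
  have d0: "ds k Sf ?z = 0" for k
    using local_min_along_line(1)[OF W smooth_Sf z line] by (simp add: ds_def)
  have "0 \<le> (\<Sum>i\<in>UNIV. \<Sum>m\<in>UNIV. (\<chi> i j. Pf i j ?z) $ i $ m * (\<chi> i j. ds i (ds j Sf) ?z) $ i $ m)"
    by (rule trace_psd_nonneg[OF P_facts(1,2)[OF z]])
      (use local_min_along_line(2)[OF W smooth_Sf z line] in \<open>simp add: second_derivative_space_direction[OF smooth_Sf z]\<close>)
  then have lap: "0 \<le> (\<Sum>i\<in>UNIV. \<Sum>m\<in>UNIV. Pf i m ?z * (ds i (ds m Sf) ?z - (\<Sum>k\<in>UNIV. \<Gamma>f i k m ?z * ds k Sf ?z)))"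
    by (simp add: d0)
  have "0 \<le> \<tau> \<bullet> ((\<chi> a b. Hf a b ?z) *v \<tau>)"
    by (rule H_psd[OF z])
  also have "\<dots> = (\<Sum>a\<in>UNIV. \<Sum>b\<in>UNIV. Hf a b ?z * (\<tau> $ a * \<tau> $ b))"
    by (simp add: inner_vec_def matrix_vector_mult_def sum_distrib_left ac_simps)
  finally have ten: "0 \<le> \<alpha> (snd ?z) * (\<Sum>a\<in>UNIV. \<Sum>b\<in>UNIV. Hf a b ?z * (\<tau> $ a * \<tau> $ b))"
    using \<alpha>_nonneg[OF z] by (rule mult_nonneg_nonneg[rotated])
  have "0 \<le> (\<Sum>i\<in>UNIV. \<Sum>j\<in>UNIV. e $ i $ j * Pf j i ?z)"
    using gram_trace_nonneg[OF P_facts(1,2)[OF z] H_psd[OF z], of v]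
    by (simp add: e[rule_format, symmetric] P_facts(3)[OF z, of _ i for i] mult.commute)
  then have energy: "dT \<alpha>f ?z * (\<Sum>i\<in>UNIV. \<Sum>j\<in>UNIV. e $ i $ j * Pf j i ?z) \<le> 0"
    using \<alpha>_decreasing[OF z] by (simp add: dT_def \<alpha>f_def[abs_def] mult_nonpos_nonneg)
  have "dT (gf i j) ?z = dT (gf j i) ?z" for i j
    unfolding dT_def
    using frechet_derivative_transform_within_open[OF smooth_on_differentiable[OF W smooth_gf z] W z gf_sym]
    by simp
  then have "transpose (\<chi> i j. dT (gf i j) ?z) = (\<chi> i j. dT (gf i j) ?z)"
    by (simp add: transpose_def vec_eq_iff)
  then have "(trace K)\<^sup>2 \<le> real CARD('m) * trace (K ** K)"
    unfolding K by (rule trace_squared_le[OF P_facts(1,2)[OF z]])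
  moreover have "trace K = - 2 * Sf ?z"
    by (simp add: K trace_def matrix_mult_nth Sf_def)
  ultimately have "4 * (Sf ?z)\<^sup>2 \<le> real CARD('m) * trace (K ** K)"
    by (simp add: power_mult_distrib)
  also have "\<dots> \<le> real CARD('m) * (2 * dT Sf ?z)"
    using evo lap ten energy by (intro mult_left_mono) auto
  finally show ?thesis by simp
qed

end

section \<open>The maximum principle on the manifold\<close>

text \<open>Invertibility of \<open>J\<close> is extracted from the congruence:
  \<open>G' ** J ** matrix_inv G\<close> is a right inverse of \<open>transpose J\<close>, hence a
  two-sided one.\<close>

lemma congruence_inverse:
  fixes G G' J :: "real ^ 'm ^ 'm::finite"
  assumes "G = transpose J ** G' ** J" "det G \<noteq> 0" "det G' \<noteq> 0"
  shows "J ** matrix_inv G ** transpose J = matrix_inv G'"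
proof -
  have "transpose J ** (G' ** J ** matrix_inv G) = mat 1"
    using matrix_inv_mult(1)[OF assms(2)] by (simp add: assms(1)[symmetric] matrix_mul_assoc)
  then have "(G' ** J ** matrix_inv G) ** transpose J = mat 1"
    using matrix_left_right_inverse by blast
  then have "matrix_inv G' ** G' ** (J ** matrix_inv G ** transpose J) = matrix_inv G'"
    by (metis matrix_mul_assoc matrix_mul_rid)
  then show ?thesis
    by (simp add: matrix_inv_mult[OF assms(3)])
qed

lemma bounded_linear_congruence: "bounded_linear (\<lambda>X :: real ^ 'm ^ 'm::finite. transpose J ** X ** J)"
proof (rule linear_conv_bounded_linear[THEN iffD1], rule linearI)
  show "transpose J ** (c *\<^sub>R X) ** J = c *\<^sub>R (transpose J ** X ** J)" for c and X :: "real ^ 'm ^ 'm"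
    by (simp add: vec_eq_iff matrix_matrix_mult_def sum_distrib_left sum_distrib_right ac_simps)
qed (simp add: matrix_ring_simps)

lemma antimono_has_derivative_nonpos:
  fixes \<alpha> :: "real \<Rightarrow> real"
  assumes "antimono_on S \<alpha>" "open S" "t \<in> S" "(\<alpha> has_real_derivative d) (at t)"
  shows "d \<le> 0"
proof (rule ccontr)
  assume "\<not> d \<le> 0"
  then obtain \<delta> where \<delta>: "\<delta> > 0" "\<And>h. 0 < h \<Longrightarrow> h < \<delta> \<Longrightarrow> \<alpha> t < \<alpha> (t + h)"
    using DERIV_pos_inc_right[OF assms(4)] by auto
  obtain \<eta> where \<eta>: "\<eta> > 0" "ball t \<eta> \<subseteq> S"
    using assms(2,3) open_contains_ball by blast
  define h where "h = min \<delta> \<eta> / 2"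
  have h: "0 < h" "h < \<delta>" "t + h \<in> S"
    using \<delta>(1) \<eta> by (auto simp: h_def dist_real_def subset_iff)
  then have "\<alpha> (t + h) \<le> \<alpha> t"
    using assms(1,3) by (auto simp: monotone_on_def)
  then show False using \<delta>(2)[OF h(1,2)] by simp
qed

section \<open>From charts to the manifold\<close>

locale rh_solution =
  fixes M :: "'a topology" and A :: "('a, 'm::finite) chart set"
    and N :: "'b topology" and B :: "('b, 'n::finite) chart set"
    and \<gamma> :: "('b, 'n) metric"
    and g :: "real \<Rightarrow> ('a, 'm) metric" and \<phi> :: "real \<Rightarrow> 'a \<Rightarrow> 'b"
    and \<alpha> :: "real \<Rightarrow> real" and T :: ereal
  assumes closed_M: "closed_manifold M A" and closed_N: "closed_manifold N B"
    and riem_N: "riemannian_metric B \<gamma>"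
    and flow: "RH_flow M A N B \<gamma> \<alpha> (time_dom T) g \<phi>"
    and \<alpha>_antimono: "antimono_on (time_dom T) \<alpha>"
    and \<alpha>_nonneg: "\<And>t. t \<in> time_dom T \<Longrightarrow> 0 \<le> \<alpha> t"
begin

text \<open>Time 0 is left out so that \<open>dom\<close> is open in space-time.\<close>

definition J where "J = {t. 0 < t \<and> ereal t < T}"

definition dom where
  "dom \<kappa> \<mu> = {z. fst z \<in> chart_image \<kappa> \<and> snd z \<in> J \<and> \<phi> (snd z) (chart_inv \<kappa> (fst z)) \<in> fst \<mu>}"

text \<open>A formula without a target chart, to be compared across the charts of the
  domain.\<close>

definition S where
  "S \<kappa> x t = - (1 / 2) * trace (vector_derivative (\<lambda>s. g s \<kappa> x) (at t) ** matrix_inv (g t \<kappa> x))"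

lemma open_J: "open J"
proof -
  have "open {t. ereal t < T}"
    by (cases T) (auto simp: lessThan_def[symmetric])
  then have "open ({0<..} \<inter> {t. ereal t < T})"
    by (intro open_Int open_greaterThan)
  then show ?thesis
    by (simp add: J_def Collect_conj_eq greaterThan_def)
qed

lemma J_subset: "J \<subseteq> time_dom T"
  by (auto simp: J_def time_dom_def)

lemma at_within_time_dom: "t \<in> J \<Longrightarrow> at t within time_dom T = at t"
  using at_within_open_subset[OF _ open_J J_subset] .

lemma interval_subset_J: "0 < a \<Longrightarrow> t \<in> J \<Longrightarrow> {a..t} \<subseteq> J"
  by (auto simp: J_def) (meson ereal_less_eq(3) order_le_less_trans)

lemma chart_open: "\<kappa> \<in> A \<Longrightarrow> open (chart_image \<kappa>)" "\<kappa> \<in> A \<Longrightarrow> openin M (fst \<kappa>)"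
  and chart_homeo: "\<kappa> \<in> A \<Longrightarrow> homeomorphic_map (subtopology M (fst \<kappa>)) (top_of_set (chart_image \<kappa>)) (snd \<kappa>)"
  and chart_open_N: "\<mu> \<in> B \<Longrightarrow> open (chart_image \<mu>)" "\<mu> \<in> B \<Longrightarrow> openin N (fst \<mu>)"
  and cover_M: "p \<in> topspace M \<Longrightarrow> charts_at A p \<noteq> {}"
  and cover_N: "q \<in> topspace N \<Longrightarrow> charts_at B q \<noteq> {}"
  using closed_M closed_N unfolding closed_manifold_def smooth_atlas_def charts_at_def by blast+

lemma chart_subset: "\<kappa> \<in> A \<Longrightarrow> fst \<kappa> \<subseteq> topspace M"
  using chart_open(2) openin_subset by blast

lemma chart_inv_left: "\<kappa> \<in> A \<Longrightarrow> p \<in> fst \<kappa> \<Longrightarrow> chart_inv \<kappa> (snd \<kappa> p) = p"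
  using homeomorphic_imp_injective_map[OF chart_homeo] chart_subset
  by (simp add: chart_inv_def Int_absorb1)

lemma chart_inv_in: "x \<in> chart_image \<kappa> \<Longrightarrow> chart_inv \<kappa> x \<in> fst \<kappa>"
  and chart_inv_right: "x \<in> chart_image \<kappa> \<Longrightarrow> snd \<kappa> (chart_inv \<kappa> x) = x"
  by (auto simp: chart_image_def chart_inv_def inv_into_into f_inv_into_f)

lemma chart_inv_topspace: "\<kappa> \<in> A \<Longrightarrow> x \<in> chart_image \<kappa> \<Longrightarrow> chart_inv \<kappa> x \<in> topspace M"
  by (rule subsetD[OF chart_subset chart_inv_in])

lemma chart_inv_continuous:
  assumes "\<kappa> \<in> A"
  shows "continuous_map (top_of_set (chart_image \<kappa>)) M (chart_inv \<kappa>)"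
proof -
  obtain h where h: "homeomorphic_maps (subtopology M (fst \<kappa>)) (top_of_set (chart_image \<kappa>)) (snd \<kappa>) h"
    using chart_homeo[OF assms] homeomorphic_map_maps by blast
  then have "continuous_map (top_of_set (chart_image \<kappa>)) M h"
    and inv: "\<And>p. p \<in> fst \<kappa> \<Longrightarrow> h (snd \<kappa> p) = p"
    using chart_subset[OF assms] by (auto simp: homeomorphic_maps_def continuous_map_in_subtopology)
  moreover have "h x = chart_inv \<kappa> x" if "x \<in> chart_image \<kappa>" for x
    using inv[OF chart_inv_in[OF that]] chart_inv_right[OF that] by simp
  ultimately show ?thesis
    by (auto intro: continuous_map_eq)
qed

lemma \<phi>_continuous: "continuous_map (prod_topology M (top_of_set (time_dom T))) N (\<lambda>(p, t). \<phi> t p)"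
  using flow by (simp add: RH_flow_def smooth_map_family_def)

lemma \<phi>_in: "p \<in> topspace M \<Longrightarrow> t \<in> time_dom T \<Longrightarrow> \<phi> t p \<in> topspace N"
  using continuous_map_image_subset_topspace[OF \<phi>_continuous] by auto

lemma target_chart:
  assumes "p \<in> topspace M" "t \<in> time_dom T"
  obtains \<mu> where "\<mu> \<in> charts_at B (\<phi> t p)"
  using cover_N[OF \<phi>_in[OF assms]] by auto

lemma open_dom:
  assumes \<kappa>: "\<kappa> \<in> A" and \<mu>: "\<mu> \<in> B"
  shows "open (dom \<kappa> \<mu>)"
proof -
  let ?U = "chart_image \<kappa> \<times> J"
  have "continuous_map (top_of_set ?U) (prod_topology M (top_of_set (time_dom T))) (\<lambda>(x, t). (chart_inv \<kappa> x, t))"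
    unfolding prod_topology_subtopology_eu[symmetric] continuous_map_prod_top
    using chart_inv_continuous[OF \<kappa>] J_subset by auto
  from continuous_map_compose[OF this \<phi>_continuous]
  have "continuous_map (top_of_set ?U) N (\<lambda>z. \<phi> (snd z) (chart_inv \<kappa> (fst z)))"
    by (simp add: o_def case_prod_beta)
  from openin_continuous_map_preimage[OF this chart_open_N(2)[OF \<mu>]]
  have "openin (top_of_set ?U) (dom \<kappa> \<mu>)"
    by (simp add: dom_def mem_Times_iff conj_assoc)
  then show ?thesis
    using openin_open_trans open_Times[OF chart_open(1)[OF \<kappa>] open_J] by blast
qed

lemma flow_at:
  assumes "t \<in> J" "p \<in> topspace M" "\<kappa> \<in> charts_at A p" "\<mu> \<in> charts_at B (\<phi> t p)"
  shows "((\<lambda>s. g s \<kappa> (snd \<kappa> p)) has_vector_derivative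
      (-2) *\<^sub>R ricci (g t \<kappa>) (snd \<kappa> p) + (2 * \<alpha> t) *\<^sub>R
        grad_tensor_grad (\<gamma> \<mu>) (local_rep \<kappa> \<mu> (\<phi> t)) (snd \<kappa> p)) (at t)"
    and "((\<lambda>s. local_rep \<kappa> \<mu> (\<phi> s) (snd \<kappa> p)) has_vector_derivative
      tension (g t \<kappa>) (\<gamma> \<mu>) (local_rep \<kappa> \<mu> (\<phi> t)) (snd \<kappa> p)) (at t)"
  using flow assms J_subset
  unfolding RH_flow_def Let_def at_within_time_dom[OF assms(1), symmetric] by blast+

lemma metric_facts:
  assumes "t \<in> time_dom T" "\<kappa> \<in> A" "x \<in> chart_image \<kappa>"
  shows "transpose (g t \<kappa> x) = g t \<kappa> x" "v \<noteq> 0 \<Longrightarrow> 0 < v \<bullet> (g t \<kappa> x *v v)"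
  using flow assms unfolding RH_flow_def smooth_metric_family_def riemannian_metric_def by blast+

lemma rh_local_dom:
  assumes \<kappa>: "\<kappa> \<in> A" and \<mu>: "\<mu> \<in> B"
  shows "rh_local (dom \<kappa> \<mu>) (\<lambda>t. g t \<kappa>) (chart_image \<mu>) (\<gamma> \<mu>) (\<lambda>t. local_rep \<kappa> \<mu> (\<phi> t)) \<alpha>"
proof
  note W = open_dom[OF \<kappa> \<mu>]
  show "open (dom \<kappa> \<mu>)" "open (chart_image \<mu>)"
    by (rule W, rule chart_open_N(1)[OF \<mu>])
  have "smooth_on (chart_image \<kappa> \<times> time_dom T) (\<lambda>(x, t). g t \<kappa> x)"
    using flow \<kappa> unfolding RH_flow_def smooth_metric_family_def by blast
  then show "smooth_on (dom \<kappa> \<mu>) (\<lambda>z. g (snd z) \<kappa> (fst z))"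
    by (rule smooth_on_subset_cong) (use J_subset in \<open>auto simp: dom_def\<close>)
  have "smooth_on {(x, t). x \<in> chart_image \<kappa> \<and> t \<in> time_dom T \<and> \<phi> t (chart_inv \<kappa> x) \<in> fst \<mu>}
      (\<lambda>(x, t). local_rep \<kappa> \<mu> (\<phi> t) x)"
    using flow \<kappa> \<mu> unfolding RH_flow_def smooth_map_family_def by blast
  then show "smooth_on (dom \<kappa> \<mu>) (\<lambda>z. local_rep \<kappa> \<mu> (\<phi> (snd z)) (fst z))"
    by (rule smooth_on_subset_cong) (use J_subset in \<open>auto simp: dom_def\<close>)
  have "smooth_on J \<alpha>"
    using flow smooth_on_subset[OF _ J_subset] unfolding RH_flow_def by blast
  from smooth_on_compose[OF W open_J _ smooth_on_linear[OF W bounded_linear_snd] this]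
  show sm\<alpha>: "smooth_on (dom \<kappa> \<mu>) (\<lambda>z. \<alpha> (snd z))"
    by (auto simp: dom_def)
  show "smooth_on (chart_image \<mu>) (\<gamma> \<mu>)"
    using riem_N \<mu> unfolding riemannian_metric_def by blast
  show "transpose (\<gamma> \<mu> y) = \<gamma> \<mu> y" if "y \<in> chart_image \<mu>" for y
    using riem_N \<mu> that unfolding riemannian_metric_def by blast
  show "0 < w \<bullet> (\<gamma> \<mu> y *v w)" if "y \<in> chart_image \<mu>" "w \<noteq> 0" for y w
    using riem_N \<mu> that unfolding riemannian_metric_def by blast
  show "((\<lambda>s. g s \<kappa> x) has_vector_derivative (-2) *\<^sub>R ricci (g t \<kappa>) x + (2 * \<alpha> t) *\<^sub>R
        grad_tensor_grad (\<gamma> \<mu>) (local_rep \<kappa> \<mu> (\<phi> t)) x) (at t)"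
    "((\<lambda>s. local_rep \<kappa> \<mu> (\<phi> s) x) has_vector_derivative tension (g t \<kappa>) (\<gamma> \<mu>) (local_rep \<kappa> \<mu> (\<phi> t)) x) (at t)"
    if "(x, t) \<in> dom \<kappa> \<mu>" for x t
  proof -
    have x: "x \<in> chart_image \<kappa>" "t \<in> J" "\<phi> t (chart_inv \<kappa> x) \<in> fst \<mu>"
      using that by (auto simp: dom_def)
    have "chart_inv \<kappa> x \<in> topspace M" "\<kappa> \<in> charts_at A (chart_inv \<kappa> x)" "\<mu> \<in> charts_at B (\<phi> t (chart_inv \<kappa> x))"
      using x chart_inv_in[OF x(1)] chart_inv_topspace[OF \<kappa> x(1)] \<kappa> \<mu> by (simp_all add: charts_at_def)
    from flow_at[OF x(2) this] show
      "((\<lambda>s. g s \<kappa> x) has_vector_derivative (-2) *\<^sub>R ricci (g t \<kappa>) x + (2 * \<alpha> t) *\<^sub>R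
        grad_tensor_grad (\<gamma> \<mu>) (local_rep \<kappa> \<mu> (\<phi> t)) x) (at t)"
      "((\<lambda>s. local_rep \<kappa> \<mu> (\<phi> s) x) has_vector_derivative tension (g t \<kappa>) (\<gamma> \<mu>) (local_rep \<kappa> \<mu> (\<phi> t)) x) (at t)"
      by (simp_all add: chart_inv_right[OF x(1)])
  qed
  fix z assume z: "z \<in> dom \<kappa> \<mu>"
  then have z': "fst z \<in> chart_image \<kappa>" "snd z \<in> J" "\<phi> (snd z) (chart_inv \<kappa> (fst z)) \<in> fst \<mu>"
    by (auto simp: dom_def)
  then have t: "snd z \<in> time_dom T" using J_subset by blast
  show "local_rep \<kappa> \<mu> (\<phi> (snd z)) (fst z) \<in> chart_image \<mu>"
    using z' by (simp add: local_rep_def chart_image_def)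
  show "transpose (g (snd z) \<kappa> (fst z)) = g (snd z) \<kappa> (fst z)"
    by (rule metric_facts(1)[OF t \<kappa> z'(1)])
  show "v \<noteq> 0 \<Longrightarrow> 0 < v \<bullet> (g (snd z) \<kappa> (fst z) *v v)" for v
    by (rule metric_facts(2)[OF t \<kappa> z'(1)])
  show "0 \<le> \<alpha> (snd z)"
    by (rule \<alpha>_nonneg[OF t])
  show "frechet_derivative (\<lambda>z. \<alpha> (snd z)) (at z) (0, 1) \<le> 0"
  proof (rule antimono_has_derivative_nonpos[OF _ open_J z'(2)])
    show "antimono_on J \<alpha>"
      by (rule monotone_on_subset[OF \<alpha>_antimono J_subset])
    show "(\<alpha> has_real_derivative frechet_derivative (\<lambda>z. \<alpha> (snd z)) (at z) (0, 1)) (at (snd z))"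
      using time_slice[of "\<lambda>z. \<alpha> (snd z)" "fst z" "snd z"] smooth_on_differentiable[OF W sm\<alpha> z]
      by (simp add: has_real_derivative_iff_has_vector_derivative)
  qed
qed

lemma Sf_eq_S:
  assumes \<kappa>: "\<kappa> \<in> A" and \<mu>: "\<mu> \<in> B" and z: "(x, t) \<in> dom \<kappa> \<mu>"
  shows "rh_local.Sf (\<lambda>t. g t \<kappa>) (x, t) = S \<kappa> x t"
proof -
  interpret rh_local "dom \<kappa> \<mu>" "\<lambda>t. g t \<kappa>" "chart_image \<mu>" "\<gamma> \<mu>" "\<lambda>t. local_rep \<kappa> \<mu> (\<phi> t)" \<alpha>
    by (rule rh_local_dom[OF \<kappa> \<mu>])
  have "((\<lambda>s. g s \<kappa> x) has_vector_derivative vector_derivative (\<lambda>s. g s \<kappa> x) (at t)) (at t)"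
    using flow_G[OF z] by (simp add: vector_derivative_at)
  from Sf_eq_trace[OF z this] show ?thesis
    by (simp add: S_def)
qed

lemma S_chart_independent:
  assumes t: "t \<in> J" and \<kappa>: "\<kappa> \<in> charts_at A p" and \<kappa>': "\<kappa>' \<in> charts_at A p"
  shows "S \<kappa> (snd \<kappa> p) t = S \<kappa>' (snd \<kappa>' p) t"
proof -
  let ?x = "snd \<kappa> p" and ?x' = "snd \<kappa>' p"
  have in_A: "\<kappa> \<in> A" "\<kappa>' \<in> A" "p \<in> fst \<kappa>" "p \<in> fst \<kappa>'"
    using \<kappa> \<kappa>' by (auto simp: charts_at_def)
  have p: "p \<in> topspace M"
    using chart_subset in_A by blast
  have tT: "t \<in> time_dom T"
    using t J_subset by blast
  have x: "?x \<in> snd \<kappa> ` (fst \<kappa> \<inter> fst \<kappa>')" "?x \<in> chart_image \<kappa>" "?x' \<in> chart_image \<kappa>'"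
    using in_A by (auto simp: chart_image_def)
  have rep: "local_rep \<kappa> \<kappa>' id ?x = ?x'"
    by (simp add: local_rep_def chart_inv_left in_A)
  define D where "D = matrix (frechet_derivative (local_rep \<kappa> \<kappa>' id) (at ?x))"
  have trans: "g s \<kappa> ?x = transpose D ** g s \<kappa>' ?x' ** D" if "s \<in> time_dom T" for s
  proof -
    have "riemannian_metric A (g s)"
      using flow that unfolding RH_flow_def smooth_metric_family_def by blast
    then show ?thesis
      using in_A x(1) unfolding riemannian_metric_def Let_def D_def by (metis rep)
  qed
  obtain \<mu> where "\<mu> \<in> charts_at B (\<phi> t p)"
    by (rule target_chart[OF p tT])
  then obtain h where h: "((\<lambda>s. g s \<kappa>' ?x') has_vector_derivative h) (at t)"
    using flow_at(1)[OF t p \<kappa>'] by blast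
  have "((\<lambda>s. transpose D ** g s \<kappa>' ?x' ** D) has_vector_derivative transpose D ** h ** D) (at t)"
    by (rule bounded_linear.has_vector_derivative[OF bounded_linear_congruence h])
  then have h': "((\<lambda>s. g s \<kappa> ?x) has_vector_derivative transpose D ** h ** D) (at t)"
    by (rule has_vector_derivative_transform_within_open[OF _ open_J t])
      (use trans J_subset in auto)
  have "D ** matrix_inv (g t \<kappa> ?x) ** transpose D = matrix_inv (g t \<kappa>' ?x')"
  proof (rule congruence_inverse[OF trans[OF tT]])
    show "det (g t \<kappa> ?x) \<noteq> 0"
      using metric_facts(2)[OF tT in_A(1) x(2)] by (rule det_ne_0_pos_def)
    show "det (g t \<kappa>' ?x') \<noteq> 0"
      using metric_facts(2)[OF tT in_A(2) x(3)] by (rule det_ne_0_pos_def)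
  qed
  \<comment> \<open>Cyclicity of the trace moves \<open>transpose D\<close> behind the inverse
    metric, where \<open>congruence_inverse\<close> applies.\<close>
  then have "trace (transpose D ** h ** D ** matrix_inv (g t \<kappa> ?x)) = trace (h ** matrix_inv (g t \<kappa>' ?x'))"
    using trace_mul_sym[of "transpose D" "h ** D ** matrix_inv (g t \<kappa> ?x)"]
    by (simp add: matrix_mul_assoc[symmetric])
  then show ?thesis
    unfolding S_def vector_derivative_at[OF h] vector_derivative_at[OF h'] by simp
qed

text \<open>Near each point a target chart can be fixed, and there \<open>S\<close> coincides with
  the smooth \<open>Sf\<close>; the chart may change from point to point.\<close>

lemma S_continuous:
  assumes \<kappa>: "\<kappa> \<in> A"
  shows "continuous_on (chart_image \<kappa> \<times> J) (\<lambda>z. S \<kappa> (fst z) (snd z))"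
proof (rule continuous_at_imp_continuous_on, rule ballI)
  fix z assume z: "z \<in> chart_image \<kappa> \<times> J"
  have "chart_inv \<kappa> (fst z) \<in> topspace M" "snd z \<in> time_dom T"
    using z chart_inv_topspace[OF \<kappa>, of "fst z"] J_subset by auto
  then obtain \<mu> where \<mu>: "\<mu> \<in> charts_at B (\<phi> (snd z) (chart_inv \<kappa> (fst z)))"
    by (rule target_chart)
  then have \<mu>B: "\<mu> \<in> B" and zW: "z \<in> dom \<kappa> \<mu>"
    using z by (auto simp: charts_at_def dom_def)
  interpret rh_local "dom \<kappa> \<mu>" "\<lambda>t. g t \<kappa>" "chart_image \<mu>" "\<gamma> \<mu>" "\<lambda>t. local_rep \<kappa> \<mu> (\<phi> t)" \<alpha>
    by (rule rh_local_dom[OF \<kappa> \<mu>B])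
  have "isCont Sf z"
    using smooth_on_continuous[OF W smooth_Sf] W zW by (auto simp: continuous_on_eq_continuous_at)
  moreover have "\<forall>\<^sub>F y in nhds z. S \<kappa> (fst y) (snd y) = Sf y"
    using eventually_nhds_in_open[OF W zW]
    by eventually_elim (use Sf_eq_S[OF \<kappa> \<mu>B] in auto)
  ultimately show "isCont (\<lambda>z. S \<kappa> (fst z) (snd z)) z"
    using isCont_cong by fastforce
qed

definition SM where "SM p t = S (SOME \<kappa>. \<kappa> \<in> charts_at A p) (snd (SOME \<kappa>. \<kappa> \<in> charts_at A p) p) t"

lemma SM_eq:
  assumes "t \<in> J" "\<kappa> \<in> charts_at A p"
  shows "SM p t = S \<kappa> (snd \<kappa> p) t"
  unfolding SM_def by (rule S_chart_independent[OF assms(1) _ assms(2)]) (rule someI[of "\<lambda>\<kappa>. \<kappa> \<in> charts_at A p", OF assms(2)])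

text \<open>The chart domains are open and the coordinate expressions agree on overlaps, so they
  paste.\<close>

lemma SM_continuous:
  assumes I: "I \<subseteq> J"
  shows "continuous_map (prod_topology M (top_of_set I)) euclideanreal (\<lambda>(p, t). (t - \<epsilon>) * SM p t)"
proof (rule pasting_lemma[where I = A and T = "\<lambda>\<kappa>. fst \<kappa> \<times> I"
      and f = "\<lambda>\<kappa> (p, t). (t - \<epsilon>) * S \<kappa> (snd \<kappa> p) t"])
  fix \<kappa> assume \<kappa>: "\<kappa> \<in> A"
  show "openin (prod_topology M (top_of_set I)) (fst \<kappa> \<times> I)"
    using chart_open(2)[OF \<kappa>] by (simp add: openin_prod_Times_iff)
  have "continuous_map (subtopology M (fst \<kappa>)) (top_of_set (chart_image \<kappa>)) (snd \<kappa>)"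
    by (rule homeomorphic_imp_continuous_map[OF chart_homeo[OF \<kappa>]])
  then have "continuous_map (prod_topology (subtopology M (fst \<kappa>)) (top_of_set I))
     (prod_topology (top_of_set (chart_image \<kappa>)) (top_of_set I)) (\<lambda>(p, t). (snd \<kappa> p, t))"
    unfolding continuous_map_prod_top by simp
  moreover have "continuous_on (chart_image \<kappa> \<times> I) (\<lambda>z. (snd z - \<epsilon>) * S \<kappa> (fst z) (snd z))"
    by (intro continuous_intros continuous_on_subset[OF S_continuous[OF \<kappa>]]) (use I in auto)
  ultimately have "continuous_map (prod_topology (subtopology M (fst \<kappa>)) (top_of_set I)) euclideanreal
     ((\<lambda>z. (snd z - \<epsilon>) * S \<kappa> (fst z) (snd z)) \<circ> (\<lambda>(p, t). (snd \<kappa> p, t)))"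
    by (intro continuous_map_compose) auto
  moreover have "(\<lambda>z. (snd z - \<epsilon>) * S \<kappa> (fst z) (snd z)) \<circ> (\<lambda>(p, t). (snd \<kappa> p, t))
      = (\<lambda>(p, t). (t - \<epsilon>) * S \<kappa> (snd \<kappa> p) t)"
    by auto
  moreover have "subtopology (prod_topology M (top_of_set I)) (fst \<kappa> \<times> I)
      = prod_topology (subtopology M (fst \<kappa>)) (top_of_set I)"
    by (simp add: subtopology_Times subtopology_subtopology)
  ultimately show "continuous_map (subtopology (prod_topology M (top_of_set I)) (fst \<kappa> \<times> I)) euclideanreal
     (\<lambda>(p, t). (t - \<epsilon>) * S \<kappa> (snd \<kappa> p) t)"
    by simp
next
  fix \<kappa> \<kappa>' and x :: "'a \<times> real"
  assume "\<kappa> \<in> A" "\<kappa>' \<in> A" "x \<in> topspace (prod_topology M (top_of_set I)) \<inter> fst \<kappa> \<times> I \<inter> fst \<kappa>' \<times> I"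
  then obtain p t where x: "x = (p, t)" "\<kappa> \<in> charts_at A p" "\<kappa>' \<in> charts_at A p" "t \<in> J"
    using I by (cases x) (auto simp: charts_at_def)
  show "(case x of (p, t) \<Rightarrow> (t - \<epsilon>) * S \<kappa> (snd \<kappa> p) t) = (case x of (p, t) \<Rightarrow> (t - \<epsilon>) * S \<kappa>' (snd \<kappa>' p) t)"
    by (simp add: x(1) S_chart_independent[OF x(4,2,3)])
next
  fix x assume "x \<in> topspace (prod_topology M (top_of_set I))"
  then obtain p t where x: "x = (p, t)" "p \<in> topspace M" "t \<in> I" by auto
  then obtain \<kappa> where \<kappa>: "\<kappa> \<in> charts_at A p" using cover_M by blast
  then have "SM p t = S \<kappa> (snd \<kappa> p) t" using SM_eq I x(3) by blast
  then show "\<exists>\<kappa>. \<kappa> \<in> A \<and> x \<in> fst \<kappa> \<times> I \<and>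
      (case x of (p, t) \<Rightarrow> (t - \<epsilon>) * SM p t) = (case x of (p, t) \<Rightarrow> (t - \<epsilon>) * S \<kappa> (snd \<kappa> p) t)"
    using x \<kappa> by (intro exI[of _ \<kappa>]) (auto simp: charts_at_def)
qed

lemma maximum_principle:
  assumes \<epsilon>: "0 < \<epsilon>" "\<epsilon> < t1" and t1: "t1 \<in> J" and p1: "p1 \<in> topspace M"
  shows "- real CARD('m) / 2 \<le> (t1 - \<epsilon>) * SM p1 t1"
proof (rule ccontr)
  assume contra: "\<not> ?thesis"
  define w where "w = (\<lambda>(p, t). (t - \<epsilon>) * SM p t)"
  let ?I = "{\<epsilon>..t1}" and ?m = "real CARD('m)"
  let ?X = "prod_topology M (top_of_set ?I)"
  have I: "?I \<subseteq> J" by (rule interval_subset_J[OF \<epsilon>(1) t1])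
  have "compact_space ?X"
    using closed_M by (auto simp: closed_manifold_def compact_space_prod_topology compact_space_subtopology)
  then have "compact (w ` topspace ?X)"
    using image_compactin[OF _ SM_continuous[OF I, of \<epsilon>]] by (simp add: compact_space_def w_def)
  moreover have "w ` topspace ?X \<noteq> {}"
    using p1 \<epsilon> by auto
  ultimately obtain p0 t0 where z0: "p0 \<in> topspace M" "t0 \<in> ?I"
    and min: "\<And>p t. p \<in> topspace M \<Longrightarrow> t \<in> ?I \<Longrightarrow> w (p0, t0) \<le> w (p, t)"
    using compact_attains_inf[of "w ` topspace ?X"] by auto
  have low: "w (p0, t0) < - ?m / 2"
    using min[OF p1, of t1] contra \<epsilon> by (simp add: w_def)
  have m: "?m > 0" by simp
  \<comment> \<open>\<open>w\<close> is 0 at time \<epsilon>, but negative at the minimum.\<close>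
  have t0: "\<epsilon> < t0" "t0 \<in> J"
  proof -
    have "t0 \<noteq> \<epsilon>" using low m by (auto simp: w_def)
    then show "\<epsilon> < t0" using z0 by auto
    show "t0 \<in> J" using I z0 by blast
  qed
  obtain \<kappa> where \<kappa>: "\<kappa> \<in> charts_at A p0"
    using cover_M[OF z0(1)] by blast
  have t0T: "t0 \<in> time_dom T" using t0 J_subset by blast
  obtain \<mu> where \<mu>: "\<mu> \<in> charts_at B (\<phi> t0 p0)"
    by (rule target_chart[OF z0(1) t0T])
  let ?x = "snd \<kappa> p0"
  have in_AB: "\<kappa> \<in> A" "p0 \<in> fst \<kappa>" "\<mu> \<in> B"
    using \<kappa> \<mu> by (auto simp: charts_at_def)
  have zW: "(?x, t0) \<in> dom \<kappa> \<mu>"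
    using in_AB t0 \<mu> by (auto simp: dom_def chart_image_def chart_inv_left charts_at_def)
  interpret rh_local "dom \<kappa> \<mu>" "\<lambda>t. g t \<kappa>" "chart_image \<mu>" "\<gamma> \<mu>" "\<lambda>t. local_rep \<kappa> \<mu> (\<phi> t)" \<alpha>
    by (rule rh_local_dom[OF in_AB(1,3)])
  have Sf_SM: "Sf (y, t) = SM (chart_inv \<kappa> y) t" if "(y, t) \<in> dom \<kappa> \<mu>" for y t
  proof -
    have y: "y \<in> chart_image \<kappa>" "t \<in> J" using that by (auto simp: dom_def)
    have "\<kappa> \<in> charts_at A (chart_inv \<kappa> y)"
      using chart_inv_in[OF y(1)] in_AB by (simp add: charts_at_def)
    then show ?thesis
      by (simp add: Sf_eq_S[OF in_AB(1,3) that] SM_eq[OF y(2)] chart_inv_right[OF y(1)])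
  qed
  have w0: "w (p0, t0) = (t0 - \<epsilon>) * Sf (?x, t0)"
    by (simp add: w_def Sf_SM[OF zW] chart_inv_left in_AB)
  have "\<forall>\<^sub>F y in nhds ?x. Sf (?x, t0) \<le> Sf (y, t0)"
  proof -
    have "\<forall>\<^sub>F y in nhds ?x. y \<in> {y. (y, t0) \<in> dom \<kappa> \<mu>}"
      using zW slice_open by (intro eventually_nhds_in_open) auto
    then show ?thesis
    proof eventually_elim
      case (elim y)
      then have "chart_inv \<kappa> y \<in> topspace M"
        using chart_inv_topspace[OF in_AB(1), of y] by (simp add: dom_def)
      from min[OF this z0(2)] have "(t0 - \<epsilon>) * Sf (?x, t0) \<le> (t0 - \<epsilon>) * Sf (y, t0)"
        using elim by (simp add: w0 Sf_SM) (simp add: w_def)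
      then show ?case using t0 by simp
    qed
  qed
  from Sf_at_spatial_min[OF zW this] have ineq: "2 * (Sf (?x, t0))\<^sup>2 \<le> ?m * dT Sf (?x, t0)" .
  define \<psi> where "\<psi> t = (t - \<epsilon>) * Sf (?x, t)" for t
  have "((\<lambda>t. Sf (?x, t)) has_real_derivative dT Sf (?x, t0)) (at t0)"
    using time_slice[OF smooth_on_differentiable[OF W smooth_Sf zW]]
    by (simp add: has_real_derivative_iff_has_vector_derivative dT_def)
  then have der: "(\<psi> has_real_derivative Sf (?x, t0) + (t0 - \<epsilon>) * dT Sf (?x, t0)) (at t0)"
    unfolding \<psi>_def by (auto intro!: derivative_eq_intros)
  \<comment> \<open>The minimum may lie on the final slice, so only earlier times are compared; this
    yields one sign of the derivative, the one needed.\<close>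
  have "Sf (?x, t0) + (t0 - \<epsilon>) * dT Sf (?x, t0) \<le> 0"
  proof (rule ccontr)
    assume "\<not> ?thesis"
    then obtain \<delta> where \<delta>: "\<delta> > 0" "\<And>h. 0 < h \<Longrightarrow> h < \<delta> \<Longrightarrow> \<psi> (t0 - h) < \<psi> t0"
      using DERIV_pos_inc_left[OF der] by auto
    have "open ((\<lambda>t. (?x, t)) -` dom \<kappa> \<mu>)"
      by (intro open_vimage W continuous_intros)
    then obtain \<eta> where \<eta>: "\<eta> > 0" "ball t0 \<eta> \<subseteq> (\<lambda>t. (?x, t)) -` dom \<kappa> \<mu>"
      using zW open_contains_ball by (metis vimageI)
    \<comment> \<open>Small enough for the increase of \<open>\<psi>\<close>, for staying in the
      chart domain, and for staying after time \<epsilon>.\<close>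
    define h where "h = min (min \<delta> \<eta>) (t0 - \<epsilon>) / 2"
    have h: "0 < h" "h < \<delta>" "h < \<eta>" "h < t0 - \<epsilon>"
      using \<delta>(1) \<eta>(1) t0(1) by (auto simp: h_def)
    have "t0 - h \<in> ball t0 \<eta>"
      using h by (simp add: dist_real_def)
    then have hW: "(?x, t0 - h) \<in> dom \<kappa> \<mu>" using \<eta>(2) by blast
    have "w (p0, t0) \<le> w (p0, t0 - h)"
      using z0 h by (intro min) auto
    then have "\<psi> t0 \<le> \<psi> (t0 - h)"
      by (simp add: \<psi>_def w_def Sf_SM[OF zW] Sf_SM[OF hW] chart_inv_left in_AB)
    then show False using \<delta>(2)[OF h(1,2)] by simp
  qed
  then have "?m * (Sf (?x, t0) + (t0 - \<epsilon>) * dT Sf (?x, t0)) \<le> 0"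
    using m by (simp add: mult_le_0_iff)
  moreover have "(t0 - \<epsilon>) * (2 * (Sf (?x, t0))\<^sup>2) \<le> (t0 - \<epsilon>) * (?m * dT Sf (?x, t0))"
    using ineq t0 by (intro mult_left_mono) auto
  \<comment> \<open>Inserting the differential inequality into m times the derivative leaves S (m +
    2 w) \<le> 0, although both factors are negative.\<close>
  ultimately have "Sf (?x, t0) * (?m + 2 * ((t0 - \<epsilon>) * Sf (?x, t0))) \<le> 0"
    by (simp add: algebra_simps power2_eq_square)
  moreover have "Sf (?x, t0) < 0"
    using low m t0 unfolding w0 by (smt (verit) divide_minus_left mult_nonneg_nonneg zero_le_divide_iff)
  moreover have "?m + 2 * ((t0 - \<epsilon>) * Sf (?x, t0)) < 0"
    using low unfolding w0 by simp
  ultimately show False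
    using mult_neg_neg by fastforce
qed

theorem S_lower_bound:
  assumes t: "t \<in> J" and p: "p \<in> topspace M"
  shows "- real CARD('m) / 2 \<le> t * SM p t"
proof (rule tendsto_lowerbound)
  show "((\<lambda>\<epsilon>. (t - \<epsilon>) * SM p t) \<longlongrightarrow> t * SM p t) (at_right 0)"
    by (auto intro!: tendsto_eq_intros)
  have "\<forall>\<^sub>F \<epsilon> in at_right 0. 0 < \<epsilon> \<and> \<epsilon> < t"
    using t by (auto simp: J_def eventually_at_right_field)
  then show "\<forall>\<^sub>F \<epsilon> in at_right 0. - real CARD('m) / 2 \<le> (t - \<epsilon>) * SM p t"
    by eventually_elim (use maximum_principle t p in auto)
qed simp

end

section \<open>From the lower bound for S to the energy density\<close>

theorem corollary5p4:
  fixes M :: "'a topology" and A :: "('a, 'm::finite) chart set"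
    and N :: "'b topology" and B :: "('b, 'n::finite) chart set"
    and \<gamma> :: "('b, 'n) metric"
    and g :: "real \<Rightarrow> ('a, 'm) metric" and \<phi> :: "real \<Rightarrow> 'a \<Rightarrow> 'b"
    and \<alpha> :: "real \<Rightarrow> real" and \<alpha>\<^sub>0 R\<^sub>0 :: real and T :: ereal
  assumes "closed_manifold M A" and "closed_manifold N B" and "riemannian_metric B \<gamma>"
    and "0 < T"
    and "RH_flow M A N B \<gamma> \<alpha> (time_dom T) g \<phi>"
    and "antimono_on (time_dom T) \<alpha>"
    and "0 < \<alpha>\<^sub>0" and "\<And>t. t \<in> time_dom T \<Longrightarrow> \<alpha>\<^sub>0 \<le> \<alpha> t"
    and "\<And>t p \<kappa>. \<lbrakk>t \<in> time_dom T; p \<in> topspace M; \<kappa> \<in> charts_at A p\<rbrakk> \<Longrightarrow>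
           scalar_curvature (g t \<kappa>) (snd \<kappa> p) \<le> R\<^sub>0"
  shows "\<forall>t\<in>time_dom T. \<forall>p\<in>topspace M. \<forall>\<kappa>\<in>charts_at A p. \<forall>\<mu>\<in>charts_at B (\<phi> t p). 0 < t \<longrightarrow>
           grad_norm_sq (g t \<kappa>) (\<gamma> \<mu>) (local_rep \<kappa> \<mu> (\<phi> t)) (snd \<kappa> p)
             \<le> R\<^sub>0 / \<alpha>\<^sub>0 + real CARD('m) / (2 * \<alpha>\<^sub>0 * t)"
proof (intro ballI impI)
  fix t p \<kappa> \<mu>
  assume t: "t \<in> time_dom T" "0 < t" and p: "p \<in> topspace M"
    and \<kappa>: "\<kappa> \<in> charts_at A p" and \<mu>: "\<mu> \<in> charts_at B (\<phi> t p)"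
  interpret rh_solution M A N B \<gamma> g \<phi> \<alpha> T
    using assms(1-3,5-8) by unfold_locales (auto intro: order_trans[of 0 \<alpha>\<^sub>0])
  let ?x = "snd \<kappa> p" and ?N = "grad_norm_sq (g t \<kappa>) (\<gamma> \<mu>) (local_rep \<kappa> \<mu> (\<phi> t)) (snd \<kappa> p)"
  have tJ: "t \<in> J" using t by (auto simp: J_def time_dom_def)
  have in_AB: "\<kappa> \<in> A" "p \<in> fst \<kappa>" "\<mu> \<in> B"
    using \<kappa> \<mu> by (auto simp: charts_at_def)
  have zW: "(?x, t) \<in> dom \<kappa> \<mu>"
    using in_AB tJ \<mu> by (auto simp: dom_def chart_image_def chart_inv_left charts_at_def)
  interpret L: rh_local "dom \<kappa> \<mu>" "\<lambda>t. g t \<kappa>" "chart_image \<mu>" "\<gamma> \<mu>" "\<lambda>t. local_rep \<kappa> \<mu> (\<phi> t)" \<alpha>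
    by (rule rh_local_dom[OF in_AB(1,3)])
  have "SM p t = scalar_curvature (g t \<kappa>) ?x - \<alpha> t * ?N"
    using L.Sf_eq_curvature[OF zW] Sf_eq_S[OF in_AB(1,3) zW] SM_eq[OF tJ \<kappa>] by simp
  moreover have "- real CARD('m) / (2 * t) \<le> SM p t"
    using S_lower_bound[OF tJ p] t(2) by (simp add: field_simps)
  moreover have "scalar_curvature (g t \<kappa>) ?x \<le> R\<^sub>0"
    by (rule assms(9)[OF t(1) p \<kappa>])
  \<comment> \<open>|\<nabla>\<phi>|^2 is nonnegative, so the coupling can be replaced by its lower
    bound before dividing.\<close>
  moreover have "\<alpha>\<^sub>0 * ?N \<le> \<alpha> t * ?N"
    by (rule mult_right_mono[OF assms(8)[OF t(1)] L.grad_norm_sq_nonneg[OF zW]])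
  ultimately have "\<alpha>\<^sub>0 * ?N \<le> R\<^sub>0 + real CARD('m) / (2 * t)"
    by simp
  then have "?N \<le> (R\<^sub>0 + real CARD('m) / (2 * t)) / \<alpha>\<^sub>0"
    using assms(7) by (simp add: field_simps)
  then show "?N \<le> R\<^sub>0 / \<alpha>\<^sub>0 + real CARD('m) / (2 * \<alpha>\<^sub>0 * t)"
    by (simp add: add_divide_distrib ac_simps)
qed

end
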